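(* Let $d\geq 1$. There exists a constant $C = C(d)$ such that for every integer $n\geq 1$ and every probability measure $\tau$ on the sphere $S^d\subset\mathbb{R}^{d+1}$, there exists a probability measure $\tau'$ on $S^d$ supported on (at most) $n$ points such that \[ \sup_{x\in S^d}\left|\int_{S^d}|x\cdot y|\,d\tau(y) - \int_{S^d}|x\cdot y|\,d\tau'(y)\right| \leq C n^{-\frac{1}{2}-\frac{3}{2d}}. \]
   Context: $S^d=\{x\in\mathbb{R}^{d+1}:|x|=1\}$ is the unit sphere of dimension $d$, and $x\cdot y$ is the Euclidean inner product. *)

theory Defs
  imports "HOL-Probability.Probability"
begin

definition sphere_prob :: "'a::euclidean_space measure \<Rightarrow> bool" where
  "sphere_prob M \<longleftrightarrow> prob_space M \<and> sets M = sets (restrict_space borel (sphere (0::'a) 1))"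

end

theory Submission
  imports Defs
begin

text \<open>
  A finitely supported measure with \<open>N\<close> atoms is replaced, at the price of an error of order
  \<open>N powr (-1/2 - 3/(2d))\<close>, by one with at most \<open>511/512 N\<close> atoms; the errors of the iteration form a
  geometric series dominated by the last step. Allowing nonuniform weights is what makes this work
  for \<open>d \<le> 3\<close>: a single partial coloring suffices in each step.

  In one step, the atoms of weight at most \<open>2/N\<close> are matched into pairs \<open>(p, q)\<close> at distance
  \<open>\<delta> = O(N powr (-1/d))\<close>, and mass is moved inside the pairs according to signs in \<open>{-1, 0, 1}\<close>. The
  function \<open>x \<mapsto> \<bar>x \<bullet> p\<bar> - \<bar>x \<bullet> q\<bar>\<close> is linear with slope at most \<open>2\<delta>\<close> away from the hyperplanes
  orthogonal to \<open>p\<close> and \<open>q\<close>. The error is controlled by chaining along nets of size \<open>O(2^(j d))\<close> in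
  which a point and its parent differ by \<open>2^-j\<close> and are separated by few of the hyperplanes; such
  nets exist by Haussler's packing lemma. The pairs are chosen greedily so that an exponential
  potential of the number of pairs separated by a net point stays bounded, and the signs come from
  the entropy method.
\<close>

section \<open>Set systems of bounded VC dimension\<close>

text \<open>The exponent is the size of one Euclidean norm. At the critical scale
  \<open>\<delta>\<close>, about \<open>M * \<delta>\<close> of the \<open>M\<close> pairs have an
  increment of order \<open>\<delta>\<close>, so a typical constraint has norm
  \<open>sqrt (M * \<delta> ^ 3)\<close>. The moved weights are at most \<open>2 / N\<close>; with
  \<open>M\<close> of order \<open>N\<close> and \<open>\<delta>\<close> of order
  \<open>N powr (-1/d)\<close> the product is of order \<open>N powr (-1/2 - 3/(2d))\<close>. A
  union bound over the nets would add a logarithm. The entropy method avoids it, because it only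
  asks that the costs of all constraints sum to at most \<open>M / 32\<close>. The obstacle is the
  number of pairs separated by a net point \<open>x\<close>: it enters the norm of the constraint at
  \<open>x\<close> and is not bounded by a multiple of \<open>M * \<delta>\<close> uniformly over
  the nets. Only an exponential moment of the ratio \<open>H x\<close> of the two is controlled,
  which suffices because the cost of a constraint grows polynomially in \<open>1 + H x\<close>. The
  fraction 511/512 comes from at least \<open>N / 16\<close> pairs, a sixteenth of which get a
  nonzero sign; in half of these, after a global change of sign, one atom loses all its
  mass.\<close>

definition vc_le :: "nat \<Rightarrow> 'a set set \<Rightarrow> bool" where
  "vc_le d \<F> \<longleftrightarrow> (\<forall>A. finite A \<and> card A = Suc d \<longrightarrow> (\<exists>B\<subseteq>A. \<forall>S\<in>\<F>. S \<inter> A \<noteq> B))"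

lemma vc_le_subset: "vc_le d \<F> \<Longrightarrow> \<G> \<subseteq> \<F> \<Longrightarrow> vc_le d \<G>"
  unfolding vc_le_def by (meson subsetD)

lemma vc_le_restrict:
  assumes "vc_le d \<F>" shows "vc_le d ((\<lambda>S. S \<inter> X) ` \<F>)"
  unfolding vc_le_def
proof (intro allI impI)
  fix A :: "'a set" assume A: "finite A \<and> card A = Suc d"
  then obtain B where B: "B \<subseteq> A" "\<forall>S\<in>\<F>. S \<inter> A \<noteq> B" using assms[unfolded vc_le_def, rule_format, of A] by auto
  show "\<exists>B\<subseteq>A. \<forall>S\<in>(\<lambda>S. S \<inter> X) ` \<F>. S \<inter> A \<noteq> B"
  proof (cases "A \<subseteq> X")
    case True
    then have "S \<inter> X \<inter> A = S \<inter> A" for S by blast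
    then show ?thesis using B by auto
  next
    case False
    then have "S \<inter> X \<inter> A \<noteq> A" for S by blast
    then show ?thesis by (intro exI[of _ A]) simp
  qed
qed

text \<open>The link of \<open>x\<close> collects the sets present both with and without
  \<open>x\<close>. Whatever it cuts out of \<open>A\<close>, the family cuts out of
  \<open>insert x A\<close> with either choice at \<open>x\<close>; so a pattern \<open>B\<close>
  missing on \<open>insert x A\<close> leaves \<open>B - {x}\<close> missing in the link. This
  lowers the dimension in both inductions below.\<close>

lemma vc_le_link:
  assumes V: "vc_le (Suc d) \<F>"
  shows "vc_le d {S. x \<notin> S \<and> S \<in> \<F> \<and> insert x S \<in> \<F>}" (is "vc_le d ?G")
  unfolding vc_le_def
proof (intro allI impI)
  fix A :: "'a set" assume A: "finite A \<and> card A = Suc d"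
  show "\<exists>B\<subseteq>A. \<forall>S\<in>?G. S \<inter> A \<noteq> B"
  proof (cases "x \<in> A")
    case True
    then have "S \<inter> A \<noteq> A" if "S \<in> ?G" for S using that by blast
    then show ?thesis by (intro exI[of _ A]) simp
  next
    case False
    then have "finite (insert x A) \<and> card (insert x A) = Suc (Suc d)" using A by simp
    then obtain B where B: "B \<subseteq> insert x A" "\<forall>S\<in>\<F>. S \<inter> insert x A \<noteq> B"
      using V[unfolded vc_le_def, rule_format, of "insert x A"] by auto
    have "S \<inter> A \<noteq> B - {x}" if "S \<in> ?G" for S
    proof
      assume "S \<inter> A = B - {x}"
      moreover have xS: "x \<notin> S" using that by blast
      ultimately have "S \<inter> insert x A = B - {x}" "insert x S \<inter> insert x A = insert x B" by auto
      then have "S \<inter> insert x A = B \<or> insert x S \<inter> insert x A = B"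
        by (cases "x \<in> B") (simp_all add: insert_absorb)
      then show False using that B(2) by blast
    qed
    moreover have "B - {x} \<subseteq> A" using B(1) by blast
    ultimately show ?thesis by (intro exI[of _ "B-{x}"]) simp
  qed
qed

lemma vc_le_0:
  assumes "vc_le 0 \<F>" "x \<notin> S" "S \<in> \<F>" shows "insert x S \<notin> \<F>"
proof
  assume i: "insert x S \<in> \<F>"
  have "finite {x} \<and> card {x} = Suc 0" by simp
  then obtain B where B: "B \<subseteq> {x}" "\<forall>S\<in>\<F>. S \<inter> {x} \<noteq> B" using assms(1)[unfolded vc_le_def, rule_format, of "{x}"] by auto
  have "S \<inter> {x} = {}" "insert x S \<inter> {x} = {x}" using assms(2) by auto
  moreover have "B = {} \<or> B = {x}" using B(1) by blast
  ultimately show False using bspec[OF B(2) assms(3)] bspec[OF B(2) i] by auto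
qed

text \<open>Deleting a coordinate \<open>x\<close> splits the count exactly: sets merged by the
  projection to \<open>X\<close> are counted once there and once more by the link of
  \<open>x\<close>, whose dimension is smaller. The power stands in for the usual sum of binomial
  coefficients, whose recursion it satisfies as an inequality.\<close>

lemma sauer:
  assumes "finite X" "\<F> \<subseteq> Pow X" "vc_le d \<F>"
  shows "card \<F> \<le> (card X + 1) ^ d"
  using assms
proof (induction X arbitrary: \<F> d rule: finite_induct)
  case empty
  then have "\<F> \<subseteq> {{}}" by auto
  then have "card \<F> \<le> 1" by (metis card.empty card_mono finite.emptyI finite.insertI is_singletonI is_singleton_altdef)
  then show ?case by simp
next
  case (insert x X)
  let ?P = "(\<lambda>S. S \<inter> X) ` \<F>"
  let ?G = "{S. x \<notin> S \<and> S \<in> \<F> \<and> insert x S \<in> \<F>}"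
  have fin: "finite \<F>" using insert.prems(1) insert.hyps(1) by (meson finite_Pow_iff finite_insert rev_finite_subset)
  let ?F0 = "{S\<in>\<F>. x \<notin> S}" let ?F1 = "(\<lambda>S. S - {x}) ` {S\<in>\<F>. x \<in> S}"
  have "\<F> = {S\<in>\<F>. x \<notin> S} \<union> {S\<in>\<F>. x \<in> S}" by blast
  then have "card \<F> = card {S\<in>\<F>. x \<notin> S} + card {S\<in>\<F>. x \<in> S}"
    using fin by (metis (no_types, lifting) card_Un_disjoint disjoint_iff finite_Un mem_Collect_eq)
  also have "card {S\<in>\<F>. x \<in> S} = card ?F1"
    by (rule card_image[symmetric]) (auto simp: inj_on_def)
  also have "card ?F0 + card ?F1 = card (?F0 \<union> ?F1) + card (?F0 \<inter> ?F1)"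
    using fin by (intro card_Un_Int) auto
  also have "?F0 \<union> ?F1 = ?P"
  proof -
    have "S \<inter> X = S - {x}" if "S \<in> \<F>" for S using that insert.prems(1) insert.hyps(2) by auto
    then have "?P = (\<lambda>S. S - {x}) ` \<F>" by (intro image_cong) auto
    moreover have "(\<lambda>S. S - {x}) ` \<F> = ?F0 \<union> ?F1"
    proof (intro set_eqI iffI)
      fix T assume "T \<in> (\<lambda>S. S - {x}) ` \<F>"
      then obtain S where "S \<in> \<F>" "T = S - {x}" by (rule imageE)
      then show "T \<in> ?F0 \<union> ?F1" by (cases "x \<in> S") simp_all
    next
      fix T assume "T \<in> ?F0 \<union> ?F1"
      then show "T \<in> (\<lambda>S. S - {x}) ` \<F>"
      proof
        assume "T \<in> ?F0"
        then have "T = T - {x}" "T \<in> \<F>" by simp_all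
        then show ?thesis by (rule image_eqI)
      next
        assume "T \<in> ?F1"
        then show ?thesis by (rule subsetD[rotated]) (rule image_mono, simp)
      qed
    qed
    ultimately show ?thesis by simp
  qed
  also have "?F0 \<inter> ?F1 = ?G"
  proof -
    have "S \<in> ?F1 \<longleftrightarrow> x \<notin> S \<and> insert x S \<in> \<F>" for S
    proof
      assume "S \<in> ?F1"
      then obtain R where "R \<in> \<F>" "x \<in> R" "S = R - {x}" by blast
      then show "x \<notin> S \<and> insert x S \<in> \<F>" by (auto simp: insert_absorb)
    next
      assume "x \<notin> S \<and> insert x S \<in> \<F>"
      then show "S \<in> ?F1" by (intro image_eqI[of _ _ "insert x S"]) auto
    qed
    then show ?thesis by blast
  qed
  finally have c: "card \<F> = card ?P + card ?G" .
  have P: "card ?P \<le> (card X + 1) ^ d"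
    by (rule insert.IH) (use vc_le_restrict[OF insert.prems(2)] in auto)
  have GX: "?G \<subseteq> Pow X" using insert.prems(1) by auto
  show ?case
  proof (cases d)
    case 0
    then have "vc_le 0 \<F>" using insert.prems(2) by simp
    then have "?G = {}" using vc_le_0[of \<F> x] by auto
    then have "card ?G = 0" by (simp only: card.empty)
    moreover have "card ?P \<le> 1" using P 0 by simp
    ultimately have "card \<F> \<le> 1" using c by linarith
    then show ?thesis using 0 by simp
  next
    case (Suc e)
    have "card ?G \<le> (card X + 1) ^ e"
      by (rule insert.IH[OF GX]) (use vc_le_link[of e \<F>] insert.prems(2) Suc in simp)
    then have "card \<F> \<le> (card X + 1) ^ d + (card X + 1) ^ e" using c P by linarith
    also have "\<dots> = (card X + 2) * (card X + 1) ^ e" using Suc by simp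
    also have "\<dots> \<le> (card X + 2) * (card X + 2) ^ e" by (intro mult_left_mono power_mono) auto
    finally show ?thesis using Suc insert.hyps by simp
  qed
qed

section \<open>Unit distance graphs and packing of set systems\<close>

lemma min_rearrange:
  fixes a0 a1 b0 b1 :: real
  shows "min a0 b0 + min a1 b1 \<le> min (max a0 a1) (max b0 b1) + min (min a0 a1) (min b0 b1)"
  by (auto simp: min_def max_def)

abbreviation edge_weight :: "'a set \<Rightarrow> ('a set \<Rightarrow> real) \<Rightarrow> real" where
  "edge_weight X w \<equiv> \<Sum>x\<in>X. \<Sum>S\<in>Pow (X - {x}). min (w S) (w (insert x S))"

text \<open>Edges of the unit distance graph are weighted by their lighter endpoint. Splitting the weights of
  \<open>S\<close> and \<open>insert z S\<close> into their maximum and minimum lets the induction of the Sauer lemma go through.\<close>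

lemma weighted_edges:
  fixes w :: "'a set \<Rightarrow> real"
  assumes "finite X" "\<And>S. w S \<ge> 0" "vc_le d {S. S \<subseteq> X \<and> w S \<noteq> 0}"
  shows "edge_weight X w \<le> d * (\<Sum>S\<in>Pow X. w S)"
  using assms
proof (induction X arbitrary: w d rule: finite_induct)
  case empty
  then show ?case by simp
next
  case (insert z X)
  have wn: "w S \<ge> 0" for S by (rule insert.prems(1))
  define w1 where "w1 S = max (w S) (w (insert z S))" for S
  define w2 where "w2 S = min (w S) (w (insert z S))" for S
  have V: "vc_le d {S. S \<subseteq> insert z X \<and> w S \<noteq> 0}" by (rule insert.prems(2))
  have V1: "vc_le d {S. S \<subseteq> X \<and> w1 S \<noteq> 0}"
  proof (rule vc_le_subset[OF vc_le_restrict[OF V, of X]], safe)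
    fix S assume S: "S \<subseteq> X" "w1 S \<noteq> 0"
    then have "w S \<noteq> 0 \<or> w (insert z S) \<noteq> 0" by (auto simp: w1_def)
    moreover have "insert z S \<inter> X = S" "S \<inter> X = S" using S insert.hyps by auto
    moreover have "S \<subseteq> insert z X" "insert z S \<subseteq> insert z X" using S by auto
    ultimately show "S \<in> (\<lambda>S. S \<inter> X) ` {S. S \<subseteq> insert z X \<and> w S \<noteq> 0}"
      by (metis (mono_tags, lifting) imageI mem_Collect_eq)
  qed
  have sumPow: "(\<Sum>S\<in>Pow (insert y Y). f S) = (\<Sum>S\<in>Pow Y. f S + f (insert y S))" 
    if "y \<notin> Y" "finite Y" for f :: "'a set \<Rightarrow> real" and y Y
  proof -
    have inj: "inj_on (insert y) (Pow Y)" using that(1) by (auto simp: inj_on_def)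
    have "(\<Sum>S\<in>Pow (insert y Y). f S) = (\<Sum>S\<in>Pow Y. f S) + (\<Sum>S\<in>insert y ` Pow Y. f S)"
      unfolding Pow_insert by (rule sum.union_disjoint) (use that in auto)
    then show ?thesis using inj by (simp add: sum.reindex sum.distrib)
  qed
  have e1: "edge_weight X w1 \<le> d * (\<Sum>S\<in>Pow X. w1 S)"
    by (rule insert.IH) (use V1 wn in \<open>auto simp: w1_def le_max_iff_disj\<close>)
  \<comment> \<open>The support of \<open>w2\<close> lies in the link of \<open>z\<close>, so its
    dimension drops by one, and \<open>w2\<close> vanishes on subsets of \<open>X\<close> if
    \<open>d = 0\<close>. What is saved pays for the edges in direction \<open>z\<close>, whose
    weights are exactly the numbers \<open>w2 S\<close>.\<close>
  have e2: "edge_weight X w2 + (\<Sum>S\<in>Pow X. w2 S) \<le> d * (\<Sum>S\<in>Pow X. w2 S)"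
  proof (cases d)
    case 0
    have "w2 S = 0" if "S \<in> Pow X" for S
    proof (rule ccontr)
      assume "w2 S \<noteq> 0"
      then have "w S \<noteq> 0" "w (insert z S) \<noteq> 0" using wn[of S] wn[of "insert z S"] by (auto simp: w2_def min_def split: if_splits)
      moreover have "z \<notin> S" using that insert.hyps by auto
      ultimately show False using vc_le_0[OF V[unfolded 0], of z S] that by auto
    qed
    then have z: "w2 S = 0" if "S \<subseteq> X" for S using that by simp
    then have "min (w2 S) (w2 (insert x S)) = 0" if "x \<in> X" "S \<in> Pow (X - {x})" for x S
      using that z[of S] z[of "insert x S"] by (simp add: subset_Diff_insert)
    then have "(\<Sum>S\<in>Pow X. w2 S) = 0" 
      and "edge_weight X w2 = 0"
      using z by simp_all
    then show ?thesis by simp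
  next
    case (Suc e)
    have "vc_le e {S. S \<subseteq> X \<and> w2 S \<noteq> 0}"
    proof (rule vc_le_subset[OF vc_le_link[OF V[unfolded Suc], of z]], safe)
      fix S assume S: "S \<subseteq> X" "w2 S \<noteq> 0"
      then show "w S = 0 \<Longrightarrow> False" "w (insert z S) = 0 \<Longrightarrow> False" 
        using wn[of S] wn[of "insert z S"] by (auto simp: w2_def min_def split: if_splits)
    qed (use insert.hyps in auto)
    then have "edge_weight X w2 \<le> e * (\<Sum>S\<in>Pow X. w2 S)"
      by (intro insert.IH) (use wn in \<open>auto simp: w2_def\<close>)
    then show ?thesis using Suc by (simp add: algebra_simps)
  qed
  have "(\<Sum>x\<in>X. \<Sum>S\<in>Pow (insert z X - {x}). min (w S) (w (insert x S)))
     = (\<Sum>x\<in>X. \<Sum>S\<in>Pow (X - {x}). min (w S) (w (insert x S)) + min (w (insert z S)) (w (insert z (insert x S))))"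
  proof (rule sum.cong[OF refl])
    fix x assume "x \<in> X"
    then have "insert z X - {x} = insert z (X - {x})" using insert.hyps by auto
    then show "(\<Sum>S\<in>Pow (insert z X - {x}). min (w S) (w (insert x S))) = 
       (\<Sum>S\<in>Pow (X - {x}). min (w S) (w (insert x S)) + min (w (insert z S)) (w (insert z (insert x S))))"
      using sumPow[of z "X - {x}" "\<lambda>S. min (w S) (w (insert x S))"] insert.hyps by (simp add: insert_commute)
  qed
  \<comment> \<open>Parallel edges in the two copies of the cube over \<open>X\<close> are compared:
    matching the larger endpoint weights with each other, and the smaller ones with each other, does
    not decrease the sum of the minima.\<close>
  also have "\<dots> \<le> (\<Sum>x\<in>X. \<Sum>S\<in>Pow (X - {x}). min (w1 S) (w1 (insert x S)) + min (w2 S) (w2 (insert x S)))"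
    unfolding w1_def w2_def by (intro sum_mono min_rearrange)
  also have "\<dots> = edge_weight X w1 + edge_weight X w2"
    by (simp add: sum.distrib)
  finally have 1: "(\<Sum>x\<in>X. \<Sum>S\<in>Pow (insert z X - {x}). min (w S) (w (insert x S))) \<le> \<dots>" .
  have "edge_weight (insert z X) w
     = (\<Sum>S\<in>Pow X. w2 S) + (\<Sum>x\<in>X. \<Sum>S\<in>Pow (insert z X - {x}). min (w S) (w (insert x S)))"
    using insert.hyps by (simp add: w2_def)
  also have "\<dots> \<le> d * (\<Sum>S\<in>Pow X. w1 S) + d * (\<Sum>S\<in>Pow X. w2 S)" using 1 e1 e2 by linarith
  also have "\<dots> = d * (\<Sum>S\<in>Pow X. w1 S + w2 S)" by (simp add: sum.distrib distrib_left)
  also have "(\<Sum>S\<in>Pow X. w1 S + w2 S) = (\<Sum>S\<in>Pow X. w S + w (insert z S))"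
    by (intro sum.cong) (auto simp: w1_def w2_def)
  also have "\<dots> = (\<Sum>S\<in>Pow (insert z X). w S)" using sumPow insert.hyps by simp
  finally show ?case .
qed

abbreviation minority :: "'a set set \<Rightarrow> 'a \<Rightarrow> real" where
  "minority Q x \<equiv> min (real (card {S\<in>Q. x \<notin> S})) (card {S\<in>Q. x \<in> S})"

abbreviation cut :: "'a \<Rightarrow> 'a set \<Rightarrow> 'a set \<Rightarrow> real" where
  "cut x S T \<equiv> of_bool ((x \<in> S) \<noteq> (x \<in> T))"

text \<open>Double counting of the ordered pairs of members of \<open>Q\<close> separated by a coordinate: if \<open>a + b = q\<close>
  members lie on the two sides of \<open>x\<close>, then \<open>x\<close> separates \<open>2 a b \<le> 2 q min a b\<close> of them.\<close>

lemma split_class: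
  fixes s :: real
  assumes fQ: "finite Q" and fX: "finite X" and QX: "Q \<subseteq> Pow X" 
    and sep: "\<And>S T. S \<in> Q \<Longrightarrow> T \<in> Q \<Longrightarrow> S \<noteq> T \<Longrightarrow> real (card (sym_diff S T)) \<ge> s"
    and same: "\<And>S T. S \<in> Q \<Longrightarrow> T \<in> Q \<Longrightarrow> S \<inter> I = T \<inter> I" and s0: "s \<ge> 0"
  shows "(\<Sum>x\<in>X-I. minority Q x) \<ge> s / 2 * (real (card Q) - 1)"
proof (cases "Q = {}")
  case True then show ?thesis using s0 by simp
next
  case False
  let ?q = "real (card Q)"
  have q: "?q > 0" using False fQ by (simp add: card_gt_0_iff)
  have ab: "2 * ?q * minority Q x \<ge> (\<Sum>S\<in>Q. \<Sum>T\<in>Q. cut x S T)" for x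
  proof -
    let ?a = "real (card {S\<in>Q. x \<notin> S})" and ?b = "real (card {S\<in>Q. x \<in> S})"
    have "Q = {S\<in>Q. x \<notin> S} \<union> {S\<in>Q. x \<in> S}" "{S\<in>Q. x \<notin> S} \<inter> {S\<in>Q. x \<in> S} = {}" by auto
    then have "card Q = card {S\<in>Q. x \<notin> S} + card {S\<in>Q. x \<in> S}"
      using fQ by (metis (no_types, lifting) card_Un_disjoint finite_Un)
    then have qq: "?q = ?a + ?b" by simp
    have "(\<Sum>S\<in>Q. \<Sum>T\<in>Q. cut x S T) = (\<Sum>S\<in>Q. if x \<in> S then ?a else ?b)"
    proof (rule sum.cong[OF refl])
      fix S assume "S \<in> Q"
      have "(\<Sum>T\<in>Q. cut x S T :: real) = real (card {T\<in>Q. (x \<in> S) \<noteq> (x \<in> T)})"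
        using fQ by (simp add: of_bool_def sum.If_cases Int_def)
      also have "{T\<in>Q. (x \<in> S) \<noteq> (x \<in> T)} = (if x \<in> S then {S\<in>Q. x \<notin> S} else {S\<in>Q. x \<in> S})" by auto
      finally show "(\<Sum>T\<in>Q. cut x S T) = (if x \<in> S then ?a else ?b)" by (auto split: if_splits)
    qed
    also have "\<dots> = ?b * ?a + ?a * ?b"
      using fQ by (simp add: sum.If_cases Int_def)
    also have "\<dots> = 2 * (?a * ?b)" by simp
    also have "?a * ?b = min ?a ?b * max ?a ?b" by (simp add: min_def max_def)
    also have "\<dots> \<le> min ?a ?b * ?q" by (rule mult_left_mono) (auto simp: qq)
    finally show ?thesis by (simp add: mult_ac)
  qed
  have "?q * (?q - 1) * s = (\<Sum>S\<in>Q. \<Sum>T\<in>Q - {S}. s)"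
    using fQ q by (simp add: card_Diff_singleton of_nat_diff Suc_le_eq)
  also have "\<dots> \<le> (\<Sum>S\<in>Q. \<Sum>T\<in>Q - {S}. \<Sum>x\<in>X-I. cut x S T)"
  proof (intro sum_mono)
    fix S T assume S: "S \<in> Q" and T: "T \<in> Q - {S}"
    have "s \<le> real (card (sym_diff S T))" using sep S T by auto
    also have "sym_diff S T = {x\<in>X-I. (x \<in> S) \<noteq> (x \<in> T)}"
      using same[of S T] S T QX by blast
    also have "real (card \<dots>) = (\<Sum>x\<in>X-I. cut x S T)"
      using fX by (simp add: of_bool_def sum.If_cases Int_def)
    finally show "s \<le> (\<Sum>x\<in>X-I. cut x S T)" .
  qed
  also have "\<dots> \<le> (\<Sum>S\<in>Q. \<Sum>T\<in>Q. \<Sum>x\<in>X-I. cut x S T)"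
    using fQ by (intro sum_mono sum_mono2) (auto intro: sum_nonneg)
  also have "\<dots> = (\<Sum>S\<in>Q. \<Sum>x\<in>X-I. \<Sum>T\<in>Q. cut x S T)"
    by (intro sum.cong refl sum.swap)
  also have "\<dots> = (\<Sum>x\<in>X-I. \<Sum>S\<in>Q. \<Sum>T\<in>Q. cut x S T)"
    by (rule sum.swap)
  also have "\<dots> \<le> (\<Sum>x\<in>X-I. 2 * ?q * minority Q x)"
    by (intro sum_mono ab)
  also have "\<dots> = 2 * ?q * (\<Sum>x\<in>X-I. minority Q x)"
    by (simp only: sum_distrib_left)
  finally have "?q * ((?q - 1) * s) \<le> ?q * (2 * (\<Sum>x\<in>X-I. minority Q x))"
    by (simp only: mult_ac)
  then have "(?q - 1) * s \<le> 2 * (\<Sum>x\<in>X-I. minority Q x)"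
    by (subst (asm) mult_le_cancel_left_pos[OF q])
  then show ?thesis by (simp add: field_simps)
qed

text \<open>Choosing \<open>t\<close> coordinates and then one more is the same as choosing
  \<open>t + 1\<close> coordinates and marking one of them. In the packing lemma the lower bound
  fixes the \<open>t\<close> coordinates and the upper bound the \<open>t + 1\<close>; this exchange
  lets the two meet.\<close>

lemma sum_subsets_remove:
  fixes g :: "'a set \<Rightarrow> 'a \<Rightarrow> real"
  assumes "finite X"
  shows "(\<Sum>I | I \<subseteq> X \<and> card I = t. \<Sum>x\<in>X-I. g I x) = (\<Sum>A | A \<subseteq> X \<and> card A = Suc t. \<Sum>x\<in>A. g (A - {x}) x)"
proof -
  have fin: "finite {I. I \<subseteq> X \<and> card I = k}" for k using assms by simp
  have f: "finite I" if "I \<subseteq> X" for I using that assms finite_subset by blast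
  have "(\<Sum>I | I \<subseteq> X \<and> card I = t. \<Sum>x\<in>X-I. g I x) 
     = (\<Sum>(I,x)\<in>(SIGMA I:{I. I \<subseteq> X \<and> card I = t}. X - I). g I x)"
    using fin assms by (subst sum.Sigma) auto
  also have "\<dots> = (\<Sum>(A,x)\<in>(SIGMA A:{A. A \<subseteq> X \<and> card A = Suc t}. A). g (A - {x}) x)"
    by (rule sum.reindex_bij_witness[of _ "\<lambda>(A,x). (A - {x}, x)" "\<lambda>(I,x). (insert x I, x)"])
      (auto dest: f simp: insert_absorb)
  also have "\<dots> = (\<Sum>A | A \<subseteq> X \<and> card A = Suc t. \<Sum>x\<in>A. g (A - {x}) x)"
    using fin f by (subst sum.Sigma) auto
  finally show ?thesis .
qed

text \<open>Haussler's packing lemma, in Chazelle's averaging proof: project to a random set of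
  \<open>t + 1\<close> coordinates and compare the edge weights of the projected unit distance graph.\<close>

lemma haussler_packing:
  fixes s :: real
  assumes fX: "finite X" and VX: "V \<subseteq> Pow X" and vc: "vc_le d V" and s: "s > 0"
    and sep: "\<And>S T. S \<in> V \<Longrightarrow> T \<in> V \<Longrightarrow> S \<noteq> T \<Longrightarrow> real (card (sym_diff S T)) \<ge> s"
  shows "real (card V) \<le> 2 * (4 * real d * real (card X) / s + 1) ^ d"
proof -
  define n where "n = card X"
  \<comment> \<open>Chosen so that \<open>d * n / (t + 1)\<close> falls below \<open>s / 4\<close>.
    Then the edge bound absorbs half of \<open>card V\<close>, which produces the factor 2 of the
    conclusion.\<close>
  define t where "t = nat \<lfloor>4 * d * n / s\<rfloor>"
  have fV: "finite V" using VX fX by (meson finite_Pow_iff finite_subset)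
  have t: "real t \<le> 4 * d * n / s" "4 * d * n / s < real t + 1" using s by (auto simp: t_def)
  have pow: "(real t + 1) ^ d \<le> (4 * d * n / s + 1) ^ d" using t by (intro power_mono) auto
  show ?thesis
  proof (cases "t \<ge> n")
    case True
    have "real (card V) \<le> real ((n + 1) ^ d)" using sauer[OF fX VX vc] unfolding n_def of_nat_le_iff .
    also have "\<dots> = (real n + 1) ^ d" by (simp add: add.commute)
    also have "\<dots> \<le> (real t + 1) ^ d" using True by (intro power_mono) auto
    also have "\<dots> \<le> 2 * (4 * d * n / s + 1) ^ d" using pow s by (smt (verit) of_nat_0_le_iff divide_nonneg_pos mult_nonneg_nonneg zero_le_power)
    finally show ?thesis by (simp add: n_def)
  next
    case False
    \<comment> \<open>\<open>w I S\<close> counts the members of \<open>V\<close> with trace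
      \<open>S\<close> on \<open>I\<close>, and \<open>?g I x\<close> is the weight of the edges in
      direction \<open>x\<close> after projection to \<open>insert x I\<close>.\<close>
    define w where "w I S = real (card {T\<in>V. T \<inter> I = S})" for I S
    let ?g = "\<lambda>I x. \<Sum>S\<in>Pow I. min (w (insert x I) S) (w (insert x I) (insert x S))"
    have sumw: "(\<Sum>S\<in>Pow I. w I S) = card V" if "I \<subseteq> X" for I
    proof -
      have "V = (\<Union>S\<in>Pow I. {T\<in>V. T \<inter> I = S})"
        by (intro set_eqI iffI) (simp_all add: UN_iff)
      then have "card V = card (\<Union>S\<in>Pow I. {T\<in>V. T \<inter> I = S})" by simp
      also have "\<dots> = (\<Sum>S\<in>Pow I. card {T\<in>V. T \<inter> I = S})"
        using that fX fV finite_subset by (intro card_UN_disjoint) auto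
      finally show ?thesis by (simp add: w_def)
    qed
    \<comment> \<open>The remaining coordinates split each trace class on \<open>I\<close> with
      total weight at least \<open>s / 2\<close> times its size minus one. Summing over the classes
      loses one per class, and there are at most \<open>(t + 1) ^ d\<close> of them.\<close>
    have lower: "s / 2 * (card V - (real t + 1) ^ d) \<le> (\<Sum>x\<in>X-I. ?g I x)" if I: "I \<subseteq> X" "card I = t" for I
    proof -
      let ?P = "(\<lambda>T. T \<inter> I) ` V"
      have fI: "finite I" using I fX finite_subset by blast
      have cP: "real (card ?P) \<le> (real t + 1) ^ d"
      proof -
        have "card ?P \<le> (card I + 1) ^ d" by (rule sauer[OF fI]) (auto intro: vc_le_restrict vc)
        then have "real (card ?P) \<le> real ((t + 1) ^ d)" using I unfolding of_nat_le_iff by simp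
        then show ?thesis by (simp add: add.commute)
      qed
      have PI: "?P \<subseteq> Pow I" by auto
      have w0: "w I S = 0" if "S \<in> Pow I - ?P" for S
      proof -
        have "{T\<in>V. T \<inter> I = S} = {}" using that by auto
        then show ?thesis unfolding w_def by (simp only: card.empty of_nat_0)
      qed
      have "(\<Sum>S\<in>?P. w I S) = (\<Sum>S\<in>Pow I. w I S)"
        by (rule sum.mono_neutral_left) (use fI PI w0 in simp_all)
      then have "s / 2 * (card V - real (card ?P)) = (\<Sum>S\<in>?P. s / 2 * (w I S - 1))"
        using sumw[OF I(1)] by (simp only: sum_distrib_left[symmetric] sum_subtractf) simp
      also have "\<dots> \<le> (\<Sum>S\<in>?P. \<Sum>x\<in>X-I. min (w (insert x I) S) (w (insert x I) (insert x S)))"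
      proof (rule sum_mono)
        fix S assume S: "S \<in> ?P"
        have "s / 2 * (w I S - 1) \<le> (\<Sum>x\<in>X-I. minority {T\<in>V. T \<inter> I = S} x)"
          unfolding w_def by (rule split_class) (use fV fX VX sep s in auto)
        also have "\<dots> = (\<Sum>x\<in>X-I. min (w (insert x I) S) (w (insert x I) (insert x S)))"
        proof (rule sum.cong[OF refl])
          fix x assume x: "x \<in> X - I"
          then have xS: "x \<notin> S" using S by auto
          have "{T\<in>{T\<in>V. T \<inter> I = S}. x \<notin> T} = {T\<in>V. T \<inter> insert x I = S}" using x xS by auto
          moreover have "{T\<in>{T\<in>V. T \<inter> I = S}. x \<in> T} = {T\<in>V. T \<inter> insert x I = insert x S}" using x xS by auto
          ultimately show "minority {T\<in>V. T \<inter> I = S} x =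
             min (w (insert x I) S) (w (insert x I) (insert x S))" unfolding w_def by simp
        qed
        finally show "s / 2 * (w I S - 1) \<le> (\<Sum>x\<in>X-I. min (w (insert x I) S) (w (insert x I) (insert x S)))" .
      qed
      also have "\<dots> \<le> (\<Sum>S\<in>Pow I. \<Sum>x\<in>X-I. min (w (insert x I) S) (w (insert x I) (insert x S)))"
        using fI PI by (intro sum_mono2) (auto simp: w_def intro!: sum_nonneg)
      also have "\<dots> = (\<Sum>x\<in>X-I. ?g I x)" by (rule sum.swap)
      finally have "s / 2 * (card V - real (card ?P)) \<le> (\<Sum>x\<in>X-I. ?g I x)" .
      moreover have "s / 2 * (card V - (real t + 1) ^ d) \<le> s / 2 * (card V - real (card ?P))"
        using cP s by (intro mult_left_mono) auto
      ultimately show ?thesis by linarith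
    qed
    have upper: "(\<Sum>x\<in>A. ?g (A - {x}) x) \<le> d * real (card V)" if A: "A \<subseteq> X" "card A = Suc t" for A
    proof -
      have fA: "finite A" using A fX finite_subset by blast
      have "vc_le d {S. S \<subseteq> A \<and> w A S \<noteq> 0}"
        by (rule vc_le_subset[OF vc_le_restrict[OF vc, of A]]) (auto simp: w_def fV)
      then have "edge_weight A (w A) \<le> d * (\<Sum>S\<in>Pow A. w A S)"
        by (intro weighted_edges[OF fA]) (auto simp: w_def)
      moreover have "(\<Sum>x\<in>A. ?g (A - {x}) x) = edge_weight A (w A)"
        by (rule sum.cong[OF refl]) (simp add: insert_absorb)
      ultimately show ?thesis using sumw[OF A(1)] by simp
    qed
    have "(n choose t) * (s / 2 * (card V - (real t + 1) ^ d)) = (\<Sum>I | I \<subseteq> X \<and> card I = t. s / 2 * (card V - (real t + 1) ^ d))"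
      using fX by (simp add: n_subsets n_def)
    also have "\<dots> \<le> (\<Sum>I | I \<subseteq> X \<and> card I = t. \<Sum>x\<in>X-I. ?g I x)"
      by (intro sum_mono lower) auto
    also have "\<dots> = (\<Sum>A | A \<subseteq> X \<and> card A = Suc t. \<Sum>x\<in>A. ?g (A - {x}) x)"
      by (rule sum_subsets_remove[OF fX])
    also have "\<dots> \<le> (\<Sum>A | A \<subseteq> X \<and> card A = Suc t. d * real (card V))"
      by (intro sum_mono upper) auto
    also have "\<dots> = (n choose Suc t) * (d * real (card V))"
      using fX by (simp add: n_subsets n_def)
    finally have 1: "(n choose t) * (s / 2 * (card V - (real t + 1) ^ d)) \<le> (n choose Suc t) * (d * real (card V))" .
    have "real (n choose Suc t) * (t + 1) = real (n choose t) * (n - t)"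
    proof -
      obtain m where m: "n = Suc m" using False by (cases n) auto
      have "Suc t * (n choose Suc t) = (n - t) * (n choose t)"
        using Suc_times_binomial[of t m] binomial_absorb_comp[of n t] m by simp
      then have "real (Suc t * (n choose Suc t)) = real ((n - t) * (n choose t))" by (rule arg_cong)
      then show ?thesis by (simp only: of_nat_mult mult.commute Suc_eq_plus1)
    qed
    also have "\<dots> \<le> real (n choose t) * n" by (intro mult_left_mono) auto
    finally have 2: "real (n choose Suc t) * (real t + 1) \<le> real (n choose t) * n" by (simp add: add.commute)
    have ch: "real (n choose t) > 0" using False by simp
    have dn: "4 * d * n \<le> s * (real t + 1)" using t(2) s by (simp add: field_simps)
    have "(real (n choose t) * (real t + 1)) * (s / 2 * (card V - (real t + 1) ^ d)) \<le> (real (n choose Suc t) * (real t + 1)) * (d * real (card V))"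
      using mult_right_mono[OF 1, of "real t + 1"] by (simp add: mult_ac)
    also have "\<dots> \<le> (real (n choose t) * n) * (d * real (card V))"
      by (rule mult_right_mono[OF 2]) auto
    finally have "real (n choose t) * ((real t + 1) * (s / 2 * (card V - (real t + 1) ^ d))) \<le> real (n choose t) * (n * (d * real (card V)))"
      by (simp only: mult_ac)
    then have 3: "(real t + 1) * (s / 2 * (card V - (real t + 1) ^ d)) \<le> n * (d * real (card V))"
      by (subst (asm) mult_le_cancel_left_pos[OF ch])
    define D where "D = card V - (real t + 1) ^ d"
    have "(s * (real t + 1)) * (2 * D) = 4 * ((real t + 1) * (s / 2 * D))" by simp
    also have "\<dots> \<le> 4 * (n * (d * real (card V)))" using 3 unfolding D_def by (intro mult_left_mono) simp_all
    also have "\<dots> = (4 * d * n) * real (card V)" by simp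
    also have "\<dots> \<le> (s * (real t + 1)) * real (card V)" by (rule mult_right_mono[OF dn]) auto
    finally have "2 * D \<le> real (card V)"
      using s by (subst (asm) mult_le_cancel_left_pos) auto
    then have "2 * (card V - (real t + 1) ^ d) \<le> real (card V)" unfolding D_def .
    then show ?thesis using pow by (simp add: n_def)
  qed
qed

section \<open>Nets of the sphere adapted to finitely many points\<close>

text \<open>Vectors of an indexed family may repeat. A repetition disappears in the image, so it is
  treated apart, with coefficients 1 and -1.\<close>

lemma family_dependent:
  fixes v :: "'e \<Rightarrow> 'a::euclidean_space"
  assumes fA: "finite A" and card: "card A > DIM('a)"
  shows "\<exists>c. (\<exists>e\<in>A. c e \<noteq> 0) \<and> (\<Sum>e\<in>A. c e *\<^sub>R v e) = 0"
proof (cases "inj_on v A")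
  case True
  then have "card (v ` A) > DIM('a)" using card by (simp add: card_image)
  then have "dependent (v ` A)" using fA by (intro dependent_biggerset) auto
  then obtain u where u: "\<exists>w\<in>v ` A. u w \<noteq> 0" "(\<Sum>w\<in>v ` A. u w *\<^sub>R w) = 0"
    using dependent_finite[of "v ` A"] fA by auto
  have "(\<Sum>e\<in>A. u (v e) *\<^sub>R v e) = 0" using u(2) True by (simp add: sum.reindex)
  then show ?thesis using u(1) by (intro exI[of _ "\<lambda>e. u (v e)"]) simp
next
  case False
  then obtain e f where ef: "e \<in> A" "f \<in> A" "e \<noteq> f" "v e = v f" unfolding inj_on_def by auto
  let ?c = "\<lambda>x. if x = e then 1 else if x = f then - 1 else (0::real)"
  have "(\<Sum>x\<in>A. ?c x *\<^sub>R v x) = (\<Sum>x\<in>{e,f}. ?c x *\<^sub>R v x)"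
    by (rule sum.mono_neutral_right) (use fA ef in auto)
  also have "\<dots> = 0" using ef by simp
  finally show ?thesis using ef by (intro exI[of _ ?c]) auto
qed

text \<open>On a chart \<open>x \<bullet> b > 0\<close> homogeneous halfspaces act like affine ones in one dimension less.\<close>

lemma vc_le_halfspaces:
  fixes v :: "'e \<Rightarrow> 'a::euclidean_space"
  assumes b: "b \<noteq> 0"
  shows "vc_le (DIM('a) - 1) {{e. x \<bullet> v e \<ge> 0} | x. x \<bullet> b > 0}"
  unfolding vc_le_def
proof (intro allI impI)
  fix A :: "'e set" assume A: "finite A \<and> card A = Suc (DIM('a) - 1)"
  show "\<exists>B\<subseteq>A. \<forall>S\<in>{{e. x \<bullet> v e \<ge> 0} | x. x \<bullet> b > 0}. S \<inter> A \<noteq> B"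
  proof (rule ccontr)
    assume "\<not> ?thesis"
    then have sh: "\<exists>x. x \<bullet> b > 0 \<and> {e. x \<bullet> v e \<ge> 0} \<inter> A = B" if "B \<subseteq> A" for B
      using that by auto
    have real: "\<exists>x. x \<bullet> b > 0 \<and> (\<forall>e\<in>A. x \<bullet> v e \<ge> 0 \<longleftrightarrow> P e)" for P
    proof -
      obtain x where x: "x \<bullet> b > 0" "{e. x \<bullet> v e \<ge> 0} \<inter> A = {e\<in>A. P e}" using sh[of "{e\<in>A. P e}"] by auto
      have "x \<bullet> v e \<ge> 0 \<longleftrightarrow> P e" if "e \<in> A" for e
        using that x(2) by (auto simp: set_eq_iff)
      then show ?thesis using x(1) by auto
    qed
    \<comment> \<open>The chart vector \<open>b\<close> joins the family under the index
      \<open>None\<close>; together with the \<open>DIM('a)\<close> vectors indexed by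
      \<open>A\<close> it forces a linear relation.\<close>
    let ?A = "insert None (Some ` A)" and ?v = "\<lambda>z. case z of None \<Rightarrow> b | Some e \<Rightarrow> v e"
    have "card ?A = Suc (card A)" using A by (subst card_insert_disjoint) (auto simp: card_image)
    then have "card ?A > DIM('a)" using A by simp
    then obtain c where c: "\<exists>e\<in>?A. c e \<noteq> 0" "(\<Sum>e\<in>?A. c e *\<^sub>R ?v e) = 0"
      using family_dependent[of ?A ?v] A by auto
    define k where "k e = c (Some e)" for e
    have "(\<Sum>e\<in>?A. c e *\<^sub>R ?v e) = c None *\<^sub>R b + (\<Sum>e\<in>A. k e *\<^sub>R v e)"
      using A by (simp add: sum.reindex k_def)
    then have sum0: "(\<Sum>e\<in>A. k e *\<^sub>R v e) = (- c None) *\<^sub>R b" using c(2) by (simp add: add_eq_0_iff)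
    have eq: "(\<Sum>e\<in>A. k e * (x \<bullet> v e)) = - c None * (x \<bullet> b)" for x
      using arg_cong[OF sum0, of "\<lambda>z. x \<bullet> z"] by (simp add: inner_sum_right)
    have nz: "\<exists>e\<in>A. k e \<noteq> 0"
    proof (rule ccontr)
      assume "\<not> ?thesis"
      then have "c None \<noteq> 0" "(\<Sum>e\<in>A. k e *\<^sub>R v e) = 0" using c(1) by (auto simp: k_def)
      then show False using sum0 b by simp
    qed
    \<comment> \<open>As in Radon's theorem, the relation is tested on points realizing its own sign
      pattern and the opposite one. \<open>x\<close> makes every term nonnegative and
      \<open>z\<close> every term nonpositive, so \<open>c None = 0\<close> because
      \<open>x \<bullet> b\<close> and \<open>z \<bullet> b\<close> are positive. Then all terms
      vanish; if \<open>k e \<noteq> 0\<close>, both points lie on the hyperplane of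
      \<open>v e\<close>, hence in its closed halfspace, which gives \<open>k e \<ge> 0\<close> and
      \<open>k e \<le> 0\<close>.\<close>
    obtain x where x: "x \<bullet> b > 0" "\<And>e. e \<in> A \<Longrightarrow> x \<bullet> v e \<ge> 0 \<longleftrightarrow> k e \<ge> 0" using real[of "\<lambda>e. k e \<ge> 0"] by auto
    obtain z where z: "z \<bullet> b > 0" "\<And>e. e \<in> A \<Longrightarrow> z \<bullet> v e \<ge> 0 \<longleftrightarrow> k e \<le> 0" using real[of "\<lambda>e. k e \<le> 0"] by auto
    have tx: "k e * (x \<bullet> v e) \<ge> 0" if "e \<in> A" for e
      using x(2)[OF that] by (auto simp: zero_le_mult_iff)
    have tz: "k e * (z \<bullet> v e) \<le> 0" if "e \<in> A" for e
      using z(2)[OF that] by (auto simp: mult_le_0_iff)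
    have "(\<Sum>e\<in>A. k e * (x \<bullet> v e)) \<ge> 0" by (intro sum_nonneg tx)
    then have "- c None * (x \<bullet> b) \<ge> 0" unfolding eq[of x] .
    then have "c None \<le> 0" using x(1) by (simp add: mult_le_0_iff)
    moreover have "(\<Sum>e\<in>A. k e * (z \<bullet> v e)) \<le> 0" by (intro sum_nonpos tz)
    then have "- c None * (z \<bullet> b) \<le> 0" unfolding eq[of z] .
    then have "c None \<ge> 0" using z(1) by (simp add: zero_le_mult_iff)
    ultimately have c0: "c None = 0" by simp
    have "(\<Sum>e\<in>A. k e * (x \<bullet> v e)) = 0" "(\<Sum>e\<in>A. - (k e * (z \<bullet> v e))) = 0" using eq c0 by (simp_all add: sum_negf)
    then have zx: "k e * (x \<bullet> v e) = 0" and zz: "k e * (z \<bullet> v e) = 0" if "e \<in> A" for e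
      using that A tx tz sum_nonneg_eq_0_iff[of A "\<lambda>e. k e * (x \<bullet> v e)"] sum_nonneg_eq_0_iff[of A "\<lambda>e. - (k e * (z \<bullet> v e))"]
      by auto
    obtain e where e: "e \<in> A" "k e \<noteq> 0" using nz by blast
    then have "x \<bullet> v e = 0" "z \<bullet> v e = 0" using zx zz by auto
    then show False using x(2)[OF e(1)] z(2)[OF e(1)] e(2) by auto
  qed
qed

lemma maximal_separated:
  assumes fF: "finite F" and sym: "\<And>S T. P S T \<Longrightarrow> P T S"
  shows "\<exists>V\<subseteq>F. (\<forall>S\<in>V. \<forall>T\<in>V. S \<noteq> T \<longrightarrow> P S T) \<and> (\<forall>S\<in>F. \<exists>T\<in>V. S = T \<or> \<not> P S T)"
proof -
  define M where "M = {V. V \<subseteq> F \<and> (\<forall>S\<in>V. \<forall>T\<in>V. S \<noteq> T \<longrightarrow> P S T)}"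
  have "M \<subseteq> Pow F" by (auto simp: M_def)
  then have "finite M" using fF finite_subset by blast
  moreover have "{} \<in> M" by (simp add: M_def)
  then have "M \<noteq> {}" by auto
  ultimately obtain V where V: "V \<in> M" "\<And>W. W \<in> M \<Longrightarrow> V \<subseteq> W \<Longrightarrow> V = W"
    using finite_has_maximal[of M] by metis
  have VF: "V \<subseteq> F" and VP: "\<And>S T. S \<in> V \<Longrightarrow> T \<in> V \<Longrightarrow> S \<noteq> T \<Longrightarrow> P S T" using V(1) by (simp_all add: M_def)
  have "\<exists>T\<in>V. S = T \<or> \<not> P S T" if S: "S \<in> F" for S
  proof (rule ccontr)
    assume "\<not> ?thesis"
    then have n: "\<And>T. T \<in> V \<Longrightarrow> S \<noteq> T \<and> P S T" by simp
    have "insert S V \<in> M"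
      unfolding M_def using VF S n VP sym by simp
    then have "V = insert S V" using V(2) by (simp add: subset_insertI)
    then have "S \<in> V" by (metis insertI1)
    then show False using n[of S] by simp
  qed
  then show ?thesis using VF VP by (intro exI[of _ V]) simp
qed

section \<open>Nets on one chart\<close>

abbreviation grid_cut :: "nat \<Rightarrow> real \<Rightarrow> real \<Rightarrow> int set" where
  "grid_cut K a b \<equiv> {t\<in>{- int K..int K}. (a \<ge> real_of_int t) \<noteq> (b \<ge> real_of_int t)}"

text \<open>The integers in the half-open interval between \<open>a\<close> and \<open>b\<close> all
  tell them apart, and rounding costs 1. A distance thus becomes the size of a symmetric difference,
  so that one packing argument controls the metric and the combinatorial distance to the net
  together.\<close>

lemma grid_separation:
  fixes a b :: real and K :: nat
  assumes "\<bar>a\<bar> \<le> K" "\<bar>b\<bar> \<le> K"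
  shows "\<bar>a - b\<bar> - 1 \<le> card (grid_cut K a b)"
proof -
  have *: "b - a - 1 \<le> card (grid_cut K a b)" 
    if ab: "a \<le> b" "\<bar>a\<bar> \<le> K" "\<bar>b\<bar> \<le> K" for a b :: real
  proof -
    have "{\<lfloor>a\<rfloor> + 1..\<lfloor>b\<rfloor>} \<subseteq> grid_cut K a b"
    proof
      fix t assume t: "t \<in> {\<lfloor>a\<rfloor> + 1..\<lfloor>b\<rfloor>}"
      then have 1: "real_of_int t \<le> b" by (simp add: le_floor_iff)
      have 2: "a < real_of_int t" using t by (simp add: floor_less_iff[symmetric])
      have "- real K < real_of_int t" "real_of_int t \<le> real K" using 1 2 ab by linarith+
      then have "- int K \<le> t" "t \<le> int K" by linarith+
      then show "t \<in> grid_cut K a b"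
        using 1 2 by auto
    qed
    then have "card {\<lfloor>a\<rfloor> + 1..\<lfloor>b\<rfloor>} \<le> card (grid_cut K a b)"
      by (intro card_mono finite_subset[of "grid_cut K a b" "{- int K..int K}"]) auto
    moreover have "b - a - 1 \<le> real (card {\<lfloor>a\<rfloor> + 1..\<lfloor>b\<rfloor>})" by simp linarith
    ultimately show ?thesis by linarith
  qed
  have sw: "grid_cut K a b = grid_cut K b a" by auto
  show ?thesis
  proof (cases "a \<le> b")
    case True then show ?thesis using *[of a b] assms by simp
  next
    case False
    then have "\<bar>a - b\<bar> = a - b" by simp
    then show ?thesis unfolding sw using *[of b a] False assms by linarith
  qed
qed

text \<open>Radial projection is Lipschitz outside the open unit ball: one
  \<open>norm (u - w)\<close> pays for the change of the vector, another for the change of its norm.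
  It carries distances on the affine chart back to the sphere.\<close>

lemma norm_sgn_diff_le:
  fixes u w :: "'a::real_normed_vector"
  assumes "norm u \<ge> 1" "norm w \<ge> 1"
  shows "norm (sgn u - sgn w) \<le> 2 * norm (u - w)"
proof -
  have u0: "norm u \<noteq> 0" "norm w \<noteq> 0" using assms by auto
  have "sgn u - sgn w = (1 / norm u) *\<^sub>R (u - w) + (1 / norm u - 1 / norm w) *\<^sub>R w"
    by (simp add: sgn_div_norm algebra_simps inverse_eq_divide)
  then have "norm (sgn u - sgn w) \<le> norm ((1 / norm u) *\<^sub>R (u - w)) + norm ((1 / norm u - 1 / norm w) *\<^sub>R w)"
    by (metis norm_triangle_ineq)
  also have "norm ((1 / norm u) *\<^sub>R (u - w)) \<le> norm (u - w)"
  proof -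
    have "norm (u - w) * 1 \<le> norm (u - w) * norm u" using assms by (intro mult_left_mono) auto
    then show ?thesis using u0 assms by (simp add: divide_le_eq)
  qed
  also have "norm ((1 / norm u - 1 / norm w) *\<^sub>R w) = \<bar>norm w - norm u\<bar> / norm u"
  proof -
    have "(1 / norm u - 1 / norm w) * norm w = (norm w - norm u) / norm u" using u0 by (simp add: field_simps)
    then have "\<bar>(1 / norm u - 1 / norm w) * norm w\<bar> = \<bar>(norm w - norm u) / norm u\<bar>" by simp
    then show ?thesis by (simp add: abs_mult)
  qed
  also have "\<dots> \<le> norm (u - w)"
  proof -
    have "\<bar>norm w - norm u\<bar> \<le> norm (u - w)" using norm_triangle_ineq3[of w u] by (simp add: norm_minus_commute)
    moreover have "\<bar>norm w - norm u\<bar> * 1 \<le> \<bar>norm w - norm u\<bar> * norm u" using assms by (intro mult_left_mono) auto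
    then have "\<bar>norm w - norm u\<bar> / norm u \<le> \<bar>norm w - norm u\<bar>" using u0 assms by (simp add: divide_le_eq)
    ultimately show ?thesis by linarith
  qed
  finally show ?thesis by simp
qed

abbreviation switching :: "'i set \<Rightarrow> ('i \<Rightarrow> 'a::euclidean_space) \<Rightarrow> 'a \<Rightarrow> 'a \<Rightarrow> 'i set" where
  "switching I y x x' \<equiv> {i\<in>I. (x \<bullet> y i \<ge> 0) \<noteq> (x' \<bullet> y i \<ge> 0)}"

text \<open>The ground set consists of the points \<open>y i\<close> and a grid of extra halfspaces
  that read off the coordinates of the central projection of \<open>x\<close>. Points with nearby
  traces are then close in both senses, so a maximal \<open>s\<close>-separated family of traces
  yields a net. Haussler's lemma, in dimension \<open>DIM('a) - 1\<close> thanks to the chart,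
  bounds its size without a logarithm.\<close>

lemma chart_net:
  fixes y :: "'i \<Rightarrow> 'a::euclidean_space" and b :: 'a and r :: real
  defines "L \<equiv> real DIM('a)"
  assumes fI: "finite I" and b: "norm b = 1" and r: "0 < r" "r \<le> 1"
  shows "\<exists>T. finite T \<and> T \<subseteq> sphere 0 1 \<and> card T \<le> 2 * (8 * L * (1 + 3 * L) / r + 1) ^ (DIM('a) - 1) \<and>
    (\<forall>x\<in>sphere 0 1. x \<bullet> b \<ge> 1 / L \<longrightarrow> (\<exists>x'\<in>T. norm (x - x') \<le> 3 * L\<^sup>2 * r \<and>
        card (switching I y x x') \<le> r * card I))"
proof -
  have L: "L \<ge> 1" unfolding L_def using DIM_positive[where 'a='a] by linarith
  \<comment> \<open>\<open>K \<ge> card I\<close> keeps \<open>card X\<close> of order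
    \<open>K\<close>, so that \<open>card X / s\<close> is of order \<open>1 / r\<close> whatever
    the size of \<open>I\<close>; \<open>K \<ge> 1 / r\<close> makes the rounding error 1 of the
    grid at most \<open>r * K\<close>.\<close>
  define K where "K = max (card I) (nat \<lceil>1 / r\<rceil>)"
  have K1: "1 / r \<le> K" unfolding K_def by linarith
  have K0: "real K \<ge> 1" using K1 r by (meson le_divide_eq_1_pos order_trans)
  define s where "s = r * K / 2"
  have s0: "s > 0" using r K0 by (simp add: s_def)
  \<comment> \<open>If \<open>K\<close> exceeds \<open>card I\<close>, then
    \<open>s \<le> 1\<close>, and fewer than \<open>s\<close> switches means none.\<close>
  have small: "real c \<le> r * card I" if "real c < s" for c :: nat
  proof (cases "K = card I")
    case True
    then show ?thesis using that r unfolding s_def by simp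
  next
    case False
    then have "K = nat \<lceil>1 / r\<rceil>" unfolding K_def by linarith
    then have "real K \<le> 1 / r + 1" using r by simp
    then have "r * K \<le> 2" using r by (simp add: field_simps)
    then have "c = 0" using that unfolding s_def by linarith
    then show ?thesis using r by simp
  qed
  define X where "X = Inl ` I \<union> Inr ` ((Basis::'a set) \<times> {- int K..int K})"
  \<comment> \<open>On the chart, the halfspace of \<open>(l, t)\<close> contains \<open>x\<close>
    exactly when \<open>t \<le> (x \<bullet> l) / (x \<bullet> b) * K / L\<close>. The projected
    coordinates are at most \<open>L\<close> in absolute value there, so this scaling fits the range
    of the grid.\<close>
  define v :: "'i + 'a \<times> int \<Rightarrow> 'a" where 
    "v e = (case e of Inl i \<Rightarrow> y i | Inr (l, t) \<Rightarrow> l - (L * real_of_int t / K) *\<^sub>R b)" for e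
  define G where "G x = {e\<in>X. x \<bullet> v e \<ge> 0}" for x
  define Ch where "Ch = {x\<in>sphere 0 1. x \<bullet> b \<ge> 1 / L}"
  have fX: "finite X" using fI by (simp add: X_def)
  have "card X \<le> card (Inl ` I :: ('i + 'a \<times> int) set) + card (Inr ` ((Basis::'a set) \<times> {- int K..int K}) :: ('i + 'a \<times> int) set)"
    unfolding X_def by (rule card_Un_le)
  also have "\<dots> = card I + DIM('a) * (2 * K + 1)"
    by (simp add: card_image card_cartesian_product nat_add_distrib nat_mult_distrib)
  finally have "card X \<le> card I + DIM('a) * (2 * K + 1)" .
  then have "real (card X) \<le> real (card I) + L * (2 * real K + 1)"
    unfolding L_def by (metis (no_types, lifting) of_nat_1 of_nat_add of_nat_mono of_nat_mult of_nat_numeral)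
  also have "\<dots> \<le> real K + L * (3 * K)" using K0 L by (intro add_mono mult_left_mono) (auto simp: K_def)
  finally have cX: "real (card X) \<le> (1 + 3 * L) * K" by (simp add: algebra_simps)
  let ?P = "\<lambda>S T. real (card (sym_diff S T)) \<ge> s"
  have GX: "G x \<subseteq> X" for x unfolding G_def by (rule Collect_restrict)
  then have "G ` Ch \<subseteq> Pow X" by (intro image_subsetI) simp
  then have "finite (G ` Ch)" using fX by (meson finite_Pow_iff finite_subset)
  moreover have "?P T S" if "?P S T" for S T :: "('i + 'a \<times> int) set" using that by (simp add: Un_commute)
  ultimately have "\<exists>V\<subseteq>G ` Ch. (\<forall>S\<in>V. \<forall>T\<in>V. S \<noteq> T \<longrightarrow> ?P S T) \<and> (\<forall>S\<in>G ` Ch. \<exists>T\<in>V. S = T \<or> \<not> ?P S T)"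
    by (rule maximal_separated)
  then obtain V where V0: "V \<subseteq> G ` Ch \<and> (\<forall>S\<in>V. \<forall>T\<in>V. S \<noteq> T \<longrightarrow> ?P S T) \<and> (\<forall>S\<in>G ` Ch. \<exists>T\<in>V. S = T \<or> \<not> ?P S T)"
    by (elim exE)
  note V = V0[THEN conjunct1] V0[THEN conjunct2, THEN conjunct1, rule_format] V0[THEN conjunct2, THEN conjunct2, rule_format]
  have VX: "V \<subseteq> Pow X" using V(1) \<open>G ` Ch \<subseteq> Pow X\<close> by (rule subset_trans)
  have vc: "vc_le (DIM('a) - 1) V"
  proof (rule vc_le_subset[OF vc_le_restrict[OF vc_le_halfspaces]])
    show "b \<noteq> 0" using b by auto
    show "V \<subseteq> (\<lambda>S. S \<inter> X) ` {{e. x \<bullet> v e \<ge> 0} | x. x \<bullet> b > 0}"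
    proof
      fix S assume "S \<in> V"
      then obtain x where x: "x \<in> Ch" "S = G x" using V(1) by auto
      have "1 / L > 0" using L by simp
      then have "x \<bullet> b > 0" using x unfolding Ch_def by (simp del: zero_less_divide_1_iff)
      moreover have "S = {e. x \<bullet> v e \<ge> 0} \<inter> X" using x(2) by (auto simp: G_def)
      ultimately show "S \<in> (\<lambda>S. S \<inter> X) ` {{e. x \<bullet> v e \<ge> 0} | x. x \<bullet> b > 0}" by blast
    qed
  qed
  have cV: "real (card V) \<le> 2 * (8 * L * (1 + 3 * L) / r + 1) ^ (DIM('a) - 1)"
  proof -
    have "real (card V) \<le> 2 * (4 * real (DIM('a) - 1) * card X / s + 1) ^ (DIM('a) - 1)"
      by (rule haussler_packing[OF fX VX vc s0 V(2)])
    also have "\<dots> \<le> 2 * (8 * L * (1 + 3 * L) / r + 1) ^ (DIM('a) - 1)"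
    proof -
      have "4 * real (DIM('a) - 1) * card X / s \<le> 4 * L * ((1 + 3 * L) * K) / s"
        using s0 cX L by (intro divide_right_mono mult_mono) (auto simp: L_def)
      also have "4 * L * ((1 + 3 * L) * K) / s = 8 * L * (1 + 3 * L) / r"
        using K0 r by (simp add: s_def field_simps)
      finally show ?thesis using s0 by (intro mult_left_mono power_mono add_right_mono) auto
    qed
    finally show ?thesis .
  qed
  have fV: "finite V" using VX fX by (meson finite_Pow_iff finite_subset)
  obtain h where h: "\<And>S. S \<in> V \<Longrightarrow> h S \<in> Ch \<and> G (h S) = S"
  proof -
    have "\<forall>S\<in>V. \<exists>x. x \<in> Ch \<and> G x = S" using V(1) by auto
    then show ?thesis using that by (metis bchoice)
  qed
  have main: "norm (x - x') \<le> 3 * L\<^sup>2 * r \<and> card (switching I y x x') \<le> r * card I"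
    if x: "x \<in> Ch" and x': "x' \<in> Ch" and lt: "real (card (sym_diff (G x) (G x'))) < s" for x x'
  proof -
    let ?D = "{e\<in>X. (x \<bullet> v e \<ge> 0) \<noteq> (x' \<bullet> v e \<ge> 0)}"
    have "sym_diff (G x) (G x') = ?D" by (auto simp: G_def)
    then have D: "real (card ?D) < s" using lt by simp
    have fD: "finite ?D" using fX by simp
    have "Inl ` switching I y x x' \<subseteq> ?D" by (auto simp: X_def v_def)
    then have "card (Inl ` switching I y x x' :: ('i + 'a \<times> int) set) \<le> card ?D"
      by (rule card_mono[OF fD])
    then have "card (switching I y x x') \<le> card ?D" by (simp add: card_image)
    then have 1: "card (switching I y x x') \<le> r * card I" using D by (intro small) linarith
    define u where "u z = (1 / (z \<bullet> b)) *\<^sub>R z" for z :: 'a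
    have Chb: "z \<bullet> b > 0 \<and> norm z = 1 \<and> 1 \<le> L * (z \<bullet> b)" if "z \<in> Ch" for z
    proof -
      have "1 / L \<le> z \<bullet> b" "norm z = 1" using that by (auto simp: Ch_def)
      moreover have "1 / L > 0" using L by simp
      ultimately have "z \<bullet> b > 0" by linarith
      moreover have "1 \<le> L * (z \<bullet> b)" using \<open>1 / L \<le> z \<bullet> b\<close> L by (simp add: divide_le_eq mult.commute)
      ultimately show ?thesis using \<open>norm z = 1\<close> by simp
    qed
    have ub: "\<bar>u z \<bullet> l\<bar> \<le> L" if "z \<in> Ch" "l \<in> Basis" for z l
    proof -
      have "\<bar>z \<bullet> l\<bar> \<le> 1" using Basis_le_norm[OF that(2), of z] Chb[OF that(1)] by simp
      also have "\<dots> \<le> L * (z \<bullet> b)" using Chb[OF that(1)] by simp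
      finally show ?thesis using Chb[OF that(1)] by (simp add: u_def abs_mult field_simps)
    qed
    have un: "norm (u z) \<ge> 1" if "z \<in> Ch" for z
    proof -
      have "1 = u z \<bullet> b" using Chb[OF that] by (simp add: u_def)
      also have "\<dots> \<le> norm (u z) * norm b" by (rule norm_cauchy_schwarz)
      finally show ?thesis using b by simp
    qed
    have us: "z = sgn (u z)" if "z \<in> Ch" for z
      using Chb[OF that] by (simp add: u_def sgn_div_norm)
    have vt: "z \<bullet> v (Inr (l, t)) \<ge> 0 \<longleftrightarrow> (u z \<bullet> l) * K / L \<ge> real_of_int t" if "z \<in> Ch" for z l t
    proof -
      have "z \<bullet> v (Inr (l, t)) = z \<bullet> l - (L * real_of_int t / K) * (z \<bullet> b)" by (simp add: v_def inner_diff_right)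
      then have "z \<bullet> v (Inr (l, t)) \<ge> 0 \<longleftrightarrow> (L * real_of_int t / K) * (z \<bullet> b) \<le> z \<bullet> l" by simp
      also have "\<dots> \<longleftrightarrow> L * real_of_int t / K \<le> u z \<bullet> l" using Chb[OF that] by (simp add: u_def pos_le_divide_eq)
      also have "\<dots> \<longleftrightarrow> (u z \<bullet> l) * K / L \<ge> real_of_int t" using L K0 by (simp add: field_simps)
      finally show ?thesis .
    qed
    have coord: "\<bar>(u x - u x') \<bullet> l\<bar> \<le> 3 / 2 * L * r" if l: "l \<in> Basis" for l
    proof -
      let ?a = "(u x \<bullet> l) * K / L" and ?b = "(u x' \<bullet> l) * K / L"
      have bd: "\<bar>u z \<bullet> l * K / L\<bar> \<le> K" if "z \<in> Ch" for z
        using ub[OF that l] L K0 by (simp add: abs_mult field_simps mult_right_mono)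
      let ?E = "grid_cut K ?a ?b"
      have "(\<lambda>t. Inr (l, t)) ` ?E \<subseteq> ?D" 
      proof (rule image_subsetI)
        fix t assume t: "t \<in> ?E"
        then have "Inr (l, t) \<in> X" using l by (auto simp: X_def)
        then show "Inr (l, t) \<in> ?D" using t vt[OF x, of l t] vt[OF x', of l t] by simp
      qed
      then have "card ((\<lambda>t. Inr (l, t) :: 'i + 'a \<times> int) ` ?E) \<le> card ?D" by (rule card_mono[OF fD])
      moreover have "inj_on (\<lambda>t. Inr (l, t) :: 'i + 'a \<times> int) ?E" by (auto simp: inj_on_def)
      ultimately have "card ?E \<le> card ?D" by (simp add: card_image)
      moreover have "\<bar>?a - ?b\<bar> - 1 \<le> card ?E" by (rule grid_separation) (use bd x x' in auto)
      ultimately have "\<bar>?a - ?b\<bar> \<le> s + 1" using D by linarith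
      also have "s + 1 \<le> r * K / 2 + r * K"
        using K1 r by (simp add: s_def field_simps)
      finally have "\<bar>?a - ?b\<bar> \<le> 3 / 2 * r * K" by simp
      moreover have "?a - ?b = ((u x - u x') \<bullet> l) * (K / L)" by (simp add: inner_diff_left left_diff_distrib diff_divide_distrib)
      ultimately have "\<bar>(u x - u x') \<bullet> l\<bar> * (K / L) \<le> 3 / 2 * r * K" using L by (simp add: abs_mult)
      then show ?thesis using L K0 by (simp add: field_simps)
    qed
    have "norm (u x - u x') \<le> (\<Sum>l\<in>Basis. \<bar>(u x - u x') \<bullet> l\<bar>)" by (rule norm_le_l1)
    also have "\<dots> \<le> (\<Sum>l\<in>(Basis::'a set). 3 / 2 * L * r)" by (intro sum_mono coord)
    also have "\<dots> = 3 / 2 * L\<^sup>2 * r" by (simp add: L_def power2_eq_square)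
    finally have "norm (u x - u x') \<le> 3 / 2 * L\<^sup>2 * r" .
    moreover have "norm (sgn (u x) - sgn (u x')) \<le> 2 * norm (u x - u x')" by (intro norm_sgn_diff_le un x x')
    ultimately have "norm (x - x') \<le> 3 * L\<^sup>2 * r" using us[OF x] us[OF x'] by simp
    then show ?thesis using 1 by simp
  qed
  show ?thesis
  proof (intro exI[of _ "h ` V"] conjI ballI impI)
    show "finite (h ` V)" using fV by simp
    show "h ` V \<subseteq> sphere 0 1" using h by (auto simp: Ch_def)
    show "real (card (h ` V)) \<le> 2 * (8 * L * (1 + 3 * L) / r + 1) ^ (DIM('a) - 1)"
      using cV card_image_le[OF fV, of h] by linarith
    fix x :: 'a assume "x \<in> sphere 0 1" "x \<bullet> b \<ge> 1 / L"
    then have x: "x \<in> Ch" by (simp add: Ch_def)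
    then obtain T where T: "T \<in> V" "G x = T \<or> \<not> ?P (G x) T" using V(3) by blast
    then have "real (card ((G x - G (h T)) \<union> (G (h T) - G x))) < s" using h[OF T(1)] s0 by auto
    then show "\<exists>x'\<in>h ` V. norm (x - x') \<le> 3 * L\<^sup>2 * r \<and>
        card (switching I y x x') \<le> r * card I"
      using main[OF x, of "h T"] h[OF T(1)] T(1) by blast
  qed
qed

text \<open>Two charts for each of the \<open>D\<close> axes, each with the bound of
  \<open>chart_net\<close> at radius \<open>r / (3 * D\<^sup>2)\<close>, after extracting the power
  of \<open>1 / r\<close>.\<close>

definition net_const :: "nat \<Rightarrow> real" where
  "net_const D = 4 * real D * (24 * real D ^ 3 * (1 + 3 * real D) + 1) ^ (D - 1)"

lemma net_const_ge_4: "D \<ge> 1 \<Longrightarrow> net_const D \<ge> 4"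
proof -
  assume D: "D \<ge> 1"
  have "(24 * real D ^ 3 * (1 + 3 * real D) + 1) ^ (D - 1) \<ge> 1" by (rule one_le_power) simp
  then have "4 * real D * (24 * real D ^ 3 * (1 + 3 * real D) + 1) ^ (D - 1) \<ge> 4 * 1" using D by (intro mult_mono) auto
  then show ?thesis by (simp add: net_const_def)
qed

text \<open>The charts around the basis vectors and their negatives cover the sphere: the absolute
  values of the coordinates of a unit vector sum to at least 1, so one of them is at least
  \<open>1 / L\<close>. The radius is divided by \<open>3 * L\<^sup>2\<close> to undo the distortion
  of the charts.\<close>

lemma sphere_net:
  fixes y :: "'i \<Rightarrow> 'a::euclidean_space" and r :: real
  assumes fI: "finite I" and r: "0 < r" "r \<le> 1"
  shows "\<exists>T. finite T \<and> T \<subseteq> sphere 0 1 \<and> card T \<le> net_const DIM('a) * (1 / r) ^ (DIM('a) - 1) \<and>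
    (\<forall>x\<in>sphere 0 1. \<exists>x'\<in>T. norm (x - x') \<le> r \<and>
        card (switching I y x x') \<le> r * card I)"
proof -
  define L where "L = real DIM('a)"
  have L: "L \<ge> 1" unfolding L_def using DIM_positive[where 'a='a] by linarith
  have L2: "3 * L\<^sup>2 \<ge> 1" using one_le_power[OF L, of 2] by linarith
  define q where "q = r / (3 * L\<^sup>2)"
  have q: "0 < q" "q \<le> 1" "q \<le> r" "3 * L\<^sup>2 * q = r" using r L L2 by (auto simp: q_def divide_le_eq mult_le_cancel_left1)
  define B where "B = (Basis::'a set) \<union> uminus ` Basis"
  have nB: "norm b = 1" if "b \<in> B" for b using that by (auto simp: B_def)
  have "\<forall>b\<in>B. \<exists>T. finite T \<and> T \<subseteq> sphere 0 1 \<and> card T \<le> 2 * (8 * L * (1 + 3 * L) / q + 1) ^ (DIM('a) - 1) \<and>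
    (\<forall>x\<in>sphere 0 1. x \<bullet> b \<ge> 1 / L \<longrightarrow> (\<exists>x'\<in>T. norm (x - x') \<le> 3 * L\<^sup>2 * q \<and>
        card (switching I y x x') \<le> q * card I))"
    unfolding L_def using chart_net[OF fI nB q(1,2), where y = y] by blast
  then obtain T where T: "\<And>b. b \<in> B \<Longrightarrow> finite (T b)" "\<And>b. b \<in> B \<Longrightarrow> T b \<subseteq> sphere 0 1"
     "\<And>b. b \<in> B \<Longrightarrow> card (T b) \<le> 2 * (8 * L * (1 + 3 * L) / q + 1) ^ (DIM('a) - 1)"
     "\<And>b x. b \<in> B \<Longrightarrow> x\<in>sphere 0 1 \<Longrightarrow> x \<bullet> b \<ge> 1 / L \<Longrightarrow> (\<exists>x'\<in>T b. norm (x - x') \<le> 3 * L\<^sup>2 * q \<and>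
        card (switching I y x x') \<le> q * card I)"
    unfolding bchoice_iff by blast
  have fB: "finite B" by (simp add: B_def)
  have cB: "real (card B) \<le> 2 * L"
  proof -
    have "card B \<le> card (Basis::'a set) + card (uminus ` (Basis::'a set))" unfolding B_def by (rule card_Un_le)
    also have "card (uminus ` (Basis::'a set)) = DIM('a)" by (simp add: card_image)
    finally show ?thesis by (simp add: L_def)
  qed
  show ?thesis
  proof (intro exI[of _ "\<Union>b\<in>B. T b"] conjI ballI)
    show "finite (\<Union>b\<in>B. T b)" using fB T(1) by simp
    show "(\<Union>b\<in>B. T b) \<subseteq> sphere 0 1" using T(2) by (rule UN_least)
    have "real (card (\<Union>b\<in>B. T b)) \<le> real (\<Sum>b\<in>B. card (T b))" using card_UN_le[OF fB, of T] of_nat_le_iff by blast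
    also have "\<dots> = (\<Sum>b\<in>B. real (card (T b)))" by simp
    also have "\<dots> \<le> (\<Sum>b\<in>B. 2 * (8 * L * (1 + 3 * L) / q + 1) ^ (DIM('a) - 1))" by (intro sum_mono T(3))
    also have "\<dots> = card B * (2 * (8 * L * (1 + 3 * L) / q + 1) ^ (DIM('a) - 1))" by simp
    also have "\<dots> \<le> (2 * L) * (2 * (8 * L * (1 + 3 * L) / q + 1) ^ (DIM('a) - 1))"
      using cB L q by (intro mult_right_mono) auto
    also have "8 * L * (1 + 3 * L) / q = 24 * L ^ 3 * (1 + 3 * L) / r"
      using r L by (simp add: q_def field_simps power2_eq_square power3_eq_cube)
    also have "(24 * L ^ 3 * (1 + 3 * L) / r + 1) ^ (DIM('a) - 1) \<le> ((24 * L ^ 3 * (1 + 3 * L) + 1) * (1 / r)) ^ (DIM('a) - 1)"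
      using r L by (intro power_mono) (auto simp: field_simps)
    also have "\<dots> = (24 * L ^ 3 * (1 + 3 * L) + 1) ^ (DIM('a) - 1) * (1 / r) ^ (DIM('a) - 1)" by (rule power_mult_distrib)
    finally show "real (card (\<Union>b\<in>B. T b)) \<le> net_const DIM('a) * (1 / r) ^ (DIM('a) - 1)"
      using L by (simp add: net_const_def L_def mult_ac)
    fix x :: 'a assume x: "x \<in> sphere 0 1"
    have "\<exists>b\<in>Basis. 1 / L \<le> \<bar>x \<bullet> b\<bar>"
    proof (rule ccontr)
      assume "\<not> ?thesis"
      then have "(\<Sum>b\<in>Basis. \<bar>x \<bullet> b\<bar>) < (\<Sum>b\<in>(Basis::'a set). 1 / L)" by (intro sum_strict_mono) auto
      also have "\<dots> = 1" using L by (simp add: L_def)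
      finally show False using norm_le_l1[of x] x by simp
    qed
    then obtain c where c: "c \<in> Basis" "1 / L \<le> \<bar>x \<bullet> c\<bar>" by blast
    obtain b where b: "b \<in> B" "1 / L \<le> x \<bullet> b"
    proof (cases "x \<bullet> c \<ge> 0")
      case True then show ?thesis using c that[of c] by (auto simp: B_def)
    next
      case False then show ?thesis using c that[of "- c"] by (auto simp: B_def)
    qed
    then obtain x' where x': "x' \<in> T b" "norm (x - x') \<le> 3 * L\<^sup>2 * q" "card (switching I y x x') \<le> q * card I"
      using T(4)[OF b(1) x b(2)] by blast
    have "q * card I \<le> r * card I" using q by (intro mult_right_mono) auto
    then show "\<exists>x'\<in>\<Union>b\<in>B. T b. norm (x - x') \<le> r \<and> card (switching I y x x') \<le> r * card I"
      using x' b(1) q(4) by (intro bexI[of _ x']) auto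
  qed
qed

section \<open>Partial coloring\<close>

definition signs :: "'i set \<Rightarrow> ('i \<Rightarrow> real) set" where
  "signs I = I \<rightarrow>\<^sub>E {-1, 1}"

lemma finite_signs: "finite I \<Longrightarrow> finite (signs I)"
  unfolding signs_def by (rule finite_PiE) auto

lemma card_signs: "finite I \<Longrightarrow> card (signs I) = 2 ^ card I"
  unfolding signs_def by (simp add: card_PiE numeral_2_eq_2)

lemma exp_moment_signs:
  fixes a :: "'i \<Rightarrow> real"
  assumes fI: "finite I"
  shows "(\<Sum>\<epsilon>\<in>signs I. exp (\<Sum>i\<in>I. a i * \<epsilon> i)) = 2 ^ card I * (\<Prod>i\<in>I. cosh (a i))"
proof -
  have "(\<Sum>\<epsilon>\<in>signs I. exp (\<Sum>i\<in>I. a i * \<epsilon> i)) = (\<Sum>\<epsilon>\<in>signs I. \<Prod>i\<in>I. exp (a i * \<epsilon> i))"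
    using fI by (simp add: exp_sum)
  also have "\<dots> = (\<Prod>i\<in>I. \<Sum>e\<in>{-1,1}. exp (a i * e))"
    unfolding signs_def using fI by (subst prod_sum_PiE) auto
  also have "\<dots> = (\<Prod>i\<in>I. 2 * cosh (a i))"
    by (intro prod.cong) (auto simp: cosh_def)
  also have "\<dots> = 2 ^ card I * (\<Prod>i\<in>I. cosh (a i))" by (simp add: prod.distrib)
  finally show ?thesis .
qed

lemma exp_half_less_2: "exp (1 / 2 :: real) < 2"
proof -
  have "exp (1 / 2 :: real) ^ 2 = exp 1" by (simp add: exp_of_nat_mult[symmetric])
  also have "\<dots> < 2 ^ 2" using exp_le by simp
  finally show ?thesis by (rule power_less_imp_less_base) simp
qed

text \<open>The power series are compared term by term, using
  \<open>2 ^ n * fact n \<le> fact (2 * n)\<close>. This is the subgaussian bound for a single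
  random sign.\<close>

lemma cosh_le_exp_half_square: "cosh (x::real) \<le> exp (x\<^sup>2 / 2)"
proof -
  have s1: "(\<lambda>n. if even n then x ^ n /\<^sub>R fact n else 0) sums cosh x" by (rule cosh_converges)
  have s2: "(\<lambda>n. (x\<^sup>2 / 2) ^ n /\<^sub>R fact n) sums exp (x\<^sup>2 / 2)" by (rule exp_converges)
  have s1': "(\<lambda>n. x ^ (2 * n) /\<^sub>R fact (2 * n)) sums cosh x"
  proof -
    have "(\<lambda>n. (\<lambda>n. if even n then x ^ n /\<^sub>R fact n else 0) ((*) 2 n)) sums cosh x"
      by (subst sums_mono_reindex) (use s1 in \<open>auto simp: strict_mono_def elim!: evenE\<close>)
    then show ?thesis by simp
  qed
  have f: "2 ^ n * fact n \<le> (fact (2 * n) :: real)" for n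
  proof (induction n)
    case (Suc n)
    have "2 ^ Suc n * fact (Suc n) = (2 * real (Suc n)) * (2 ^ n * (fact n :: real))" by simp
    also have "\<dots> \<le> (2 * real (Suc n) * (2 * n + 1)) * fact (2 * n)" 
      using Suc by (intro mult_mono) auto
    also have "\<dots> = fact (2 * Suc n)" by (simp add: algebra_simps)
    finally show ?case .
  qed simp
  show ?thesis
  proof (rule sums_le[OF _ s1' s2])
    fix n
    have "x ^ (2 * n) /\<^sub>R fact (2 * n) = (x\<^sup>2) ^ n / fact (2 * n)" by (simp only: power_mult) (simp add: divide_inverse mult.commute)
    also have "\<dots> \<le> (x\<^sup>2) ^ n / (2 ^ n * fact n)" using f[of n] by (intro divide_left_mono) auto
    also have "\<dots> = (x\<^sup>2 / 2) ^ n /\<^sub>R fact n" by (simp add: power_divide field_simps)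
    finally show "x ^ (2 * n) /\<^sub>R fact (2 * n) \<le> (x\<^sup>2 / 2) ^ n /\<^sub>R fact n" .
  qed
qed

lemma power_le_fact_exp:
  assumes "0 \<le> (t::real)" shows "t ^ m \<le> fact m * exp t"
proof -
  have "t ^ m /\<^sub>R fact m \<le> (\<Sum>n. t ^ n /\<^sub>R fact n)"
    using sum_le_suminf[OF summable_exp_generic[of t], of "{m}"] assms by simp
  then have "t ^ m / fact m \<le> exp t" by (simp add: exp_def divide_inverse mult.commute)
  then show ?thesis by (simp add: divide_le_eq mult.commute)
qed

lemma power_le_fact_cosh: "\<bar>t::real\<bar> ^ m \<le> 2 * fact m * cosh t"
proof -
  have "\<bar>t\<bar> ^ m \<le> fact m * exp \<bar>t\<bar>" by (rule power_le_fact_exp) simp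
  also have "\<dots> \<le> fact m * (2 * cosh t)"
    by (intro mult_left_mono) (auto simp: cosh_def abs_if)
  finally show ?thesis by simp
qed

text \<open>The mean exponential moments of the sum at scale \<open>1 / \<sigma>\<close> are at most
  2 for both signs, and \<open>\<bar>t\<bar> ^ m\<close> is dominated by
  \<open>2 * fact m * cosh t\<close>. The factorial is cruder than Gaussian growth, but the orders
  that occur later depend on \<open>d\<close> alone.\<close>

lemma moment_signs:
  fixes a :: "'i \<Rightarrow> real"
  assumes fI: "finite I" and s: "\<sigma> > 0" and a: "(\<Sum>i\<in>I. (a i)\<^sup>2) \<le> \<sigma>\<^sup>2"
  shows "(\<Sum>\<epsilon>\<in>signs I. \<bar>\<Sum>i\<in>I. a i * \<epsilon> i\<bar> ^ m) \<le> 4 * fact m * \<sigma> ^ m * 2 ^ card I"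
proof -
  let ?X = "\<lambda>\<epsilon>. (\<Sum>i\<in>I. a i * \<epsilon> i)"
  have e: "(\<Sum>\<epsilon>\<in>signs I. exp (c * ?X \<epsilon> / \<sigma>)) \<le> 2 ^ card I * 2" if c: "c\<^sup>2 = 1" for c
  proof -
    have "(\<Sum>\<epsilon>\<in>signs I. exp (c * ?X \<epsilon> / \<sigma>)) = (\<Sum>\<epsilon>\<in>signs I. exp (\<Sum>i\<in>I. (c * a i / \<sigma>) * \<epsilon> i))"
      by (simp add: sum_distrib_left sum_divide_distrib mult.assoc)
    also have "\<dots> = 2 ^ card I * (\<Prod>i\<in>I. cosh (c * a i / \<sigma>))" by (rule exp_moment_signs[OF fI])
    also have "(\<Prod>i\<in>I. cosh (c * a i / \<sigma>)) \<le> (\<Prod>i\<in>I. exp ((c * a i / \<sigma>)\<^sup>2 / 2))"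
      by (intro prod_mono) (auto simp: cosh_le_exp_half_square cosh_real_nonneg)
    also have "\<dots> = exp (\<Sum>i\<in>I. (c * a i / \<sigma>)\<^sup>2 / 2)" using fI by (simp add: exp_sum)
    also have "(\<Sum>i\<in>I. (c * a i / \<sigma>)\<^sup>2 / 2) = (\<Sum>i\<in>I. (a i)\<^sup>2) / (2 * \<sigma>\<^sup>2)"
      by (simp add: sum_divide_distrib power_mult_distrib power_divide c mult.commute)
    also have "exp \<dots> \<le> exp (1 / 2)" using a s by (simp add: divide_le_eq)
    also have "exp (1 / 2 :: real) \<le> 2" using exp_half_less_2 by simp
    finally show ?thesis by simp
  qed
  have "(\<Sum>\<epsilon>\<in>signs I. \<bar>?X \<epsilon>\<bar> ^ m) = (\<Sum>\<epsilon>\<in>signs I. \<sigma> ^ m * \<bar>?X \<epsilon> / \<sigma>\<bar> ^ m)"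
    using s by (intro sum.cong) (auto simp: power_divide abs_divide)
  also have "\<dots> \<le> (\<Sum>\<epsilon>\<in>signs I. \<sigma> ^ m * (2 * fact m * cosh (?X \<epsilon> / \<sigma>)))"
    using s by (intro sum_mono mult_left_mono power_le_fact_cosh) auto
  also have "\<dots> = \<sigma> ^ m * fact m * (\<Sum>\<epsilon>\<in>signs I. exp (1 * ?X \<epsilon> / \<sigma>) + exp (- 1 * ?X \<epsilon> / \<sigma>))"
  proof -
    have "\<sigma> ^ m * (2 * fact m * cosh y) = \<sigma> ^ m * fact m * (exp y + exp (- y))" for y by (simp add: cosh_field_def)
    moreover have "1 * y / \<sigma> = y / \<sigma>" "- 1 * y / \<sigma> = - (y / \<sigma>)" for y by simp_all
    ultimately show ?thesis
      by (simp only: sum_distrib_left[where A = "signs I" and r = "\<sigma> ^ m * fact m"])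
  qed
  also have "\<dots> = \<sigma> ^ m * fact m * ((\<Sum>\<epsilon>\<in>signs I. exp (1 * ?X \<epsilon> / \<sigma>)) + (\<Sum>\<epsilon>\<in>signs I. exp (- 1 * ?X \<epsilon> / \<sigma>)))"
    by (simp add: sum.distrib)
  also have "\<dots> \<le> \<sigma> ^ m * fact m * (2 ^ card I * 2 + 2 ^ card I * 2)"
    using s by (intro mult_left_mono add_mono e) auto
  finally show ?thesis by (simp add: mult_ac)
qed

section \<open>The entropy method\<close>

definition bucket :: "real \<Rightarrow> real \<Rightarrow> int" where
  "bucket \<tau> x = \<lfloor>x / (2 * \<tau>) + 1 / 2\<rfloor>"

text \<open>Buckets are centered at the multiples of \<open>2 * \<tau>\<close>, so values below
  \<open>\<tau>\<close> in absolute value fall into bucket 0. For the others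
  \<open>\<bar>x\<bar> / \<tau> \<ge> 1\<close>, and every power of it dominates the bucket number.
  A moment of any order therefore bounds the mean bucket number.\<close>

lemma bucket_abs_le:
  assumes "\<tau> > 0" "m \<ge> 1"
  shows "\<bar>real_of_int (bucket \<tau> x)\<bar> \<le> (\<bar>x\<bar> / \<tau>) ^ m"
proof (cases "\<bar>x\<bar> < \<tau>")
  case True
  then have "- 1 / 2 < x / (2 * \<tau>)" "x / (2 * \<tau>) < 1 / 2" using assms by (auto simp: field_simps)
  then have "bucket \<tau> x = 0" unfolding bucket_def by (simp add: floor_eq_iff)
  then show ?thesis using assms by simp
next
  case False
  then have 1: "1 \<le> \<bar>x\<bar> / \<tau>" using assms by simp
  have "\<bar>x / (2 * \<tau>)\<bar> = (\<bar>x\<bar> / \<tau>) / 2" using assms by (simp add: abs_divide abs_mult)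
  moreover have "\<bar>real_of_int \<lfloor>z + 1 / 2\<rfloor>\<bar> \<le> 2 * \<bar>z\<bar>" if "1 \<le> 2 * \<bar>z\<bar>" for z :: real
    using that by linarith
  ultimately have "\<bar>real_of_int (bucket \<tau> x)\<bar> \<le> \<bar>x\<bar> / \<tau>"
    using 1 unfolding bucket_def by (metis mult.commute nonzero_divide_eq_eq zero_neq_numeral)
  also have "\<dots> \<le> (\<bar>x\<bar> / \<tau>) ^ m" using 1 assms(2) by (metis power_increasing power_one_right)
  finally show ?thesis .
qed

lemma bucket_eq_imp:
  assumes "\<tau> > 0" "bucket \<tau> x = bucket \<tau> y"
  shows "\<bar>x - y\<bar> \<le> 2 * \<tau>"
proof -
  have "\<bar>x / (2 * \<tau>) - y / (2 * \<tau>)\<bar> \<le> 1" using assms(2) unfolding bucket_def by linarith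
  then have "\<bar>x - y\<bar> / (2 * \<tau>) \<le> 1" using assms(1) by (simp add: diff_divide_distrib[symmetric] abs_divide)
  then show ?thesis using assms(1) by (simp add: divide_le_eq)
qed

text \<open>A two-sided geometric series, cut off at \<open>B\<close>. It normalizes the weights
  \<open>exp (- l * \<bar>b\<bar>)\<close>, so the logarithm of the bound is part of the price of
  encoding one bucket number.\<close>

lemma kraft_int:
  fixes l :: real
  assumes "l > 0"
  shows "(\<Sum>b\<in>{- int B..int B}. exp (- l * \<bar>real_of_int b\<bar>)) \<le> 1 + 2 / (exp l - 1)"
proof -
  define q where "q = exp (- l)"
  have q: "0 < q" "q < 1" using assms by (auto simp: q_def)
  have "(\<Sum>b\<in>{- int B..int B}. exp (- l * \<bar>real_of_int b\<bar>)) = 1 + 2 * (\<Sum>n=1..B. q ^ n)"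
  proof (induction B)
    case 0 then show ?case by simp
  next
    case (Suc B)
    have "{- int (Suc B)..int (Suc B)} = insert (int (Suc B)) (insert (- int (Suc B)) {- int B..int B})" by auto
    then have "(\<Sum>b\<in>{- int (Suc B)..int (Suc B)}. exp (- l * \<bar>real_of_int b\<bar>)) =
      2 * exp (- l * real (Suc B)) + (\<Sum>b\<in>{- int B..int B}. exp (- l * \<bar>real_of_int b\<bar>))" by (simp add: abs_if)
    also have "exp (- l * real (Suc B)) = q ^ Suc B" by (simp only: q_def exp_of_nat_mult[symmetric] mult.commute)
    finally show ?case using Suc by simp
  qed
  also have "(\<Sum>n=1..B. q ^ n) = q * (\<Sum>n<B. q ^ n)"
    by (simp add: sum_distrib_left sum.atLeast1_atMost_eq)
  also have "(\<Sum>n<B. q ^ n) = (1 - q ^ B) / (1 - q)" using q by (simp add: sum_gp_strict)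
  also have "q * ((1 - q ^ B) / (1 - q)) \<le> q * (1 / (1 - q))"
    using q by (intro mult_left_mono divide_right_mono) auto
  also have "q * (1 / (1 - q)) = 1 / (exp l - 1)"
    using q by (simp add: q_def exp_minus field_simps)
  finally show ?thesis by simp
qed

text \<open>The weights \<open>(1 / 16) ^ card A\<close> sum over all subsets to
  \<open>(17 / 16) powr card I \<le> 2 powr (card I / 8)\<close>, while each subset counted here has
  weight at least \<open>2 powr (- card I / 4)\<close>. The exponents 1/8 and 1/4 add up to
  3/8.\<close>

lemma card_small_subsets:
  assumes fI: "finite I"
  shows "real (card {A. A \<subseteq> I \<and> 16 * card A < card I}) \<le> 2 powr (3 / 8 * card I)"
proof -
  let ?M = "real (card I)"
  let ?S = "{A. A \<subseteq> I \<and> 16 * card A < card I}"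
  have "real (card ?S) * 16 powr (- ?M / 16) = (\<Sum>A\<in>?S. 16 powr (- ?M / 16))" by simp
  also have "\<dots> \<le> (\<Sum>A\<in>?S. (1 / 16) ^ card A)"
  proof (rule sum_mono)
    fix A assume "A \<in> ?S"
    then have "real (card A) \<le> ?M / 16" by simp
    then have "16 powr (- ?M / 16) \<le> 16 powr (- real (card A))" by (intro powr_mono) auto
    also have "\<dots> = (1 / 16) ^ card A" by (simp add: powr_minus powr_realpow power_divide inverse_eq_divide)
    finally show "16 powr (- ?M / 16) \<le> (1 / 16) ^ card A" .
  qed
  also have "\<dots> \<le> (\<Sum>A\<in>Pow I. (1 / 16) ^ card A)" using fI by (intro sum_mono2) auto
  also have "\<dots> = (\<Sum>A\<in>Pow I. (\<Prod>i\<in>A. 1 / 16) * (\<Prod>i\<in>I - A. 1))" by simp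
  also have "\<dots> = (\<Prod>i\<in>I. 1 / 16 + 1)" using prod_add[OF fI, of "\<lambda>_. 1/16 :: real" "\<lambda>_. 1"] by simp
  also have "\<dots> = (17 / 16) powr ?M" by (simp add: powr_realpow)
  also have "\<dots> \<le> (2 powr (1 / 8)) powr ?M"
  proof (intro powr_mono2)
    have "(17 / 16 :: real) ^ 8 \<le> (2 powr (1 / 8)) ^ 8" by (simp add: powr_realpow[symmetric] powr_powr power_divide)
    then show "(17 / 16 :: real) \<le> 2 powr (1 / 8)" by (subst (asm) power_mono_iff) auto
  qed auto
  finally have 1: "real (card ?S) * 16 powr (- ?M / 16) \<le> 2 powr (?M / 8)" by (simp add: powr_powr)
  have p: "(16::real) powr (- ?M / 16) = 2 powr (- (?M / 4))"
  proof -
    have "(16::real) = 2 powr 4" by (simp add: powr_numeral)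
    then have "(16::real) powr (- ?M / 16) = (2 powr 4) powr (- ?M / 16)" by (rule arg_cong)
    also have "\<dots> = 2 powr (4 * (- ?M / 16))" by (rule powr_powr)
    finally show ?thesis by simp
  qed
  have "real (card ?S) = real (card ?S) * 16 powr (- ?M / 16) * 2 powr (?M / 4)"
    unfolding p by (simp add: powr_add[symmetric] mult.assoc)
  also have "\<dots> \<le> 2 powr (?M / 8) * 2 powr (?M / 4)" using 1 by (intro mult_right_mono) auto
  also have "\<dots> = 2 powr (3 / 8 * ?M)" by (simp add: powr_add[symmetric])
  finally show ?thesis .
qed

text \<open>The entropy method: the bucket vector is encoded with the Kraft weights
  \<open>exp (- l c * \<bar>b c\<bar>)\<close>, so that a cheap bucket vector must be shared by many sign vectors.
  Here \<open>e c\<close> bounds the mean of \<open>\<bar>b c\<bar>\<close>.\<close>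

lemma partial_coloring_aux:
  fixes a :: "'c \<Rightarrow> 'i \<Rightarrow> real" and \<tau> l e :: "'c \<Rightarrow> real"
  assumes fI: "finite I" and fQ: "finite Q" and M2: "card I \<ge> 2"
    and \<tau>: "\<And>c. c \<in> Q \<Longrightarrow> \<tau> c > 0" and l: "\<And>c. c \<in> Q \<Longrightarrow> l c > 0"
    and e: "\<And>c. c \<in> Q \<Longrightarrow> (\<Sum>\<epsilon>\<in>signs I. \<bar>real_of_int (bucket (\<tau> c) (\<Sum>i\<in>I. a c i * \<epsilon> i))\<bar>) \<le> e c * 2 ^ card I"
    and cost: "(\<Sum>c\<in>Q. l c * e c + ln (1 + 2 / (exp (l c) - 1))) \<le> card I / 32"
  shows "\<exists>\<epsilon>. (\<forall>i\<in>I. \<epsilon> i \<in> {-1, 0, 1::real}) \<and> card I \<le> 16 * card {i\<in>I. \<epsilon> i \<noteq> 0} \<and> 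
    (\<forall>c\<in>Q. \<bar>\<Sum>i\<in>I. a c i * \<epsilon> i\<bar> \<le> \<tau> c)"
proof -
  define M where "M = card I"
  define b where "b \<epsilon> = restrict (\<lambda>c. bucket (\<tau> c) (\<Sum>i\<in>I. a c i * \<epsilon> i)) Q" for \<epsilon>
  define \<kappa> where "\<kappa> \<beta> = (\<Sum>c\<in>Q. l c * \<bar>real_of_int (\<beta> c)\<bar>)" for \<beta> :: "'c \<Rightarrow> int"
  define K where "K = (\<Sum>c\<in>Q. l c * e c)"
  define Z where "Z c = 1 + 2 / (exp (l c) - 1)" for c
  have Zpos: "Z c > 1" if "c \<in> Q" for c using l[OF that] by (simp add: Z_def)
  have fS: "finite (signs I)" using fI by (rule finite_signs)
  have "(\<Sum>\<epsilon>\<in>signs I. \<kappa> (b \<epsilon>)) = (\<Sum>c\<in>Q. \<Sum>\<epsilon>\<in>signs I. l c * \<bar>real_of_int (bucket (\<tau> c) (\<Sum>i\<in>I. a c i * \<epsilon> i))\<bar>)"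
    unfolding \<kappa>_def b_def by (subst sum.swap) simp
  also have "\<dots> = (\<Sum>c\<in>Q. l c * (\<Sum>\<epsilon>\<in>signs I. \<bar>real_of_int (bucket (\<tau> c) (\<Sum>i\<in>I. a c i * \<epsilon> i))\<bar>))"
    by (simp add: sum_distrib_left)
  also have "\<dots> \<le> (\<Sum>c\<in>Q. l c * (e c * 2 ^ M))"
    unfolding M_def by (intro sum_mono mult_left_mono e) (auto intro: less_imp_le l)
  also have "\<dots> = K * 2 ^ M" by (simp add: K_def sum_distrib_right mult.assoc)
  finally have mean: "(\<Sum>\<epsilon>\<in>signs I. \<kappa> (b \<epsilon>)) \<le> K * 2 ^ M" .
  have \<kappa>0: "\<kappa> \<beta> \<ge> 0" for \<beta> unfolding \<kappa>_def by (auto intro!: sum_nonneg mult_nonneg_nonneg less_imp_le[OF l])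
  have K0: "K \<ge> 0" 
  proof -
    have "0 \<le> K * 2 ^ M" using mean \<kappa>0 by (meson order_trans sum_nonneg)
    then have "0 \<le> K * 2 ^ M / 2 ^ M" by (rule divide_nonneg_pos) simp
    then show ?thesis by simp
  qed
  \<comment> \<open>Sign vectors whose bucket vector costs at most twice the mean; by Markov's
    inequality they are at least half of all. For \<open>K = 0\<close> the division in Markov's
    inequality fails, but then every cost is 0.\<close>
  define G where "G = {\<epsilon>\<in>signs I. \<kappa> (b \<epsilon>) \<le> 2 * K}"
  have fG: "finite G" using fS by (simp add: G_def)
  have G: "2 ^ M \<le> 2 * real (card G)"
  proof (cases "K = 0")
    case True
    have "(\<Sum>\<epsilon>\<in>signs I. \<kappa> (b \<epsilon>)) = 0" using mean True \<kappa>0 by (simp add: sum_nonneg antisym)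
    then have "\<forall>\<epsilon>\<in>signs I. \<kappa> (b \<epsilon>) = 0" using fS \<kappa>0 by (simp add: sum_nonneg_eq_0_iff)
    then have "G = signs I" using True by (auto simp: G_def)
    then show ?thesis using card_signs[OF fI] by (simp add: M_def)
  next
    case False
    then have Kp: "K > 0" using K0 by simp
    have "2 * K * (2 ^ M - real (card G)) = (\<Sum>\<epsilon>\<in>signs I - G. 2 * K)"
      using fS fG card_signs[OF fI] card_mono[OF fS, of G] by (simp add: card_Diff_subset G_def M_def of_nat_diff)
    also have "\<dots> \<le> (\<Sum>\<epsilon>\<in>signs I - G. \<kappa> (b \<epsilon>))" by (intro sum_mono) (auto simp: G_def)
    also have "\<dots> \<le> (\<Sum>\<epsilon>\<in>signs I. \<kappa> (b \<epsilon>))" using fS \<kappa>0 by (intro sum_mono2) auto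
    also have "\<dots> \<le> K * 2 ^ M" by (rule mean)
    finally have "K * (2 * (2 ^ M - real (card G))) \<le> K * 2 ^ M" by (simp add: mult_ac)
    then have "2 * (2 ^ M - real (card G)) \<le> 2 ^ M" by (subst (asm) mult_le_cancel_left_pos[OF Kp])
    then show ?thesis by simp
  qed
  \<comment> \<open>Kraft's inequality: each cheap bucket vector has weight at least
    \<open>exp (- (2 * K))\<close>, and the total weight of all vectors with entries bounded by
    \<open>B\<close> factorizes over the constraints.\<close>
  have few: "real (card (b ` G)) \<le> exp (2 * K) * (\<Prod>c\<in>Q. Z c)"
  proof -
    define B where "B = Max (insert 0 ((\<lambda>(\<epsilon>,c). nat \<bar>b \<epsilon> c\<bar>) ` (G \<times> Q)))"
    have fin: "finite (insert 0 ((\<lambda>(\<epsilon>,c). nat \<bar>b \<epsilon> c\<bar>) ` (G \<times> Q)))" using fG fQ by auto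
    have B: "\<bar>b \<epsilon> c\<bar> \<le> int B" if "\<epsilon> \<in> G" "c \<in> Q" for \<epsilon> c
    proof -
      have "nat \<bar>b \<epsilon> c\<bar> \<in> insert 0 ((\<lambda>(\<epsilon>,c). nat \<bar>b \<epsilon> c\<bar>) ` (G \<times> Q))" using that by auto
      then have "nat \<bar>b \<epsilon> c\<bar> \<le> B" unfolding B_def using fin Max_ge by blast
      then show ?thesis by simp
    qed
    have sub: "b ` G \<subseteq> Q \<rightarrow>\<^sub>E {- int B..int B}"
    proof
      fix \<beta> assume "\<beta> \<in> b ` G"
      then obtain \<epsilon> where \<epsilon>: "\<epsilon> \<in> G" "\<beta> = b \<epsilon>" by auto
      have "b \<epsilon> c \<in> {- int B..int B}" if "c \<in> Q" for c using B[OF \<epsilon>(1) that] by auto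
      moreover have "b \<epsilon> c = undefined" if "c \<notin> Q" for c using that by (simp add: b_def)
      ultimately show "\<beta> \<in> Q \<rightarrow>\<^sub>E {- int B..int B}" unfolding \<epsilon>(2) by (rule PiE_I)
    qed
    have "real (card (b ` G)) * exp (- (2 * K)) = (\<Sum>\<beta>\<in>b ` G. exp (- (2 * K)))" by simp
    also have "\<dots> \<le> (\<Sum>\<beta>\<in>b ` G. exp (- \<kappa> \<beta>))" by (intro sum_mono) (auto simp: G_def)
    also have "\<dots> \<le> (\<Sum>\<beta>\<in>Q \<rightarrow>\<^sub>E {- int B..int B}. exp (- \<kappa> \<beta>))"
      using sub fQ by (intro sum_mono2 finite_PiE) auto
    also have "\<dots> = (\<Sum>\<beta>\<in>Q \<rightarrow>\<^sub>E {- int B..int B}. \<Prod>c\<in>Q. exp (- l c * \<bar>real_of_int (\<beta> c)\<bar>))"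
      using fQ by (simp add: \<kappa>_def sum_negf[symmetric] exp_sum)
    also have "\<dots> = (\<Prod>c\<in>Q. \<Sum>b\<in>{- int B..int B}. exp (- l c * \<bar>real_of_int b\<bar>))"
      using fQ by (subst prod_sum_PiE) auto
    also have "\<dots> \<le> (\<Prod>c\<in>Q. Z c)"
      unfolding Z_def by (intro prod_mono conjI kraft_int l sum_nonneg) auto
    finally have "real (card (b ` G)) * exp (- (2 * K)) * exp (2 * K) \<le> (\<Prod>c\<in>Q. Z c) * exp (2 * K)"
      by (rule mult_right_mono) simp
    moreover have "real (card (b ` G)) * exp (- (2 * K)) * exp (2 * K) = real (card (b ` G))" by (simp add: exp_minus)
    ultimately show ?thesis by (simp only: mult.commute)
  qed
  have costs: "exp (2 * K) * (\<Prod>c\<in>Q. Z c) \<le> exp (M / 16)"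
  proof -
    have "exp (\<Sum>c\<in>Q. ln (Z c)) = (\<Prod>c\<in>Q. exp (ln (Z c)))" by (rule exp_sum[OF fQ])
    also have "\<dots> = (\<Prod>c\<in>Q. Z c)"
    proof (rule prod.cong[OF refl])
      fix c assume "c \<in> Q"
      then have "Z c > 0" using Zpos[of c] by simp
      then show "exp (ln (Z c)) = Z c" by simp
    qed
    finally have "(\<Prod>c\<in>Q. Z c) = exp (\<Sum>c\<in>Q. ln (Z c))" by (rule sym)
    moreover have "(\<Sum>c\<in>Q. ln (Z c)) \<ge> 0" using Zpos by (intro sum_nonneg ln_ge_zero less_imp_le) 
    moreover have "K + (\<Sum>c\<in>Q. ln (Z c)) \<le> M / 32" using cost by (simp add: sum.distrib K_def Z_def M_def)
    ultimately show ?thesis by (simp add: exp_add[symmetric])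
  qed
  \<comment> \<open>Pigeonhole: at least \<open>2 ^ M / 2\<close> sign vectors share fewer than
    \<open>2 powr (M / 8)\<close> bucket vectors, because \<open>exp (1 / 2) < 2\<close>. Having at
    least two indices gives \<open>M / 2 \<le> M - 1\<close>.\<close>
  have "\<exists>\<beta>\<in>b ` G. real (card {\<epsilon>\<in>G. b \<epsilon> = \<beta>}) > 2 powr (3 / 8 * M)"
  proof (rule ccontr)
    assume "\<not> ?thesis"
    then have le: "real (card {\<epsilon>\<in>G. b \<epsilon> = \<beta>}) \<le> 2 powr (3 / 8 * M)" if "\<beta> \<in> b ` G" for \<beta> using that by force
    have "card G = (\<Sum>\<beta>\<in>b ` G. card {\<epsilon>\<in>G. b \<epsilon> = \<beta>})"
      using sum.image_gen[OF fG, of "\<lambda>_. 1::nat" b] by simp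
    then have "real (card G) = (\<Sum>\<beta>\<in>b ` G. real (card {\<epsilon>\<in>G. b \<epsilon> = \<beta>}))" by simp
    also have "\<dots> \<le> (\<Sum>\<beta>\<in>b ` G. 2 powr (3 / 8 * M))" by (intro sum_mono le)
    also have "\<dots> = real (card (b ` G)) * 2 powr (3 / 8 * M)" by simp
    also have "\<dots> \<le> exp (M / 16) * 2 powr (3 / 8 * M)"
      using few costs by (intro mult_right_mono) auto
    also have "exp (M / 16) < 2 powr (M / 8)"
    proof -
      have "exp (M / 16) = exp (1/2) powr (M / 8)" by (simp add: powr_def)
      also have "\<dots> < 2 powr (M / 8)"
      proof (rule powr_less_mono2)
        show "exp (1/2 :: real) < 2" by (rule exp_half_less_2)
        show "0 < real M / 8" using M2 by (simp add: M_def)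
      qed simp
      finally show ?thesis .
    qed
    finally have "real (card G) < 2 powr (M / 8) * 2 powr (3 / 8 * M)" by simp
    also have "\<dots> = 2 powr (M / 2)" by (simp add: powr_add[symmetric])
    also have "\<dots> \<le> 2 powr (real M - 1)" using M2 by (intro powr_mono) (auto simp: M_def)
    also have "\<dots> = 2 ^ M / 2" by (simp add: powr_diff powr_realpow)
    finally show False using G by simp
  qed
  then obtain \<beta> where \<beta>: "\<beta> \<in> b ` G" "real (card {\<epsilon>\<in>G. b \<epsilon> = \<beta>}) > 2 powr (3 / 8 * M)" by blast
  define F where "F = {\<epsilon>\<in>G. b \<epsilon> = \<beta>}"
  obtain \<epsilon>0 where \<epsilon>0: "\<epsilon>0 \<in> F" using \<beta>(1) by (auto simp: F_def)
  have FS: "F \<subseteq> signs I" by (auto simp: F_def G_def)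
  have pm: "\<epsilon> i = 1 \<or> \<epsilon> i = -1" if "\<epsilon> \<in> signs I" "i \<in> I" for \<epsilon> i using that by (auto simp: signs_def PiE_def Pi_def)
  \<comment> \<open>\<open>F\<close> outnumbers the index sets with fewer than \<open>M / 16\<close>
    elements, and a sign vector is determined by where it disagrees with \<open>\<epsilon>0\<close>;
    so some member of \<open>F\<close> is far from \<open>\<epsilon>0\<close>.\<close>
  have "\<exists>\<epsilon>\<in>F. M \<le> 16 * card {i\<in>I. \<epsilon> i \<noteq> \<epsilon>0 i}"
  proof (rule ccontr)
    assume n: "\<not> ?thesis"
    let ?d = "\<lambda>\<epsilon>. {i\<in>I. \<epsilon> i \<noteq> \<epsilon>0 i}"
    have "inj_on ?d F"
    proof (rule inj_onI)
      fix \<epsilon> \<epsilon>' assume ee: "\<epsilon> \<in> F" "\<epsilon>' \<in> F" "?d \<epsilon> = ?d \<epsilon>'"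
      show "\<epsilon> = \<epsilon>'"
      proof (rule PiE_ext[of _ I "\<lambda>_. {-1,1}"])
        show "\<epsilon> \<in> I \<rightarrow>\<^sub>E {-1,1}" "\<epsilon>' \<in> I \<rightarrow>\<^sub>E {-1,1}" using ee FS by (auto simp: signs_def)
        fix i assume i: "i \<in> I"
        have "\<epsilon> i \<noteq> \<epsilon>0 i \<longleftrightarrow> \<epsilon>' i \<noteq> \<epsilon>0 i" using ee(3) i by (auto simp: set_eq_iff)
        moreover have "\<epsilon> i = 1 \<or> \<epsilon> i = -1" "\<epsilon>' i = 1 \<or> \<epsilon>' i = -1" "\<epsilon>0 i = 1 \<or> \<epsilon>0 i = -1"
          using pm i ee \<epsilon>0 FS by (meson subsetD)+
        ultimately show "\<epsilon> i = \<epsilon>' i" by auto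
      qed
    qed
    moreover have "?d ` F \<subseteq> {A. A \<subseteq> I \<and> 16 * card A < card I}" using n by (auto simp: M_def not_le)
    moreover have "finite {A. A \<subseteq> I \<and> 16 * card A < card I}" using fI by simp
    ultimately have "card F \<le> card {A. A \<subseteq> I \<and> 16 * card A < card I}" by (rule card_inj_on_le)
    then have "real (card F) \<le> 2 powr (3 / 8 * M)" using card_small_subsets[OF fI] unfolding M_def by linarith
    then show False using \<beta>(2) by (simp add: F_def)
  qed
  then obtain \<epsilon>1 where \<epsilon>1: "\<epsilon>1 \<in> F" "M \<le> 16 * card {i\<in>I. \<epsilon>1 i \<noteq> \<epsilon>0 i}" by blast
  \<comment> \<open>Half the difference of two sign vectors with the same buckets: it is nonzero
    exactly where they differ, and each constraint is at most half a bucket width.\<close>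
  define \<epsilon> where "\<epsilon> i = (\<epsilon>1 i - \<epsilon>0 i) / 2" for i
  show ?thesis
  proof (intro exI[of _ \<epsilon>] conjI ballI)
    fix i assume i: "i \<in> I"
    have "\<epsilon>1 i = 1 \<or> \<epsilon>1 i = -1" "\<epsilon>0 i = 1 \<or> \<epsilon>0 i = -1"
      using pm i \<epsilon>1 \<epsilon>0 FS by (meson subsetD)+
    then show "\<epsilon> i \<in> {-1, 0, 1}" by (auto simp: \<epsilon>_def)
  next
    have "{i\<in>I. \<epsilon> i \<noteq> 0} = {i\<in>I. \<epsilon>1 i \<noteq> \<epsilon>0 i}" by (auto simp: \<epsilon>_def)
    then show "card I \<le> 16 * card {i\<in>I. \<epsilon> i \<noteq> 0}" using \<epsilon>1(2) by (simp add: M_def)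
  next
    fix c assume c: "c \<in> Q"
    have "b \<epsilon>1 = b \<epsilon>0" using \<epsilon>1(1) \<epsilon>0 by (simp add: F_def)
    then have "b \<epsilon>1 c = b \<epsilon>0 c" by simp
    then have "bucket (\<tau> c) (\<Sum>i\<in>I. a c i * \<epsilon>1 i) = bucket (\<tau> c) (\<Sum>i\<in>I. a c i * \<epsilon>0 i)" using c by (simp add: b_def)
    then have "\<bar>(\<Sum>i\<in>I. a c i * \<epsilon>1 i) - (\<Sum>i\<in>I. a c i * \<epsilon>0 i)\<bar> \<le> 2 * \<tau> c" by (rule bucket_eq_imp[OF \<tau>[OF c]])
    moreover have "(\<Sum>i\<in>I. a c i * \<epsilon> i) = ((\<Sum>i\<in>I. a c i * \<epsilon>1 i) - (\<Sum>i\<in>I. a c i * \<epsilon>0 i)) / 2"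
      by (simp add: \<epsilon>_def sum_subtractf[symmetric] sum_divide_distrib right_diff_distrib)
    ultimately show "\<bar>\<Sum>i\<in>I. a c i * \<epsilon> i\<bar> \<le> \<tau> c" by simp
  qed
qed

text \<open>An upper bound for the entropy cost of a constraint whose allowed discrepancy is \<open>l\<close> times
  its Euclidean norm; \<open>m = 0\<close> selects the bound that stays useful for small \<open>l\<close>.\<close>

definition cost :: "nat \<Rightarrow> real \<Rightarrow> real" where
  "cost m l = (if m = 0 then 12 * l powr (- 1 / 6) else 6 * fact (Suc m) * l powr (- real m))"

text \<open>The first summand is \<open>l\<close> times the moment bound for the mean bucket number,
  the second the logarithm of the normalizing constant. For \<open>m \<ge> 1\<close> the moment of
  order \<open>m + 1\<close> makes both of order \<open>l powr (- m)\<close>. For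
  \<open>m = 0\<close> and \<open>l \<le> 1\<close> the first moment gives the constant 4, and the
  logarithm is traded for the small power \<open>l powr (- 1 / 6)\<close>; for \<open>l > 1\<close>
  the second moment suffices.\<close>

lemma cost_bound:
  assumes l: "l > 0"
  shows "\<exists>k\<ge>1. l * (4 * fact k * l powr (- real k)) + ln (1 + 2 / (exp l - 1)) \<le> cost m l"
proof -
  have bd: "l * (4 * fact (Suc m) * l powr (- real (Suc m))) + ln (1 + 2 / (exp l - 1)) \<le> 6 * fact (Suc m) * l powr (- real m)"
    if m: "m \<ge> 1" for m
  proof -
    have "l * l powr (- real (Suc m)) = l powr (- real m)" 
      using l powr_add[of l 1 "- real (Suc m)"] by simp
    then have 1: "l * (4 * fact (Suc m) * l powr (- real (Suc m))) = 4 * fact (Suc m) * l powr (- real m)"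
      by (metis mult.assoc mult.commute)
    have pe: "l ^ m / fact m \<le> exp l - 1"
    proof -
      have "(\<Sum>n\<in>{0,m}. l ^ n /\<^sub>R fact n) \<le> (\<Sum>n. l ^ n /\<^sub>R fact n)"
        using l by (intro sum_le_suminf summable_exp_generic) auto
      then show ?thesis using m by (simp add: exp_def divide_inverse mult.commute)
    qed
    have e0: "exp l - 1 > 0" using l by simp
    have "ln (1 + 2 / (exp l - 1)) \<le> 2 / (exp l - 1)" using e0 by (intro ln_add_one_self_le_self) auto
    also have "2 / (exp l - 1) \<le> 2 / (l ^ m / fact m)" using pe l e0 by (intro divide_left_mono) auto
    also have "\<dots> = 2 * fact m * l powr (- real m)" using l by (simp add: powr_minus powr_realpow field_simps)
    also have "\<dots> \<le> 2 * fact (Suc m) * l powr (- real m)" by (intro mult_right_mono mult_left_mono fact_mono) auto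
    finally have "ln (1 + 2 / (exp l - 1)) \<le> 2 * fact (Suc m) * l powr (- real m)" .
    then show ?thesis unfolding 1 by linarith
  qed
  show ?thesis
  proof (cases "m \<ge> 1")
    case True
    then show ?thesis using bd[OF True] by (intro exI[of _ "Suc m"]) (simp add: cost_def)
  next
    case m0: False
    show ?thesis
    proof (cases "l \<le> 1")
      case True
      define u where "u = l powr (- 1 / 6)"
      have u: "u > 0" "ln u = - ln l / 6" using l by (simp_all add: u_def ln_powr)
      have e: "exp l - 1 \<ge> l" using exp_ge_add_one_self[of l] by linarith
      then have "1 + 2 / (exp l - 1) \<le> 1 + 2 / l" using l by (intro add_left_mono divide_left_mono) auto
      also have "\<dots> \<le> 3 / l" using l True by (simp add: field_simps)
      finally have "ln (1 + 2 / (exp l - 1)) \<le> ln (3 / l)" using l e by (intro ln_mono) (auto intro: add_pos_nonneg)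
      also have "\<dots> = ln 3 + 6 * ln u" using l u by (simp add: ln_div)
      also have "\<dots> \<le> 2 + 6 * (u - 1)" using ln_le_minus_one[of 3] ln_le_minus_one[OF u(1)] by simp
      finally have "ln (1 + 2 / (exp l - 1)) \<le> 6 * u - 4" by simp
      moreover have "l * (4 * fact 1 * l powr (- real 1)) = 4" using l by (simp add: powr_minus)
      ultimately have "l * (4 * fact 1 * l powr (- real 1)) + ln (1 + 2 / (exp l - 1)) \<le> 12 * u" using u(1) by linarith
      then show ?thesis using m0 by (intro exI[of _ 1]) (simp add: cost_def u_def)
    next
      case False
      have "l powr (- real 1) \<le> l powr (- 1 / 6)" using False by (intro powr_mono) auto
      then have "6 * fact (Suc 1) * l powr (- real 1) \<le> 12 * l powr (- 1 / 6)" by (simp add: numeral_2_eq_2)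
      then have "l * (4 * fact (Suc 1) * l powr (- real (Suc 1))) + ln (1 + 2 / (exp l - 1)) \<le> 12 * l powr (- 1 / 6)"
        using bd[of 1] by linarith
      then show ?thesis using m0 by (intro exI[of _ "Suc 1"]) (simp add: cost_def)
    qed
  qed
qed

text \<open>Each constraint bounds its mean bucket number through a moment of the order that
  \<open>cost_bound\<close> provides. The price of the entropy method becomes a function of the
  ratio \<open>\<tau> c / \<sigma> c\<close>.\<close>

lemma partial_coloring:
  fixes a :: "'c \<Rightarrow> 'i \<Rightarrow> real" and \<tau> \<sigma> :: "'c \<Rightarrow> real" and m :: "'c \<Rightarrow> nat"
  assumes fI: "finite I" and fQ: "finite Q" and M2: "card I \<ge> 2"
    and \<tau>: "\<And>c. c \<in> Q \<Longrightarrow> \<tau> c > 0" and \<sigma>: "\<And>c. c \<in> Q \<Longrightarrow> \<sigma> c > 0"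
    and a: "\<And>c. c \<in> Q \<Longrightarrow> (\<Sum>i\<in>I. (a c i)\<^sup>2) \<le> (\<sigma> c)\<^sup>2"
    and cost: "(\<Sum>c\<in>Q. cost (m c) (\<tau> c / \<sigma> c)) \<le> card I / 32"
  shows "\<exists>\<epsilon>. (\<forall>i\<in>I. \<epsilon> i \<in> {-1, 0, 1::real}) \<and> card I \<le> 16 * card {i\<in>I. \<epsilon> i \<noteq> 0} \<and> 
    (\<forall>c\<in>Q. \<bar>\<Sum>i\<in>I. a c i * \<epsilon> i\<bar> \<le> \<tau> c)"
proof -
  define l where "l c = \<tau> c / \<sigma> c" for c
  have l: "l c > 0" if "c \<in> Q" for c using \<tau> \<sigma> that by (simp add: l_def)
  have "\<forall>c\<in>Q. \<exists>k\<ge>1. l c * (4 * fact k * l c powr (- real k)) + ln (1 + 2 / (exp (l c) - 1)) \<le> cost (m c) (l c)"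
    using cost_bound[OF l] by blast
  then obtain k where k: "\<And>c. c \<in> Q \<Longrightarrow> k c \<ge> 1" 
    "\<And>c. c \<in> Q \<Longrightarrow> l c * (4 * fact (k c) * l c powr (- real (k c))) + ln (1 + 2 / (exp (l c) - 1)) \<le> cost (m c) (l c)"
    by (metis (no_types) bchoice)
  show ?thesis
  proof (rule partial_coloring_aux[OF fI fQ M2 \<tau>, where l = l and e = "\<lambda>c. 4 * fact (k c) * l c powr (- real (k c))"])
    show "(\<Sum>c\<in>Q. l c * (4 * fact (k c) * l c powr - real (k c)) + ln (1 + 2 / (exp (l c) - 1))) \<le> card I / 32"
      using cost k(2) unfolding l_def[symmetric] by (meson order_trans sum_mono)
    fix c assume c: "c \<in> Q"
    show "l c > 0" using l[OF c] .
    have t: "\<tau> c > 0" "\<sigma> c > 0" using \<tau> \<sigma> c by auto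
    let ?X = "\<lambda>\<epsilon>. (\<Sum>i\<in>I. a c i * \<epsilon> i)"
    have "(\<Sum>\<epsilon>\<in>signs I. \<bar>real_of_int (bucket (\<tau> c) (?X \<epsilon>))\<bar>) \<le> (\<Sum>\<epsilon>\<in>signs I. (\<bar>?X \<epsilon>\<bar> / \<tau> c) ^ k c)"
      by (intro sum_mono bucket_abs_le t k(1) c)
    also have "\<dots> = (\<Sum>\<epsilon>\<in>signs I. \<bar>?X \<epsilon>\<bar> ^ k c) / \<tau> c ^ k c" by (simp add: power_divide sum_divide_distrib)
    also have "\<dots> \<le> (4 * fact (k c) * \<sigma> c ^ k c * 2 ^ card I) / \<tau> c ^ k c"
      using t by (intro divide_right_mono moment_signs fI a c) auto
    also have "\<dots> = 4 * fact (k c) * l c powr (- real (k c)) * 2 ^ card I"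
      using t l[OF c] by (simp add: powr_minus powr_realpow) (simp add: l_def power_divide field_simps)
    finally show "(\<Sum>\<epsilon>\<in>signs I. \<bar>real_of_int (bucket (\<tau> c) (?X \<epsilon>))\<bar>) \<le> 4 * fact (k c) * l c powr (- real (k c)) * 2 ^ card I" .
  qed
qed

section \<open>Close pairs with few separations\<close>

definition separates :: "'a::euclidean_space \<Rightarrow> 'a \<Rightarrow> 'a \<Rightarrow> bool" where
  "separates x u v \<longleftrightarrow> (x \<bullet> u \<ge> 0) \<noteq> (x \<bullet> v \<ge> 0)"

abbreviation separated :: "nat \<Rightarrow> (nat \<Rightarrow> 'a::euclidean_space) \<Rightarrow> (nat \<Rightarrow> 'a) \<Rightarrow> 'a \<Rightarrow> nat set" where
  "separated M p q x \<equiv> {i\<in>{..<M}. separates x (p i) (q i)}"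

text \<open>The net is taken with exchanged roles: the points of \<open>P\<close> are approximated,
  and the test points \<open>x c\<close>, repeated according to their weights, supply the
  hyperplanes. As \<open>P\<close> has more points than the net, two of them share a net point; they
  are close, and a test point separating them separates one of them from that net point. Swapping
  the two arranges \<open>f p \<le> f q\<close>.\<close>

lemma close_pair:
  fixes P :: "'a::euclidean_space set" and x :: "'c \<Rightarrow> 'a" and w :: "'c \<Rightarrow> real" and f :: "'a \<Rightarrow> real"
  assumes fP: "finite P" "P \<subseteq> sphere 0 1" and fX: "finite X" and w: "\<And>c. c \<in> X \<Longrightarrow> w c \<ge> 0"
    and r: "0 < r" "r \<le> 1" and card: "net_const DIM('a) * (1 / r) ^ (DIM('a) - 1) < card P"
  shows "\<exists>p\<in>P. \<exists>q\<in>P. p \<noteq> q \<and> f p \<le> f q \<and> norm (p - q) \<le> 2 * r \<and>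
     (\<Sum>c | c \<in> X \<and> separates (x c) p q. w c) \<le> 4 * r * (\<Sum>c\<in>X. w c)"
proof -
  define W where "W = (\<Sum>c\<in>X. w c)"
  have W0: "W \<ge> 0" unfolding W_def by (intro sum_nonneg w)
  \<comment> \<open>Multiplicities proportional to the weights, rounded down and increased by 1. The
    1 ensures that \<open>w c \<le> W / card X * n c\<close> and adds only \<open>card X\<close>
    indices; if \<open>W = 0\<close>, the quotient is 0 and every multiplicity is 1.\<close>
  define n where "n c = nat \<lfloor>w c * card X / W\<rfloor> + 1" for c
  define I where "I = (SIGMA c:X. {..<n c})"
  have fI: "finite I" using fX by (simp add: I_def)
  have cardI: "card {i\<in>I. Q (fst i)} = (\<Sum>c | c \<in> X \<and> Q c. n c)" for Q
  proof -
    have "{i\<in>I. Q (fst i)} = (SIGMA c:{c\<in>X. Q c}. {..<n c})" by (auto simp: I_def)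
    then show ?thesis using fX by (simp add: card_SigmaI)
  qed
  have wn: "w c \<le> W / card X * n c" if "c \<in> X" for c
  proof (cases "W = 0")
    case True
    then have "w c = 0" using fX w that unfolding W_def by (simp add: sum_nonneg_eq_0_iff)
    then show ?thesis using True by simp
  next
    case False
    have cX: "card X > 0" using that fX by (auto simp: card_gt_0_iff)
    have "w c * card X / W \<le> n c" using W0 w[OF that] by (simp add: n_def) linarith
    then show ?thesis using False W0 cX by (simp add: field_simps)
  qed
  have "real (card I) = (\<Sum>c\<in>X. real (n c))" using cardI[of "\<lambda>_. True"] by simp
  also have "\<dots> \<le> (\<Sum>c\<in>X. w c * card X / W + 1)"
    using W0 w by (intro sum_mono) (simp add: n_def)
  also have "\<dots> = W * card X / W + card X" by (simp add: sum.distrib W_def sum_divide_distrib[symmetric] sum_distrib_right[symmetric])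
  also have "\<dots> \<le> 2 * card X" by (cases "W = 0") auto
  finally have cI: "real (card I) \<le> 2 * card X" by simp
  obtain T where T: "finite T" "card T \<le> net_const DIM('a) * (1 / r) ^ (DIM('a) - 1)"
    "\<And>z. z \<in> sphere 0 1 \<Longrightarrow> \<exists>t\<in>T. norm (z - t) \<le> r \<and> card (switching I (\<lambda>i. x (fst i)) z t) \<le> r * card I"
    using sphere_net[OF fI r, of "\<lambda>i. x (fst i)"] by blast
  have "\<forall>z\<in>P. \<exists>t. t \<in> T \<and> norm (z - t) \<le> r \<and> card (switching I (\<lambda>i. x (fst i)) z t) \<le> r * card I"
    using T(3) fP(2) by (meson subsetD)
  then obtain h where h: "\<forall>z\<in>P. h z \<in> T \<and> norm (z - h z) \<le> r \<and> card (switching I (\<lambda>i. x (fst i)) z (h z)) \<le> r * card I"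
    by (rule bchoice[THEN exE])
  have "\<not> inj_on h P"
  proof
    assume "inj_on h P"
    then have "card P \<le> card T" using h T(1) by (intro card_inj_on_le[of h]) auto
    then show False using T(2) card by linarith
  qed
  then obtain p' q' where pq': "p' \<in> P" "q' \<in> P" "h p' = h q'" "p' \<noteq> q'" unfolding inj_on_def by blast
  obtain p q where pq: "p \<in> P" "q \<in> P" "h p = h q" "p \<noteq> q" "f p \<le> f q"
    using pq' that[of p' q'] that[of q' p'] by (cases "f p' \<le> f q'") auto
  have "norm (p - q) \<le> norm (p - h p) + norm (q - h q)"
    using pq(3) norm_triangle_ineq4[of "p - h p" "q - h p"] by simp
  also have "\<dots> \<le> 2 * r" using bspec[OF h pq(1)] bspec[OF h pq(2)] by linarith
  finally have d: "norm (p - q) \<le> 2 * r" .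
  let ?D = "\<lambda>z. switching I (\<lambda>i. x (fst i)) z (h z)"
  have "(\<Sum>c | c \<in> X \<and> separates (x c) p q. w c) \<le> (\<Sum>c | c \<in> X \<and> separates (x c) p q. W / card X * n c)"
    by (intro sum_mono wn) auto
  also have "\<dots> = W / card X * (\<Sum>c | c \<in> X \<and> separates (x c) p q. n c)"
    by (simp add: sum_distrib_left)
  also have "(\<Sum>c | c \<in> X \<and> separates (x c) p q. n c) = card {i\<in>I. separates (x (fst i)) p q}" by (rule cardI[symmetric])
  also have "W / card X * real \<dots> \<le> W / card X * (4 * r * card X)"
  proof (rule mult_left_mono)
    have "{i\<in>I. separates (x (fst i)) p q} \<subseteq> ?D p \<union> ?D q"
      using pq(3) by (auto simp: separates_def inner_commute)
    then have "card {i\<in>I. separates (x (fst i)) p q} \<le> card (?D p \<union> ?D q)"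
      using fI by (intro card_mono) auto
    also have "\<dots> \<le> card (?D p) + card (?D q)" by (rule card_Un_le)
    finally have "real (card {i\<in>I. separates (x (fst i)) p q}) \<le> real (card (?D p)) + real (card (?D q))" by simp
    also have "\<dots> \<le> r * card I + r * card I" using h pq(1,2) by (intro add_mono) auto
    also have "\<dots> \<le> r * (2 * card X) + r * (2 * card X)" using cI r by (intro add_mono mult_left_mono) auto
    finally show "real (card {i\<in>I. separates (x (fst i)) p q}) \<le> 4 * r * card X" by simp
  qed (use W0 in simp)
  also have "\<dots> \<le> 4 * r * W" using W0 r by (cases "card X = 0") auto
  finally show ?thesis using pq d unfolding W_def by blast
qed

text \<open>A test point is charged a factor \<open>1 + \<theta>\<close> for every pair that it
  separates. The next pair is chosen for the weights charged so far; the test points separating it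
  hold at most the share \<open>4 * r\<close> of the total, so the potential grows by a factor of at
  most \<open>1 + 4 * r * \<theta>\<close>.\<close>

lemma greedy_pairs:
  fixes P :: "'a::euclidean_space set" and x :: "'c \<Rightarrow> 'a" and \<omega> :: "'c \<Rightarrow> real" and f :: "'a \<Rightarrow> real"
  assumes fP: "finite P" "P \<subseteq> sphere 0 1" and fX: "finite X" and \<omega>: "\<And>c. c \<in> X \<Longrightarrow> \<omega> c \<ge> 0"
    and r: "0 < r" "r \<le> 1" and \<theta>: "\<theta> \<ge> 0"
    and card: "net_const DIM('a) * (1 / r) ^ (DIM('a) - 1) + 2 * real k < card P"
  shows "\<exists>p q. (\<forall>i<k. p i \<in> P \<and> q i \<in> P \<and> f (p i) \<le> f (q i) \<and> norm (p i - q i) \<le> 2 * r) \<and>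
     inj_on p {..<k} \<and> inj_on q {..<k} \<and> p ` {..<k} \<inter> q ` {..<k} = {} \<and>
     (\<Sum>c\<in>X. \<omega> c * (1 + \<theta>) ^ card (separated k p q (x c))) \<le> (1 + 4 * r * \<theta>) ^ k * (\<Sum>c\<in>X. \<omega> c)"
  using card
proof (induction k)
  case 0
  then show ?case by simp
next
  case (Suc k)
  then obtain p q where pq: "\<And>i. i < k \<Longrightarrow> p i \<in> P \<and> q i \<in> P \<and> f (p i) \<le> f (q i) \<and> norm (p i - q i) \<le> 2 * r"
     "inj_on p {..<k}" "inj_on q {..<k}" "p ` {..<k} \<inter> q ` {..<k} = {}"
     "(\<Sum>c\<in>X. \<omega> c * (1 + \<theta>) ^ card (separated k p q (x c))) \<le> (1 + 4 * r * \<theta>) ^ k * (\<Sum>c\<in>X. \<omega> c)"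
    by auto
  define U where "U = p ` {..<k} \<union> q ` {..<k}"
  have "card U \<le> card (p ` {..<k}) + card (q ` {..<k})" unfolding U_def by (rule card_Un_le)
  also have "\<dots> \<le> k + k" using card_image_le[of "{..<k}" p] card_image_le[of "{..<k}" q] by simp
  finally have "card U \<le> 2 * k" by simp
  moreover have "finite U" by (simp add: U_def)
  moreover have "card P - card U \<le> card (P - U)" using \<open>finite U\<close> by (rule diff_card_le_card_Diff)
  ultimately have "real (card P) - 2 * real k \<le> card (P - U)" by linarith
  then have big: "net_const DIM('a) * (1 / r) ^ (DIM('a) - 1) < card (P - U)" using Suc.prems by simp
  define w where "w c = \<omega> c * (1 + \<theta>) ^ card (separated k p q (x c))" for c
  have w0: "w c \<ge> 0" if "c \<in> X" for c using \<omega>[OF that] \<theta> by (simp add: w_def)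
  have PU: "finite (P - U)" "P - U \<subseteq> sphere 0 1" using fP by auto
  obtain a b where ab: "a \<in> P - U" "b \<in> P - U" "a \<noteq> b" "f a \<le> f b" "norm (a - b) \<le> 2 * r"
     "(\<Sum>c | c \<in> X \<and> separates (x c) a b. w c) \<le> 4 * r * (\<Sum>c\<in>X. w c)"
    using close_pair[where w = w and x = x and f = f, OF PU fX w0 r big] by blast
  have cnt: "card {i\<in>{..<Suc k}. separates (x c) ((p(k := a)) i) ((q(k := b)) i)} = 
     card (separated k p q (x c)) + (if separates (x c) a b then 1 else 0)" for c
  proof -
    have "{i\<in>{..<Suc k}. separates (x c) ((p(k := a)) i) ((q(k := b)) i)} = 
      (if separates (x c) a b then insert k (separated k p q (x c)) else (separated k p q (x c)))"
      by (auto simp: less_Suc_eq)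
    then show ?thesis by simp
  qed
  have "(\<Sum>c\<in>X. \<omega> c * (1 + \<theta>) ^ card {i\<in>{..<Suc k}. separates (x c) ((p(k := a)) i) ((q(k := b)) i)})
     = (\<Sum>c\<in>X. w c + \<theta> * (if separates (x c) a b then w c else 0))"
    unfolding cnt w_def by (intro sum.cong) (auto simp: algebra_simps)
  also have "\<dots> = (\<Sum>c\<in>X. w c) + \<theta> * (\<Sum>c | c \<in> X \<and> separates (x c) a b. w c)"
    using fX by (simp add: sum.distrib sum_distrib_left[symmetric] sum.If_cases Int_def)
  also have "\<dots> \<le> (\<Sum>c\<in>X. w c) + \<theta> * (4 * r * (\<Sum>c\<in>X. w c))"
    using ab(6) \<theta> by (intro add_left_mono mult_left_mono)
  also have "\<dots> = (1 + 4 * r * \<theta>) * (\<Sum>c\<in>X. w c)" by (simp add: algebra_simps)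
  also have "\<dots> \<le> (1 + 4 * r * \<theta>) * ((1 + 4 * r * \<theta>) ^ k * (\<Sum>c\<in>X. \<omega> c))"
    using pq(5) r \<theta> unfolding w_def by (intro mult_left_mono) auto
  finally have fin: "(\<Sum>c\<in>X. \<omega> c * (1 + \<theta>) ^ card {i\<in>{..<Suc k}. separates (x c) ((p(k := a)) i) ((q(k := b)) i)})
     \<le> (1 + 4 * r * \<theta>) ^ Suc k * (\<Sum>c\<in>X. \<omega> c)" by (simp add: mult.assoc)
  have img: "(p(k := a)) ` {..<Suc k} = insert a (p ` {..<k})" "(q(k := b)) ` {..<Suc k} = insert b (q ` {..<k})"
    by (auto simp: lessThan_Suc)
  have "inj_on (p(k := a)) {..<Suc k}" "inj_on (q(k := b)) {..<Suc k}"
    using pq(2,3) ab(1,2) by (auto simp: lessThan_Suc U_def inj_on_def)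
  moreover have "(p(k := a)) ` {..<Suc k} \<inter> (q(k := b)) ` {..<Suc k} = {}"
    unfolding img using pq(4) ab(1-3) by (auto simp: U_def)
  moreover have "\<forall>i<Suc k. (p(k := a)) i \<in> P \<and> (q(k := b)) i \<in> P \<and> f ((p(k := a)) i) \<le> f ((q(k := b)) i) \<and> norm ((p(k := a)) i - (q(k := b)) i) \<le> 2 * r"
    using pq(1) ab by (auto simp: less_Suc_eq)
  ultimately show ?case using fin by blast
qed

section \<open>Increments of a pair between two test points\<close>

lemma abs_inner_diff_le: "\<bar>\<bar>x \<bullet> p\<bar> - \<bar>x \<bullet> q\<bar>\<bar> \<le> norm x * norm (p - q)"
proof -
  have "\<bar>\<bar>x \<bullet> p\<bar> - \<bar>x \<bullet> q\<bar>\<bar> \<le> \<bar>x \<bullet> (p - q)\<bar>" by (simp add: inner_diff_right)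
  also have "\<dots> \<le> norm x * norm (p - q)" by (rule Cauchy_Schwarz_ineq2)
  finally show ?thesis .
qed

definition pairdiff :: "'a::euclidean_space \<Rightarrow> 'a \<Rightarrow> 'a \<Rightarrow> real" where
  "pairdiff p q x = \<bar>x \<bullet> p\<bar> - \<bar>x \<bullet> q\<bar>"

lemma pairdiff_le: "norm x = 1 \<Longrightarrow> \<bar>pairdiff p q x\<bar> \<le> norm (p - q)"
  using abs_inner_diff_le[of x p q] by (simp add: pairdiff_def)

lemma pairdiff_lipschitz:
  assumes "norm p = 1" "norm q = 1"
  shows "\<bar>pairdiff p q x - pairdiff p q x'\<bar> \<le> 2 * norm (x - x')"
proof -
  have t: "\<bar>(a - b) - (c - e)\<bar> \<le> \<bar>a - c\<bar> + \<bar>b - e\<bar>" for a b c e :: real by linarith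
  have "\<bar>\<bar>x \<bullet> p\<bar> - \<bar>x' \<bullet> p\<bar>\<bar> \<le> norm (x - x')" "\<bar>\<bar>x \<bullet> q\<bar> - \<bar>x' \<bullet> q\<bar>\<bar> \<le> norm (x - x')"
    using abs_inner_diff_le[of p x x'] abs_inner_diff_le[of q x x'] assms by (simp_all add: inner_commute)
  then show ?thesis
    unfolding pairdiff_def using t[of "\<bar>x \<bullet> p\<bar>" "\<bar>x \<bullet> q\<bar>" "\<bar>x' \<bullet> p\<bar>" "\<bar>x' \<bullet> q\<bar>"] by linarith
qed

text \<open>The four inner products lie on the same side of 0, so all absolute values open with one
  sign and the increment is \<open>(x - x') \<bullet> (p - q)\<close> up to sign. The gain is a
  product of two small distances instead of their minimum.\<close>

lemma pairdiff_linear: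
  assumes "\<not> separates x p q" "(x \<bullet> p \<ge> 0) = (x' \<bullet> p \<ge> 0)" "(x \<bullet> q \<ge> 0) = (x' \<bullet> q \<ge> 0)"
  shows "\<bar>pairdiff p q x - pairdiff p q x'\<bar> \<le> norm (x - x') * norm (p - q)"
proof -
  have "\<bar>pairdiff p q x - pairdiff p q x'\<bar> = \<bar>(x - x') \<bullet> (p - q)\<bar>"
    using assms unfolding separates_def pairdiff_def by (auto simp: inner_diff_left inner_diff_right abs_if)
  also have "\<dots> \<le> norm (x - x') * norm (p - q)" by (rule Cauchy_Schwarz_ineq2)
  finally show ?thesis .
qed

text \<open>For pairs with an endpoint switched between \<open>x\<close> and \<open>x'\<close>, and
  for pairs separated by \<open>x\<close>, the increment is at most
  \<open>4 * min \<delta> \<rho>\<close>, by closeness of the pair or of the test points. For all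
  other pairs it is linear and at most \<open>4 * \<rho> * \<delta>\<close>.\<close>

lemma constraint_norm:
  fixes P :: "'a::euclidean_space set" and u :: "nat \<Rightarrow> real" and \<delta> \<rho> n :: real
  assumes fP: "finite P" "P \<subseteq> sphere 0 1"
    and pq: "\<And>i. i < M \<Longrightarrow> p i \<in> P \<and> q i \<in> P \<and> norm (p i - q i) \<le> 2 * \<delta>"
    and inj: "inj_on p {..<M}" "inj_on q {..<M}" "p ` {..<M} \<inter> q ` {..<M} = {}"
    and u: "\<And>i. i < M \<Longrightarrow> 0 \<le> u i \<and> u i \<le> 1"
    and x: "norm x = 1" "norm x' = 1" "norm (x - x') \<le> 2 * \<rho>"
    and sw: "real (card (switching P (\<lambda>z. z) x x')) \<le> n" and \<delta>: "\<delta> > 0"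
  shows "(\<Sum>i<M. (u i * (pairdiff (p i) (q i) x - pairdiff (p i) (q i) x'))\<^sup>2) 
    \<le> 16 * (min \<delta> \<rho>)\<^sup>2 * (n + real (card (separated M p q x))) + 16 * real M * \<rho>\<^sup>2 * \<delta>\<^sup>2"
proof -
  have \<rho>: "\<rho> \<ge> 0" using x(3) norm_ge_zero[of "x - x'"] by linarith
  let ?g = "\<lambda>i. pairdiff (p i) (q i) x - pairdiff (p i) (q i) x'"
  let ?sw = "\<lambda>z. (x \<bullet> z \<ge> 0) \<noteq> (x' \<bullet> z \<ge> 0)"
  define A where "A = {i\<in>{..<M}. ?sw (p i) \<or> ?sw (q i)}"
  define S where "S = (separated M p q x)"
  \<comment> \<open>Selects a switched endpoint of each pair in \<open>A\<close>. All endpoints are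
    distinct, so \<open>A\<close> is no larger than the set of switched points of
    \<open>P\<close>.\<close>
  define h where "h i = (if ?sw (p i) then p i else q i)" for i
  have "inj_on h A"
  proof (rule inj_onI)
    fix i j assume "i \<in> A" "j \<in> A" "h i = h j"
    then show "i = j" using inj unfolding A_def h_def inj_on_def by (auto split: if_splits)
  qed
  moreover have "h ` A \<subseteq> {z\<in>P. ?sw z}" using pq by (auto simp: A_def h_def)
  ultimately have "card A \<le> card {z\<in>P. ?sw z}" using fP by (intro card_inj_on_le[of h]) auto
  then have cA: "real (card A) \<le> n" using sw by linarith
  have t: "(u i * ?g i)\<^sup>2 \<le> (if i \<in> A \<union> S then 16 * (min \<delta> \<rho>)\<^sup>2 else 0) + 16 * \<rho>\<^sup>2 * \<delta>\<^sup>2" if i: "i < M" for i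
  proof -
    have pn: "norm (p i) = 1" "norm (q i) = 1" using pq[OF i] fP(2) by auto
    have "\<bar>u i * ?g i\<bar> \<le> 1 * \<bar>?g i\<bar>" unfolding abs_mult using u[OF i] by (intro mult_right_mono) auto
    then have ug: "(u i * ?g i)\<^sup>2 \<le> (?g i)\<^sup>2" by (metis abs_le_square_iff mult_1)
    have "\<bar>?g i\<bar> \<le> 4 * \<delta>" using pairdiff_le[OF x(1), of "p i" "q i"] pairdiff_le[OF x(2), of "p i" "q i"] pq[OF i] by linarith
    moreover have "\<bar>?g i\<bar> \<le> 4 * \<rho>" using pairdiff_lipschitz[OF pn, of x x'] x(3) by linarith
    ultimately have "\<bar>?g i\<bar> \<le> \<bar>4 * min \<delta> \<rho>\<bar>" by (simp add: min_def)
    then have 1: "(?g i)\<^sup>2 \<le> 16 * (min \<delta> \<rho>)\<^sup>2" using abs_le_square_iff[of "?g i" "4 * min \<delta> \<rho>"] by (simp add: power_mult_distrib)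
    have 2: "(?g i)\<^sup>2 \<le> 16 * \<rho>\<^sup>2 * \<delta>\<^sup>2" if "i \<notin> A \<union> S"
    proof -
      have "\<bar>?g i\<bar> \<le> norm (x - x') * norm (p i - q i)" using that i by (intro pairdiff_linear) (auto simp: A_def S_def)
      also have "\<dots> \<le> (2 * \<rho>) * (2 * \<delta>)" using x(3) pq[OF i] \<rho> by (intro mult_mono) auto
      also have "\<dots> \<le> \<bar>4 * \<rho> * \<delta>\<bar>" by simp
      finally have "\<bar>?g i\<bar> \<le> \<bar>4 * \<rho> * \<delta>\<bar>" .
      then show ?thesis using abs_le_square_iff[of "?g i" "4 * \<rho> * \<delta>"] by (simp add: power_mult_distrib)
    qed
    show ?thesis
    proof (cases "i \<in> A \<union> S")
      case True
      have "0 \<le> 16 * \<rho>\<^sup>2 * \<delta>\<^sup>2" by simp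
      then show ?thesis using ug 1 True by (smt (verit))
    next
      case False
      then show ?thesis using ug 2 by simp
    qed
  qed
  have "(\<Sum>i<M. (u i * ?g i)\<^sup>2) \<le> (\<Sum>i<M. (if i \<in> A \<union> S then 16 * (min \<delta> \<rho>)\<^sup>2 else 0) + 16 * \<rho>\<^sup>2 * \<delta>\<^sup>2)"
    by (intro sum_mono t) simp
  also have "\<dots> = 16 * (min \<delta> \<rho>)\<^sup>2 * card ({..<M} \<inter> (A \<union> S)) + 16 * real M * \<rho>\<^sup>2 * \<delta>\<^sup>2"
    by (simp add: sum.distrib sum.If_cases Collect_disj_eq[symmetric] Un_def)
  also have "card ({..<M} \<inter> (A \<union> S)) \<le> card A + card S"
    using card_mono[of "A \<union> S" "{..<M} \<inter> (A \<union> S)"] card_Un_le[of A S] by (auto simp: A_def S_def intro: order_trans)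
  then have "16 * (min \<delta> \<rho>)\<^sup>2 * card ({..<M} \<inter> (A \<union> S)) \<le> 16 * (min \<delta> \<rho>)\<^sup>2 * (n + card S)"
    using cA by (intro mult_left_mono) auto
  finally show ?thesis unfolding S_def by simp
qed

section \<open>Chaining\<close>

abbreviation decay :: "nat \<Rightarrow> nat \<Rightarrow> real" where
  "decay k j \<equiv> 2 powr (- \<bar>real j - real k\<bar> / 4)"

text \<open>Each side is a geometric series with ratio \<open>2 powr (- 1 / 4) \<le> 7 / 8\<close>,
  hence at most 8.\<close>

lemma two_sided_geometric:
  "(\<Sum>j\<le>J. decay k j) \<le> 16"
proof -
  define \<beta> :: real where "\<beta> = 2 powr (- 1 / 4)"
  have b: "0 \<le> \<beta>" "\<beta> \<le> 7 / 8"
  proof -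
    have "\<beta> ^ 4 = 2 powr (- 1 / 4 * real 4)" unfolding \<beta>_def by (simp only: powr_powr[symmetric] powr_realpow[symmetric] powr_gt_zero)
    also have "\<dots> \<le> (7 / 8) ^ 4" by (simp add: powr_minus power_divide)
    finally show "\<beta> \<le> 7 / 8" by (subst (asm) power_mono_iff) (auto simp: \<beta>_def)
  qed (simp add: \<beta>_def)
  have geo: "(\<Sum>n\<in>A. \<beta> ^ n) \<le> 8" if "A \<subseteq> {..<m}" for A m
  proof -
    have "(\<Sum>n\<in>A. \<beta> ^ n) \<le> (\<Sum>n<m. \<beta> ^ n)" using that b by (intro sum_mono2) auto
    also have "\<dots> = (1 - \<beta> ^ m) / (1 - \<beta>)" using b by (simp add: sum_gp_strict)
    also have "\<dots> \<le> 1 / (1 - \<beta>)" using b by (intro divide_right_mono) auto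
    also have "\<dots> \<le> 8" using b by (simp add: divide_le_eq)
    finally show ?thesis .
  qed
  have pw: "2 powr (- real n / 4) = \<beta> ^ n" for n
    unfolding \<beta>_def by (simp add: powr_realpow[symmetric] powr_powr)
  have "(\<Sum>j\<le>J. decay k j) = (\<Sum>j\<in>{j\<in>{..J}. j \<ge> k}. decay k j) + (\<Sum>j\<in>{j\<in>{..J}. \<not> j \<ge> k}. decay k j)"
    by (subst sum.union_disjoint[symmetric]) (auto intro!: sum.cong)
  also have "(\<Sum>j\<in>{j\<in>{..J}. j \<ge> k}. decay k j) = (\<Sum>j\<in>{j\<in>{..J}. j \<ge> k}. \<beta> ^ (j - k))"
    by (intro sum.cong) (auto simp: pw[symmetric] of_nat_diff)
  also have "\<dots> = (\<Sum>n\<in>(\<lambda>j. j - k) ` {j\<in>{..J}. j \<ge> k}. \<beta> ^ n)"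
    by (subst sum.reindex) (auto simp: inj_on_def)
  also have "\<dots> \<le> 8" by (rule geo[of _ "Suc J"]) auto
  also have "(\<Sum>j\<in>{j\<in>{..J}. \<not> j \<ge> k}. decay k j) = (\<Sum>j\<in>{j\<in>{..J}. \<not> j \<ge> k}. \<beta> ^ (k - j))"
    by (intro sum.cong) (auto simp: pw[symmetric] of_nat_diff)
  also have "\<dots> = (\<Sum>n\<in>(\<lambda>j. k - j) ` {j\<in>{..J}. \<not> j \<ge> k}. \<beta> ^ n)"
    by (subst sum.reindex) (auto simp: inj_on_def)
  also have "\<dots> \<le> 8" by (rule geo[of _ "Suc k"]) auto
  finally show ?thesis by simp
qed

text \<open>At the critical level \<open>k\<close> the net has about as many points as there are pairs. The exponents at
  level \<open>j\<close> are chosen such that both the allowed discrepancies and the total costs of the levels are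
  summable in \<open>\<bar>j - k\<bar>\<close>, although the nets grow like \<open>2^(j d)\<close>.\<close>

definition lev_size :: "nat \<Rightarrow> nat \<Rightarrow> real" where
  "lev_size k j = (if k \<le> j then 2 powr (real k - real j) else 2 powr ((real k - real j) / 2))"

text \<open>Relative to \<open>lev_size\<close> this allowance grows like
  \<open>2 powr ((j - k) / 2)\<close> above the critical level, where constraints are many and must
  be cheap, and shrinks like \<open>2 powr (- 3 / 2 * (k - j))\<close> below it, where they are few
  and may be expensive.\<close>

definition lev_disc :: "nat \<Rightarrow> nat \<Rightarrow> real" where
  "lev_disc k j = (if k \<le> j then 2 powr ((real k - real j) / 2) else 2 powr (real j - real k))"

text \<open>The binary exponent, relative to level \<open>k\<close>, that is granted to the moment
  sum of level \<open>j\<close>. On both sides of \<open>k\<close> it exceeds the growth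
  \<open>(j - k) * d\<close> of the nets, and the surplus makes the weights
  \<open>2 powr (- lev_growth d k j)\<close> summable against the net sizes.\<close>

definition lev_growth :: "nat \<Rightarrow> nat \<Rightarrow> nat \<Rightarrow> real" where
  "lev_growth d k j = (if k \<le> j then (real j - real k) * (real d + 1) else (real j - real k) * (real d - 1 / 2))"

definition lev_moment :: "nat \<Rightarrow> nat \<Rightarrow> nat \<Rightarrow> nat" where
  "lev_moment d k j = (if k \<le> j then 2 * (d + 2) else 0)"

text \<open>The factor \<open>6 * fact (Suc m)\<close> of \<open>cost\<close> for
  \<open>m = 2 * (d + 2)\<close>, times the constant of \<open>power_le_exp_half\<close> for the
  exponent \<open>d + 2\<close>.\<close>

definition cost_const :: "nat \<Rightarrow> real" where
  "cost_const d = 6 * fact (2 * d + 5) * 2 ^ (d + 2) * fact (d + 2) * 2"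

text \<open>Powers of \<open>1 + H\<close> are paid with \<open>exp (H / 2)\<close>, the exponential
  moment that the greedy choice of pairs controls.\<close>

lemma power_le_exp_half:
  assumes "H \<ge> (0::real)"
  shows "(1 + H) ^ n \<le> 2 ^ n * fact n * 2 * exp (H / 2)"
proof -
  let ?u = "(1 + H) / 2"
  have "?u ^ n \<le> fact n * exp ?u" using assms by (intro power_le_fact_exp) simp
  also have "exp ?u = exp (1 / 2) * exp (H / 2)" by (simp add: exp_add[symmetric] add_divide_distrib)
  also have "exp (1 / 2 :: real) \<le> 2" using exp_half_less_2 by simp
  finally have "?u ^ n \<le> fact n * (2 * exp (H / 2))" by simp
  then have "2 ^ n * ?u ^ n \<le> 2 ^ n * (fact n * (2 * exp (H / 2)))" by (intro mult_left_mono) auto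
  also have "2 ^ n * ?u ^ n = (2 * ?u) ^ n" by (rule power_mult_distrib[symmetric])
  also have "2 * ?u = 1 + H" by simp
  finally show ?thesis by (simp only: mult.assoc)
qed

text \<open>Let \<open>s\<close> be the distance to the critical level. Above it, the ratio of
  allowance to norm is \<open>2 powr (s / 2)\<close>, and the moment \<open>2 * (d + 2)\<close>
  turns this into \<open>2 powr (- s * (d + 2))\<close>, which beats the growth \<open>d + 1\<close>
  with room for the decay. Below it, the ratio \<open>2 powr (- 3 / 2 * s)\<close> and the exponent
  \<open>- 1 / 6\<close> give the cost \<open>2 powr (s / 4)\<close>, which fits exactly when
  \<open>d \<ge> 1\<close>.\<close>

lemma level_cost:
  assumes L: "\<Lambda> \<ge> 1" and H: "H \<ge> 0" and d: "d \<ge> 1"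
  shows "cost (lev_moment d k j) (\<Lambda> * (lev_disc k j / lev_size k j) / sqrt (1 + H)) 
    \<le> cost_const d * \<Lambda> powr (- 1 / 6) * 2 powr (- \<bar>real j - real k\<bar> / 4 - lev_growth d k j) * exp (H / 2)"
proof (cases "k \<le> j")
  case True
  define s where "s = real j - real k"
  have s: "s \<ge> 0" using True by (simp add: s_def)
  define n where "n = d + 2"
  let ?l = "\<Lambda> * (lev_disc k j / lev_size k j) / sqrt (1 + H)"
  have "lev_disc k j / lev_size k j = 2 powr (s / 2)"
    using True by (simp add: lev_disc_def lev_size_def powr_diff[symmetric] s_def field_simps)
  then have l: "?l = \<Lambda> * 2 powr (s / 2) / sqrt (1 + H)" by simp
  have "?l powr (- real (2 * n)) = \<Lambda> powr (- real (2 * n)) * (2 powr (s / 2)) powr (- real (2 * n)) / (sqrt (1 + H)) powr (- real (2 * n))"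
    unfolding l using L H by (simp add: powr_mult powr_divide)
  also have "(2 powr (s / 2)) powr (- real (2 * n)) = 2 powr (- s * n)" by (simp add: powr_powr)
  also have "(sqrt (1 + H)) powr (- real (2 * n)) = 1 / (1 + H) ^ n"
  proof -
    have "(sqrt (1 + H)) powr (real (2 * n)) = (sqrt (1 + H)) ^ (2 * n)" using H by (intro powr_realpow) auto
    also have "\<dots> = (1 + H) ^ n" using H by (simp add: power_mult)
    finally show ?thesis by (simp only: powr_minus_divide)
  qed
  finally have "?l powr (- real (2 * n)) = \<Lambda> powr (- real (2 * n)) * 2 powr (- s * n) * (1 + H) ^ n" by simp
  also have "\<dots> \<le> \<Lambda> powr (- 1 / 6) * 2 powr (- s / 4 - s * (real d + 1)) * (2 ^ n * fact n * 2 * exp (H / 2))"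
  proof (intro mult_mono)
    show "\<Lambda> powr (- real (2 * n)) \<le> \<Lambda> powr (- 1 / 6)" using L by (intro powr_mono) (auto simp: n_def)
    have "- s * real n \<le> - s / 4 - s * (real d + 1)" using s by (simp add: n_def algebra_simps)
    then show "2 powr (- s * real n) \<le> 2 powr (- s / 4 - s * (real d + 1))" by (intro powr_mono) auto
    show "(1 + H) ^ n \<le> 2 ^ n * fact n * 2 * exp (H / 2)" by (rule power_le_exp_half[OF H])
  qed (use H in auto)
  finally have "6 * fact (Suc (2 * n)) * ?l powr (- real (2 * n)) \<le> 6 * fact (Suc (2 * n)) * (\<Lambda> powr (- 1 / 6) * 2 powr (- s / 4 - s * (real d + 1)) * (2 ^ n * fact n * 2 * exp (H / 2)))"
    by (intro mult_left_mono) auto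
  moreover have "cost (lev_moment d k j) ?l = 6 * fact (Suc (2 * n)) * ?l powr (- real (2 * n))"
    using True by (simp add: cost_def lev_moment_def n_def)
  moreover have "Suc (2 * n) = 2 * d + 5" by (simp add: n_def)
  moreover have "- \<bar>real j - real k\<bar> / 4 - lev_growth d k j = - s / 4 - s * (real d + 1)"
    using True by (simp add: lev_growth_def s_def)
  ultimately show ?thesis by (simp only: cost_const_def n_def mult_ac)
next
  case False
  define s where "s = real k - real j"
  have s: "s \<ge> 0" using False by (simp add: s_def)
  let ?l = "\<Lambda> * (lev_disc k j / lev_size k j) / sqrt (1 + H)"
  have "lev_disc k j / lev_size k j = 2 powr (- (3 / 2 * s))"
  proof -
    have "lev_disc k j / lev_size k j = 2 powr ((real j - real k) - (real k - real j) / 2)"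
      using False by (simp add: lev_disc_def lev_size_def powr_diff)
    also have "(real j - real k) - (real k - real j) / 2 = - (3 / 2 * s)" by (simp add: s_def field_simps)
    finally show ?thesis .
  qed
  then have l: "?l = \<Lambda> * 2 powr (- (3 / 2 * s)) / sqrt (1 + H)" by simp
  have "?l powr (- 1 / 6) = \<Lambda> powr (- 1 / 6) * (2 powr (- (3 / 2 * s))) powr (- 1 / 6) / (sqrt (1 + H)) powr (- 1 / 6)"
    unfolding l using L H by (simp add: powr_mult powr_divide)
  also have "(2 powr (- (3 / 2 * s))) powr (- 1 / 6) = 2 powr (s / 4)" by (simp add: powr_powr)
  also have "(sqrt (1 + H)) powr (- 1 / 6) = 1 / (sqrt (1 + H)) powr (1 / 6)"
    by (simp add: powr_minus_divide)
  finally have "?l powr (- 1 / 6) = \<Lambda> powr (- 1 / 6) * 2 powr (s / 4) * (sqrt (1 + H)) powr (1 / 6)" by simp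
  also have "\<dots> \<le> \<Lambda> powr (- 1 / 6) * 2 powr (- s / 4 + s * (real d - 1 / 2)) * (2 ^ 1 * fact 1 * 2 * exp (H / 2))"
  proof (intro mult_mono)
    have "s * 1 \<le> s * real d" using s d by (intro mult_left_mono) auto
    then have "s / 4 \<le> - s / 4 + s * (real d - 1 / 2)" by (simp add: algebra_simps)
    then show "2 powr (s / 4) \<le> 2 powr (- s / 4 + s * (real d - 1 / 2))" by (intro powr_mono) auto
    have "(sqrt (1 + H)) powr (1 / 6) \<le> (sqrt (1 + H)) powr 2" using H by (intro powr_mono) auto
    also have "\<dots> = (1 + H) ^ 1" using H by (simp add: powr_numeral)
    also have "\<dots> \<le> 2 ^ 1 * fact 1 * 2 * exp (H / 2)" by (rule power_le_exp_half[OF H])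
    finally show "(sqrt (1 + H)) powr (1 / 6) \<le> 2 ^ 1 * fact 1 * 2 * exp (H / 2)" .
  qed (use H in auto)
  finally have "12 * ?l powr (- 1 / 6) \<le> 12 * (\<Lambda> powr (- 1 / 6) * 2 powr (- s / 4 + s * (real d - 1 / 2)) * (2 ^ 1 * fact 1 * 2 * exp (H / 2)))"
    by (rule mult_left_mono) simp
  also have "\<dots> = 48 * (\<Lambda> powr (- 1 / 6) * 2 powr (- s / 4 + s * (real d - 1 / 2)) * exp (H / 2))" by simp
  also have "\<dots> \<le> cost_const d * (\<Lambda> powr (- 1 / 6) * 2 powr (- s / 4 + s * (real d - 1 / 2)) * exp (H / 2))"
  proof (rule mult_right_mono)
    have "6 * 1 * 2 ^ 2 * 1 * 2 \<le> 6 * fact (2 * d + 5) * 2 ^ (d + 2) * fact (d + 2) * (2::real)"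
      by (intro mult_mono power_increasing fact_ge_1) auto
    then show "48 \<le> cost_const d" by (simp add: cost_const_def)
  qed simp
  finally have "12 * ?l powr (- 1 / 6) \<le> cost_const d * (\<Lambda> powr (- 1 / 6) * 2 powr (- s / 4 + s * (real d - 1 / 2)) * exp (H / 2))" .
  moreover have "cost (lev_moment d k j) ?l = 12 * ?l powr (- 1 / 6)"
    using False by (simp add: cost_def lev_moment_def)
  moreover have "- \<bar>real j - real k\<bar> / 4 - lev_growth d k j = - s / 4 + s * (real d - 1 / 2)"
  proof -
    have "\<bar>real j - real k\<bar> = s" using False by (simp add: s_def)
    moreover have "lev_growth d k j = - (s * (real d - 1 / 2))"
      using False by (simp add: lev_growth_def s_def left_diff_distrib)
    ultimately show ?thesis by simp
  qed
  ultimately show ?thesis by (simp only: mult_ac)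
qed

text \<open>Put \<open>v = \<rho> / \<delta>\<close>. On fine levels
  \<open>min \<delta> \<rho> = \<rho>\<close>, and up to the factor \<open>1 + H\<close> the sum is
  of order \<open>M * \<delta> ^ 3 * v\<^sup>2\<close>. On coarse levels the minimum is
  \<open>\<delta>\<close>, and the order \<open>M * \<rho>\<close> of the number of switched points
  gives \<open>M * \<delta> ^ 3 * v\<close>. This is the origin of \<open>lev_size\<close>; the
  constant is \<open>16 * 33 = 528 \<le> 23\<^sup>2\<close>.\<close>

lemma level_norm:
  fixes M \<delta> \<rho> H :: real
  assumes \<delta>: "\<delta> = (1 / 2) ^ k" and \<rho>: "\<rho> = (1 / 2) ^ j" and M: "M \<ge> 0" and H: "H \<ge> 0"
  shows "16 * (min \<delta> \<rho>)\<^sup>2 * (32 * M * \<rho> + H * (M * \<delta>)) + 16 * M * \<rho>\<^sup>2 * \<delta>\<^sup>2 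
     \<le> (23 * sqrt (M * \<delta> ^ 3) * lev_size k j * sqrt (1 + H))\<^sup>2"
    (is "?lhs \<le> _")
proof -
  have p: "(1 / 2 :: real) ^ n = 2 powr (- real n)" for n by (simp add: powr_minus powr_realpow power_one_over inverse_eq_divide)
  have d1: "0 < \<delta>" "\<delta> \<le> 1" "0 < \<rho>" "\<rho> \<le> 1" by (auto simp: \<delta> \<rho> power_le_one)
  define v where "v = 2 powr (real k - real j)"
  have v: "v > 0" "\<rho> = \<delta> * v" by (auto simp: v_def \<rho> \<delta> p powr_add[symmetric])
  have R: "(23 * sqrt (M * \<delta> ^ 3) * lev_size k j * sqrt (1 + H))\<^sup>2 = 529 * (M * \<delta> ^ 3) * (lev_size k j)\<^sup>2 * (1 + H)"
    using M d1 H by (simp add: power_mult_distrib)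
  have M3: "0 \<le> M * \<delta> ^ 3" using M d1 by simp
  show ?thesis
  proof (cases "k \<le> j")
    case True
    then have v1: "v \<le> 1" unfolding v_def using powr_mono[of "real k - real j" 0 2] by simp
    have mn: "min \<delta> \<rho> = \<delta> * v" using v v1 d1 by (simp add: min_def mult_left_le)
    have "?lhs 
      = 16 * (M * \<delta> ^ 3) * v\<^sup>2 * (32 * v + H + \<delta>)"
      by (simp only: mn) (simp add: v(2) algebra_simps power2_eq_square power3_eq_cube)
    also have "\<dots> \<le> 16 * (M * \<delta> ^ 3) * v\<^sup>2 * (33 * (1 + H))"
      using v1 d1 H M3 by (intro mult_left_mono) auto
    also have "\<dots> = 528 * ((M * \<delta> ^ 3) * v\<^sup>2 * (1 + H))" by simp
    also have "\<dots> \<le> 529 * ((M * \<delta> ^ 3) * v\<^sup>2 * (1 + H))" using M3 H by (intro mult_right_mono) auto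
    also have "\<dots> = 529 * (M * \<delta> ^ 3) * v\<^sup>2 * (1 + H)" by simp
    finally show ?thesis unfolding R using True by (simp add: lev_size_def v_def)
  next
    case False
    then have v1: "v \<ge> 1" unfolding v_def by (simp add: ge_one_powr_ge_zero)
    have mn: "min \<delta> \<rho> = \<delta>" using v v1 d1 by (simp add: min_def)
    have "?lhs 
      = 16 * (M * \<delta> ^ 3) * (32 * v + H + (\<delta> * v) * v)"
      by (simp only: mn) (simp add: v(2) algebra_simps power2_eq_square power3_eq_cube)
    also have "\<dots> \<le> 16 * (M * \<delta> ^ 3) * (32 * v + H * v + 1 * v)"
      using v1 v(2) d1 H M3 by (intro mult_left_mono add_mono mult_right_mono) (auto simp: mult_le_cancel_left1)
    also have "\<dots> = 16 * (M * \<delta> ^ 3) * v * (33 + H)" by (simp add: algebra_simps)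
    also have "\<dots> \<le> 16 * (M * \<delta> ^ 3) * v * (33 * (1 + H))" using H M3 v by (intro mult_left_mono) auto
    also have "\<dots> = 528 * ((M * \<delta> ^ 3) * v * (1 + H))" by simp
    also have "\<dots> \<le> 529 * ((M * \<delta> ^ 3) * v * (1 + H))" using M3 H v by (intro mult_right_mono) auto
    also have "\<dots> = 529 * (M * \<delta> ^ 3) * v * (1 + H)" by simp
    finally have "?lhs \<le> 529 * (M * \<delta> ^ 3) * v * (1 + H)" .
    moreover have "(lev_size k j)\<^sup>2 = v" using False by (simp add: lev_size_def v_def power2_eq_square powr_add[symmetric])
    ultimately show ?thesis unfolding R by simp
  qed
qed

text \<open>Points of level 0 have no parent, so their constraint is the full difference, at most
  \<open>2 * \<delta>\<close> for each pair. It fits because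
  \<open>\<delta> * (lev_size k 0)\<^sup>2 = 1\<close>.\<close>

lemma level_norm_0:
  fixes M \<delta> H :: real
  assumes \<delta>: "\<delta> = (1 / 2) ^ k" and M: "M \<ge> 0" and H: "H \<ge> 0"
  shows "4 * M * \<delta>\<^sup>2 \<le> (23 * sqrt (M * \<delta> ^ 3) * lev_size k 0 * sqrt (1 + H))\<^sup>2"
proof -
  have d1: "0 < \<delta>" by (simp add: \<delta>)
  have R: "(23 * sqrt (M * \<delta> ^ 3) * lev_size k 0 * sqrt (1 + H))\<^sup>2 = 529 * (M * \<delta>\<^sup>2) * (\<delta> * (lev_size k 0)\<^sup>2) * (1 + H)"
  proof -
    have "(23 * sqrt (M * \<delta> ^ 3) * lev_size k 0 * sqrt (1 + H))\<^sup>2 = 529 * (M * \<delta> ^ 3) * (lev_size k 0)\<^sup>2 * (1 + H)"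
      using M d1 H by (simp add: power_mult_distrib)
    then show ?thesis by (simp add: power2_eq_square power3_eq_cube)
  qed
  have "\<delta> * (lev_size k 0)\<^sup>2 = 1"
    by (cases "k = 0") (simp_all add: \<delta> lev_size_def powr_power powr_realpow power_one_over)
  then have "(23 * sqrt (M * \<delta> ^ 3) * lev_size k 0 * sqrt (1 + H))\<^sup>2 = 529 * (M * \<delta>\<^sup>2) * (1 + H)" using R by simp
  moreover have "4 * (M * \<delta>\<^sup>2) * 1 \<le> 529 * (M * \<delta>\<^sup>2) * (1 + H)" using M H by (intro mult_mono) auto
  ultimately show ?thesis by simp
qed

lemma level_disc_le: "lev_disc k j \<le> decay k j"
proof (cases "k \<le> j")
  case True
  then have "real k \<le> real j" by simp
  then show ?thesis using True unfolding lev_disc_def by (auto intro!: powr_mono)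
next
  case False
  then have "real j \<le> real k" by simp
  then show ?thesis using False unfolding lev_disc_def by (auto intro!: powr_mono)
qed

lemma level_pos: "lev_disc k j > 0" "lev_size k j > 0"
  by (simp_all add: lev_disc_def lev_size_def)

lemma level_growth_le:
  "(real j - real k) * d - lev_growth d k j \<le> - \<bar>real j - real k\<bar> / 4"
proof (cases "k \<le> j")
  case True
  then have "\<bar>real j - real k\<bar> = real j - real k" "real k \<le> real j" by simp_all
  moreover have "(real j - real k) * d - lev_growth d k j = - (real j - real k)" using True by (simp add: lev_growth_def algebra_simps)
  ultimately show ?thesis by simp
next
  case False
  then have "\<bar>real j - real k\<bar> = real k - real j" "real j \<le> real k" by simp_all
  moreover have "(real j - real k) * d - lev_growth d k j = (real j - real k) / 2"
    using False by (simp add: lev_growth_def right_diff_distrib)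
  ultimately show ?thesis by simp
qed

text \<open>One greedy choice serves the nets of all levels up to \<open>J\<close>, level
  \<open>j\<close> being weighted by \<open>2 powr (- lev_growth d k j)\<close>; the initial
  potential is then at most \<open>2 * N\<close>. With \<open>\<theta> = 1 / (M * \<delta>)\<close>
  each pair multiplies it by at most \<open>1 + 4 / M\<close>, all of them by at most
  \<open>exp 4\<close>, and a point separating \<open>n\<close> pairs is charged at least
  \<open>exp (n * \<theta> / 2)\<close>.\<close>

lemma separation_moments:
  fixes P :: "'a::euclidean_space set" and T :: "nat \<Rightarrow> 'a set" and f :: "'a \<Rightarrow> real"
    and C \<delta> :: real and d k M N J :: nat
  defines "d \<equiv> DIM('a) - 1" and "C \<equiv> net_const DIM('a)"
  assumes fP: "finite P" "P \<subseteq> sphere 0 1" and NP: "N \<le> 2 * card P" 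
    and k: "8 * C * 2 ^ (k * d) \<le> N" and M: "M = N div 8" and N16: "N \<ge> 16"
    and \<delta>: "\<delta> = (1 / 2) ^ k" and M\<delta>: "M * \<delta> \<ge> 1"
    and T: "\<And>j. finite (T j)" "\<And>j. card (T j) \<le> C * 2 ^ (j * d)"
  shows "\<exists>p q. (\<forall>i<M. p i \<in> P \<and> q i \<in> P \<and> f (p i) \<le> f (q i) \<and> norm (p i - q i) \<le> 2 * \<delta>) \<and>
     inj_on p {..<M} \<and> inj_on q {..<M} \<and> p ` {..<M} \<inter> q ` {..<M} = {} \<and>
     (\<forall>j\<le>J. (\<Sum>x\<in>T j. exp (card (separated M p q x) / (M * \<delta>) / 2)) \<le> 2 * exp 4 * N * 2 powr (lev_growth d k j))"
proof -
  define \<theta> where "\<theta> = 1 / (M * \<delta>)"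
  define X where "X = (SIGMA j:{..J}. T j)"
  define \<omega> where "\<omega> c = 2 powr (- lev_growth d k (fst c))" for c :: "nat \<times> 'a"
  have \<delta>1: "0 < \<delta>" "\<delta> \<le> 1" by (auto simp: \<delta> power_le_one)
  have M0: "M > 0" using M N16 by auto
  have \<theta>: "0 < \<theta>" "\<theta> \<le> 1" using M\<delta> by (auto simp: \<theta>_def divide_le_eq)
  have fX: "finite X" using T(1) by (simp add: X_def)
  have pw: "(2::real) ^ (n * d) = 2 powr (real n * d)" for n by (simp add: powr_realpow[symmetric])
  have C1: "C \<ge> 1" using net_const_ge_4[of "DIM('a)"] DIM_positive[where 'a='a] unfolding C_def by linarith
  have "(\<Sum>c\<in>X. \<omega> c) = (\<Sum>j\<le>J. \<Sum>x\<in>T j. \<omega> (j, x))" unfolding X_def using T(1) by (subst sum.Sigma) auto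
  also have "\<dots> = (\<Sum>j\<le>J. real (card (T j)) * 2 powr (- lev_growth d k j))" by (simp add: \<omega>_def)
  also have "\<dots> \<le> (\<Sum>j\<le>J. C * 2 ^ (j * d) * 2 powr (- lev_growth d k j))"
    by (intro sum_mono mult_right_mono T(2)) auto
  also have "\<dots> \<le> (\<Sum>j\<le>J. (C * 2 ^ (k * d)) * decay k j)"
  proof (rule sum_mono)
    fix j
    have "C * 2 ^ (j * d) * 2 powr (- lev_growth d k j) = (C * 2 ^ (k * d)) * 2 powr ((real j - real k) * d - lev_growth d k j)"
      unfolding pw by (simp add: powr_add[symmetric] left_diff_distrib)
    also have "\<dots> \<le> (C * 2 ^ (k * d)) * decay k j"
      using C1 by (intro mult_left_mono powr_mono level_growth_le) auto
    finally show "C * 2 ^ (j * d) * 2 powr (- lev_growth d k j) \<le> (C * 2 ^ (k * d)) * decay k j" .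
  qed
  also have "\<dots> = (C * 2 ^ (k * d)) * (\<Sum>j\<le>J. decay k j)" by (rule sum_distrib_left[symmetric])
  also have "\<dots> \<le> (real N / 8) * 16" using k C1 by (intro mult_mono two_sided_geometric sum_nonneg) auto
  finally have sum\<omega>: "(\<Sum>c\<in>X. \<omega> c) \<le> 2 * real N" by simp
  have "M * 8 \<le> N" unfolding M by simp
  then have "real (M * 8) \<le> real N" unfolding of_nat_le_iff .
  then have M8: "8 * real M \<le> N" by simp
  have "(1 / \<delta>) ^ d = 2 ^ (k * d)" by (simp add: \<delta> power_divide power_mult)
  then have "C * (1 / \<delta>) ^ d = C * 2 ^ (k * d)" by simp
  moreover have "real N \<le> 2 * real (card P)" using NP by linarith
  \<comment> \<open>The net takes at most \<open>N / 8\<close> points and the pairs at most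
    \<open>N / 4\<close>, together fewer than the \<open>N / 2\<close> available.\<close>
  ultimately have "C * (1 / \<delta>) ^ d + 2 * real M < card P" using k N16 M8 by linarith
  then obtain p q where pq: "\<forall>i<M. p i \<in> P \<and> q i \<in> P \<and> f (p i) \<le> f (q i) \<and> norm (p i - q i) \<le> 2 * \<delta>"
     "inj_on p {..<M}" "inj_on q {..<M}" "p ` {..<M} \<inter> q ` {..<M} = {}"
     "(\<Sum>c\<in>X. \<omega> c * (1 + \<theta>) ^ card {i\<in>{..<M}. separates (snd c) (p i) (q i)}) \<le> (1 + 4 * \<delta> * \<theta>) ^ M * (\<Sum>c\<in>X. \<omega> c)"
    using greedy_pairs[where x = snd and f = f and \<omega> = \<omega> and k = M and r = \<delta> and \<theta> = \<theta>, OF fP fX _ \<delta>1] \<theta>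
    unfolding C_def d_def by (auto simp: \<omega>_def)
  let ?s = "\<lambda>x. card (separated M p q x)"
  have "(1 + 4 * \<delta> * \<theta>) ^ M \<le> exp (4 * \<delta> * \<theta>) ^ M"
    using \<delta>1 \<theta> by (intro power_mono exp_ge_add_one_self) auto
  also have "\<dots> = exp (M * (4 * \<delta> * \<theta>))" by (rule exp_of_nat_mult[symmetric])
  also have "M * (4 * \<delta> * \<theta>) = 4" using M0 \<delta>1 by (simp add: \<theta>_def)
  finally have e4: "(1 + 4 * \<delta> * \<theta>) ^ M \<le> exp 4" .
  have ebd: "exp (real n / (M * \<delta>) / 2) \<le> (1 + \<theta>) ^ n" for n
  proof -
    have "exp (\<theta> / 2) \<le> 1 + \<theta> / 2 + (\<theta> / 2)\<^sup>2" using \<theta> by (intro exp_bound) auto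
    also have "\<dots> \<le> 1 + \<theta>"
    proof -
      have "\<theta> * \<theta> \<le> \<theta> * 1" using \<theta> by (intro mult_left_mono) auto
      moreover have "(\<theta> / 2)\<^sup>2 = \<theta> * \<theta> / 4" by (simp add: power2_eq_square)
      ultimately show ?thesis using \<theta> by linarith
    qed
    finally have "exp (\<theta> / 2) ^ n \<le> (1 + \<theta>) ^ n" by (intro power_mono) auto
    moreover have "exp (\<theta> / 2) ^ n = exp (real n / (M * \<delta>) / 2)" by (simp add: exp_of_nat_mult[symmetric] \<theta>_def)
    ultimately show ?thesis by simp
  qed
  have lev: "(\<Sum>x\<in>T j. exp (?s x / (M * \<delta>) / 2)) \<le> 2 * exp 4 * N * 2 powr (lev_growth d k j)" if j: "j \<le> J" for j
  proof -
    let ?g = "2 powr (lev_growth d k j)"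
    have "(\<Sum>x\<in>T j. exp (?s x / (M * \<delta>) / 2)) \<le> (\<Sum>x\<in>T j. (1 + \<theta>) ^ ?s x)" by (intro sum_mono ebd)
    also have "\<dots> = ?g * (\<Sum>x\<in>T j. \<omega> (j, x) * (1 + \<theta>) ^ ?s x)"
      by (simp add: \<omega>_def sum_distrib_left powr_minus mult.assoc[symmetric])
    also have "(\<Sum>x\<in>T j. \<omega> (j, x) * (1 + \<theta>) ^ ?s x) \<le> (\<Sum>i\<le>J. \<Sum>x\<in>T i. \<omega> (i, x) * (1 + \<theta>) ^ ?s x)"
      using j \<theta> by (intro member_le_sum[where f = "\<lambda>i. \<Sum>x\<in>T i. \<omega> (i, x) * (1 + \<theta>) ^ ?s x"]) (auto intro!: sum_nonneg simp: \<omega>_def)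
    also have "\<dots> = (\<Sum>c\<in>X. \<omega> c * (1 + \<theta>) ^ ?s (snd c))"
      unfolding X_def using T(1) by (subst sum.Sigma) (auto simp: case_prod_beta)
    also have "\<dots> \<le> exp 4 * (2 * real N)"
    proof -
      have "(1 + 4 * \<delta> * \<theta>) ^ M * (\<Sum>c\<in>X. \<omega> c) \<le> exp 4 * (2 * real N)"
        using e4 sum\<omega> by (intro mult_mono sum_nonneg) (auto simp: \<omega>_def)
      then show ?thesis using pq(5) by linarith
    qed
    finally show ?thesis by (simp add: mult_ac)
  qed
  show ?thesis using pq lev by blast
qed

text \<open>Partial coloring is applied to the increments of the chain: the constraint of
  \<open>(j, x)\<close> compares \<open>x\<close> with its parent on level \<open>j - 1\<close>.
  Allowances summed along the parents bound the signed sum at every net point. The function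
  \<open>f\<close> will be the weight of an atom, rescaled to be at most 1.\<close>

lemma scale_discrepancy:
  fixes P :: "'a::euclidean_space set" and f :: "'a \<Rightarrow> real"
    and C \<delta> \<Lambda> :: real and d k M N :: nat
  defines "d \<equiv> DIM('a) - 1" and "C \<equiv> net_const DIM('a)"
  assumes d1: "d \<ge> 1"
    and fP: "finite P" "P \<subseteq> sphere 0 1" and PN: "card P \<le> N" and NP: "N \<le> 2 * card P" 
    and f: "\<And>z. z \<in> P \<Longrightarrow> 0 \<le> f z \<and> f z \<le> 1"
    and k: "8 * C * 2 ^ (k * d) \<le> N" and M: "M = N div 8" and N16: "N \<ge> 16"
    and \<delta>: "\<delta> = (1 / 2) ^ k" and M\<delta>: "M * \<delta> \<ge> 1"
    and \<Lambda>: "\<Lambda> \<ge> 1" "16384 * exp 4 * cost_const d * \<Lambda> powr (- 1 / 6) \<le> 1"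
  shows "\<exists>p q \<epsilon>. (\<forall>i<M. p i \<in> P \<and> q i \<in> P \<and> f (p i) \<le> f (q i) \<and> \<epsilon> i \<in> {-1, 0, 1::real}) \<and>
     inj_on p {..<M} \<and> inj_on q {..<M} \<and> p ` {..<M} \<inter> q ` {..<M} = {} \<and>
     M \<le> 16 * card {i\<in>{..<M}. \<epsilon> i \<noteq> 0} \<and>
     (\<forall>x\<in>sphere 0 1. \<bar>\<Sum>i<M. \<epsilon> i * f (p i) * pairdiff (p i) (q i) x\<bar> \<le> 400 * \<Lambda> * sqrt (M * \<delta> ^ 3))"
proof -
  have \<delta>1: "0 < \<delta>" "\<delta> \<le> 1" by (auto simp: \<delta> power_le_one)
  have M2: "M \<ge> 2" using M N16 by auto
  have NM: "real N \<le> 16 * M" using M N16 by linarith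
  define R where "R = 23 * sqrt (M * \<delta> ^ 3)"
  have R0: "R > 0" "sqrt (M * \<delta> ^ 3) > 0" using M2 \<delta>1 by (auto simp: R_def)
  \<comment> \<open>The last level is so fine that the plain Lipschitz bound, summed over all
    \<open>M\<close> pairs, stays below the target size.\<close>
  obtain J where J: "2 * real M * (1 / 2) ^ J \<le> sqrt (M * \<delta> ^ 3)"
  proof -
    obtain J where "(1 / 2 :: real) ^ J < sqrt (M * \<delta> ^ 3) / (2 * real M)"
      using real_arch_pow_inv[of "sqrt (M * \<delta> ^ 3) / (2 * real M)" "1/2"] R0 M2 by auto
    then show ?thesis using that[of J] M2 by (simp add: field_simps)
  qed
  have "\<forall>j. \<exists>T. finite T \<and> T \<subseteq> sphere 0 1 \<and> card T \<le> C * (1 / (1 / 2) ^ j) ^ d \<and>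
    (\<forall>x\<in>sphere 0 1. \<exists>x'\<in>T. norm (x - x') \<le> (1 / 2) ^ j \<and>
        card (switching P (\<lambda>z. z) x x') \<le> (1 / 2) ^ j * card P)"
    unfolding C_def d_def by (intro allI sphere_net fP) (auto simp: power_le_one)
  then obtain T where T0: "\<forall>j. finite (T j) \<and> T j \<subseteq> sphere 0 1 \<and> card (T j) \<le> C * (1 / (1 / 2) ^ j) ^ d \<and>
    (\<forall>x\<in>sphere 0 1. \<exists>x'\<in>T j. norm (x - x') \<le> (1 / 2) ^ j \<and>
        card (switching P (\<lambda>z. z) x x') \<le> (1 / 2) ^ j * card P)"
    by (rule choice[THEN exE])
  have T: "finite (T j)" "T j \<subseteq> sphere 0 1" "card (T j) \<le> C * 2 ^ (j * d)" for j
    using T0[rule_format, of j] by (simp_all add: power_divide power_mult)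
  have near: "\<exists>x'\<in>T j. norm (x - x') \<le> (1 / 2) ^ j \<and> card (switching P (\<lambda>z. z) x x') \<le> (1 / 2) ^ j * card P"
    if "x \<in> sphere 0 1" for x j using T0[rule_format, of j] that by blast
  obtain p q where pq: "\<And>i. i < M \<Longrightarrow> p i \<in> P \<and> q i \<in> P \<and> f (p i) \<le> f (q i) \<and> norm (p i - q i) \<le> 2 * \<delta>"
     and inj: "inj_on p {..<M}" "inj_on q {..<M}" "p ` {..<M} \<inter> q ` {..<M} = {}"
     and mom: "\<And>j. j \<le> J \<Longrightarrow> (\<Sum>x\<in>T j. exp (card (separated M p q x) / (M * \<delta>) / 2)) \<le> 2 * exp 4 * N * 2 powr (lev_growth d k j)"
    using separation_moments[OF fP NP k[unfolded C_def d_def] M N16 \<delta> M\<delta> T(1) T(3)[unfolded C_def d_def], of f J] unfolding d_def by blast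
  define H where "H x = card (separated M p q x) / (M * \<delta>)" for x
  have H0: "H x \<ge> 0" for x using \<delta>1 by (simp add: H_def)
  have Hc: "real (card (separated M p q x)) = H x * (M * \<delta>)" for x using \<delta>1 M2 by (simp add: H_def)
  have "\<forall>c. \<exists>x'. fst c \<ge> 1 \<and> snd c \<in> sphere 0 1 \<longrightarrow> x' \<in> T (fst c - 1) \<and> norm (snd c - x') \<le> (1 / 2) ^ (fst c - 1) \<and>
       card (switching P (\<lambda>z. z) (snd c) x') \<le> (1 / 2) ^ (fst c - 1) * card P"
    using near by blast
  then obtain par where par0: "\<forall>c. fst c \<ge> 1 \<and> snd c \<in> sphere 0 1 \<longrightarrow> par c \<in> T (fst c - 1) \<and> norm (snd c - par c) \<le> (1 / 2) ^ (fst c - 1) \<and>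
       card (switching P (\<lambda>z. z) (snd c) (par c)) \<le> (1 / 2) ^ (fst c - 1) * card P"
    by (rule choice[THEN exE])
  have par: "fst c \<ge> 1 \<Longrightarrow> snd c \<in> sphere 0 1 \<Longrightarrow> par c \<in> T (fst c - 1) \<and> norm (snd c - par c) \<le> (1 / 2) ^ (fst c - 1) \<and>
       card (switching P (\<lambda>z. z) (snd c) (par c)) \<le> (1 / 2) ^ (fst c - 1) * card P"
    for c using par0[rule_format, of c] by simp
  define X where "X = (SIGMA j:{..J}. T j)"
  have fX: "finite X" using T(1) by (simp add: X_def)
  define g where "g i x = pairdiff (p i) (q i) x" for i x
  \<comment> \<open>On level 0 nothing is subtracted, so the increments along a chain telescope to
    the full value.\<close>
  define a where "a c i = f (p i) * (g i (snd c) - (if fst c = 0 then 0 else g i (par c)))" for c i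
  define \<sigma> where "\<sigma> c = R * lev_size k (fst c) * sqrt (1 + H (snd c))" for c :: "nat \<times> 'a"
  define \<tau> where "\<tau> c = \<Lambda> * R * lev_disc k (fst c)" for c :: "nat \<times> 'a"
  have \<sigma>0: "\<sigma> c > 0" for c unfolding \<sigma>_def using R0 level_pos H0[of "snd c"] by (auto intro!: mult_pos_pos add_pos_nonneg)
  have \<tau>0: "\<tau> c > 0" for c unfolding \<tau>_def using R0 level_pos \<Lambda> by auto
  have fp: "0 \<le> f (p i) \<and> f (p i) \<le> 1" if "i < M" for i using f pq that by blast
  have norm_bd: "(\<Sum>i<M. (a c i)\<^sup>2) \<le> (\<sigma> c)\<^sup>2" if c: "c \<in> X" for c
  proof -
    obtain j x where jx: "c = (j, x)" "j \<le> J" "x \<in> T j" using c by (auto simp: X_def)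
    have x1: "x \<in> sphere 0 1" using jx T(2) by blast
    show ?thesis
    proof (cases "j = 0")
      case True
      have "(\<Sum>i<M. (a c i)\<^sup>2) \<le> (\<Sum>i<M. 4 * \<delta>\<^sup>2)"
      proof (rule sum_mono)
        fix i assume i: "i \<in> {..<M}"
        have "\<bar>a c i\<bar> \<le> 1 * (2 * \<delta>)"
          unfolding a_def abs_mult using True jx fp[of i] i pairdiff_le[of x "p i" "q i"] x1 pq[of i]
          by (intro mult_mono) (auto simp: g_def)
        then have "\<bar>a c i\<bar> \<le> \<bar>2 * \<delta>\<bar>" by simp
        then have "(a c i)\<^sup>2 \<le> (2 * \<delta>)\<^sup>2" by (simp only: abs_le_square_iff)
        then show "(a c i)\<^sup>2 \<le> 4 * \<delta>\<^sup>2" by (simp add: power_mult_distrib)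
      qed
      also have "\<dots> = 4 * real M * \<delta>\<^sup>2" by simp
      also have "\<dots> \<le> (\<sigma> c)\<^sup>2" using level_norm_0[OF \<delta>, of "real M" "H x"] H0 True jx by (simp add: \<sigma>_def R_def)
      finally show ?thesis .
    next
      case False
      define \<rho> :: real where "\<rho> = (1 / 2) ^ j"
      have \<rho>2: "(1 / 2 :: real) ^ (j - 1) = 2 * \<rho>" using False by (cases j) (auto simp: \<rho>_def)
      have pr: "par c \<in> T (j - 1)" "norm (x - par c) \<le> 2 * \<rho>" "card (switching P (\<lambda>z. z) x (par c)) \<le> 2 * \<rho> * card P"
        using par[of c] False jx x1 \<rho>2 by auto
      have "2 * \<rho> * card P \<le> 2 * \<rho> * (16 * real M)" using PN NM by (intro mult_left_mono) (auto simp: \<rho>_def)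
      also have "\<dots> = 32 * real M * \<rho>" by simp
      finally have sw: "real (card (switching P (\<lambda>z. z) x (par c))) \<le> 32 * real M * \<rho>" using pr(3) by linarith
      have "par c \<in> sphere 0 1" using pr(1) T(2) by blast
      then have "(\<Sum>i<M. (f (p i) * (pairdiff (p i) (q i) x - pairdiff (p i) (q i) (par c)))\<^sup>2) 
        \<le> 16 * (min \<delta> \<rho>)\<^sup>2 * (32 * real M * \<rho> + real (card (separated M p q x))) + 16 * real M * \<rho>\<^sup>2 * \<delta>\<^sup>2"
        using x1 pq pr(2) fp sw by (intro constraint_norm[OF fP _ inj _ _ _ _ _ \<delta>1(1)]) auto
      also have "\<dots> \<le> (\<sigma> c)\<^sup>2" unfolding Hc using level_norm[OF \<delta> \<rho>_def, of "real M" "H x"] H0 jx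
        by (simp add: \<sigma>_def R_def)
      finally show ?thesis using False jx by (simp add: a_def g_def)
    qed
  qed
  have cost: "(\<Sum>c\<in>X. cost (lev_moment d k (fst c)) (\<tau> c / \<sigma> c)) \<le> card {..<M} / 32"
  proof -
    define K where "K = cost_const d * \<Lambda> powr (- 1 / 6)"
    have K0: "K \<ge> 0" by (simp add: K_def cost_const_def)
    have "(\<Sum>c\<in>X. cost (lev_moment d k (fst c)) (\<tau> c / \<sigma> c)) \<le> (\<Sum>c\<in>X. K * 2 powr (- \<bar>real (fst c) - real k\<bar> / 4 - lev_growth d k (fst c)) * exp (H (snd c) / 2))"
    proof (rule sum_mono)
      fix c assume "c \<in> X"
      have "\<tau> c / \<sigma> c = \<Lambda> * (lev_disc k (fst c) / lev_size k (fst c)) / sqrt (1 + H (snd c))"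
        using R0 by (simp add: \<tau>_def \<sigma>_def)
      then show "cost (lev_moment d k (fst c)) (\<tau> c / \<sigma> c) \<le> K * 2 powr (- \<bar>real (fst c) - real k\<bar> / 4 - lev_growth d k (fst c)) * exp (H (snd c) / 2)"
        using level_cost[OF \<Lambda>(1) H0 d1, of k "fst c" "snd c"] by (simp add: K_def)
    qed
    also have "\<dots> = (\<Sum>j\<le>J. \<Sum>x\<in>T j. K * 2 powr (- \<bar>real j - real k\<bar> / 4 - lev_growth d k j) * exp (H x / 2))"
      unfolding X_def using T(1) by (subst sum.Sigma) (auto simp: case_prod_beta)
    also have "\<dots> = (\<Sum>j\<le>J. K * 2 powr (- \<bar>real j - real k\<bar> / 4 - lev_growth d k j) * (\<Sum>x\<in>T j. exp (H x / 2)))"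
      by (simp add: sum_distrib_left)
    \<comment> \<open>The moment bound of level \<open>j\<close> cancels the factor
      \<open>2 powr (- lev_growth d k j)\<close> of the costs and leaves only the decay, with sum at
      most 16. As \<open>N / 512 \<le> M / 32\<close>, the number
      \<open>2 * 16 * 512 = 16384\<close> in the condition on \<open>\<Lambda>\<close> is what is
      required.\<close>
    also have "\<dots> \<le> (\<Sum>j\<le>J. K * 2 powr (- \<bar>real j - real k\<bar> / 4 - lev_growth d k j) * (2 * exp 4 * N * 2 powr (lev_growth d k j)))"
      using K0 mom unfolding H_def by (intro sum_mono mult_left_mono) auto
    also have "\<dots> = (\<Sum>j\<le>J. (2 * exp 4 * K * N) * decay k j)"
      by (intro sum.cong refl) (simp add: powr_diff)
    also have "\<dots> = (2 * exp 4 * K * N) * (\<Sum>j\<le>J. decay k j)" by (rule sum_distrib_left[symmetric])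
    also have "\<dots> \<le> (2 * exp 4 * K * N) * 16" using K0 by (intro mult_left_mono two_sided_geometric) auto
    also have "\<dots> = (16384 * exp 4 * K) * (N / 512)" by simp
    also have "\<dots> \<le> 1 * (N / 512)" using \<Lambda>(2) unfolding K_def by (intro mult_right_mono) (auto simp: mult.assoc)
    also have "\<dots> \<le> M / 32" using NM by simp
    finally show ?thesis by simp
  qed
  have "\<exists>\<epsilon>. (\<forall>i\<in>{..<M}. \<epsilon> i \<in> {-1, 0, 1::real}) \<and> card {..<M} \<le> 16 * card {i\<in>{..<M}. \<epsilon> i \<noteq> 0} \<and> 
    (\<forall>c\<in>X. \<bar>\<Sum>i<M. a c i * \<epsilon> i\<bar> \<le> \<tau> c)"
    by (rule partial_coloring[where \<sigma> = \<sigma> and m = "\<lambda>c. lev_moment d k (fst c)"])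
      (use fX M2 \<tau>0 \<sigma>0 norm_bd cost in simp_all)
  then obtain \<epsilon> where \<epsilon>0: "\<forall>i\<in>{..<M}. \<epsilon> i \<in> {-1, 0, 1::real}" "card {..<M} \<le> 16 * card {i\<in>{..<M}. \<epsilon> i \<noteq> 0}"
    "\<forall>c\<in>X. \<bar>\<Sum>i<M. a c i * \<epsilon> i\<bar> \<le> \<tau> c" by (elim exE conjE)
  have \<epsilon>: "\<And>i. i < M \<Longrightarrow> \<epsilon> i \<in> {-1, 0, 1::real}" "M \<le> 16 * card {i\<in>{..<M}. \<epsilon> i \<noteq> 0}"
      "\<And>c. c \<in> X \<Longrightarrow> \<bar>\<Sum>i<M. a c i * \<epsilon> i\<bar> \<le> \<tau> c"
    using \<epsilon>0(1)[THEN bspec] \<epsilon>0(2) \<epsilon>0(3)[THEN bspec] by simp_all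
  define D where "D x = (\<Sum>i<M. \<epsilon> i * f (p i) * g i x)" for x
  have chain: "\<bar>D x\<bar> \<le> (\<Sum>l\<le>j. \<Lambda> * R * lev_disc k l)" if "j \<le> J" "x \<in> T j" for j x
    using that
  proof (induction j arbitrary: x)
    case 0
    then have "(0, x) \<in> X" by (auto simp: X_def)
    from \<epsilon>(3)[OF this] show ?case by (simp add: a_def D_def \<tau>_def mult_ac)
  next
    case (Suc j)
    then have c: "(Suc j, x) \<in> X" by (auto simp: X_def)
    have x1: "x \<in> sphere 0 1" using Suc.prems T(2) by blast
    define x' where "x' = par (Suc j, x)"
    have "x' \<in> T j" using par[of "(Suc j, x)"] x1 by (simp add: x'_def)
    then have 1: "\<bar>D x'\<bar> \<le> (\<Sum>l\<le>j. \<Lambda> * R * lev_disc k l)" using Suc by simp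
    have "D x - D x' = (\<Sum>i<M. a (Suc j, x) i * \<epsilon> i)"
      unfolding D_def sum_subtractf[symmetric] by (intro sum.cong) (auto simp: a_def x'_def algebra_simps)
    then have "\<bar>D x - D x'\<bar> \<le> \<Lambda> * R * lev_disc k (Suc j)" using \<epsilon>(3)[OF c] by (simp add: \<tau>_def)
    then show ?case using 1 by simp
  qed
  have total: "\<bar>D x\<bar> \<le> 400 * \<Lambda> * sqrt (M * \<delta> ^ 3)" if x: "x \<in> sphere 0 1" for x
  proof -
    obtain x' where x': "x' \<in> T J" "norm (x - x') \<le> (1 / 2) ^ J" using near[OF x, of J] by blast
    have "\<bar>D x'\<bar> \<le> (\<Sum>l\<le>J. \<Lambda> * R * lev_disc k l)" by (rule chain) (use x' in auto)
    also have "\<dots> \<le> (\<Sum>l\<le>J. \<Lambda> * R * decay k l)"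
      using \<Lambda> R0 by (intro sum_mono mult_left_mono level_disc_le) auto
    also have "\<dots> = \<Lambda> * R * (\<Sum>l\<le>J. decay k l)" by (rule sum_distrib_left[symmetric])
    also have "\<dots> \<le> \<Lambda> * R * 16" using \<Lambda> R0 by (intro mult_left_mono two_sided_geometric) auto
    \<comment> \<open>The factor is \<open>23 * 16 = 368\<close>; the error beyond the last level
      adds at most 1 to it, which stays within 400.\<close>
    finally have 1: "\<bar>D x'\<bar> \<le> 368 * (\<Lambda> * sqrt (M * \<delta> ^ 3))" by (simp add: R_def)
    have "\<bar>D x - D x'\<bar> = \<bar>\<Sum>i<M. \<epsilon> i * f (p i) * (g i x - g i x')\<bar>"
      unfolding D_def sum_subtractf[symmetric] by (simp add: right_diff_distrib)
    also have "\<dots> \<le> (\<Sum>i<M. \<bar>\<epsilon> i * f (p i) * (g i x - g i x')\<bar>)" by (rule sum_abs)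
    also have "\<dots> \<le> (\<Sum>i<M. 1 * 1 * (2 * (1 / 2) ^ J))"
    proof (rule sum_mono)
      fix i assume "i \<in> {..<M}"
      then have i: "i < M" by simp
      have "\<bar>\<epsilon> i\<bar> \<le> 1" using \<epsilon>(1)[OF i] by auto
      moreover have "\<bar>f (p i)\<bar> \<le> 1" using fp[OF i] by simp
      moreover have "norm (p i) = 1" "norm (q i) = 1" using pq[OF i] fP(2) by auto
      then have "\<bar>g i x - g i x'\<bar> \<le> 2 * (1 / 2) ^ J"
        using pairdiff_lipschitz[of "p i" "q i" x x'] x'(2) by (simp add: g_def)
      ultimately show "\<bar>\<epsilon> i * f (p i) * (g i x - g i x')\<bar> \<le> 1 * 1 * (2 * (1 / 2) ^ J)"
        unfolding abs_mult by (intro mult_mono) auto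
    qed
    also have "\<dots> \<le> sqrt (M * \<delta> ^ 3)" using J by (simp add: mult_ac)
    also have "\<dots> \<le> \<Lambda> * sqrt (M * \<delta> ^ 3)" using \<Lambda>(1) R0(2) by simp
    finally have 2: "\<bar>D x - D x'\<bar> \<le> \<Lambda> * sqrt (M * \<delta> ^ 3)" .
    have "0 \<le> \<Lambda> * sqrt (M * \<delta> ^ 3)" using \<Lambda>(1) R0(2) by simp
    then show ?thesis using 1 2 by linarith
  qed
  show ?thesis
    by (intro exI[of _ p] exI[of _ q] exI[of _ \<epsilon>] conjI)
      (use pq \<epsilon>(1,2) inj total[unfolded D_def g_def] in auto)
qed

section \<open>Reducing the support\<close>

text \<open>For nonnegative weights this is the support function of a zonotope, the Minkowski sum of
  the segments from \<open>- w z *\<^sub>R z\<close> to \<open>w z *\<^sub>R z\<close>.\<close>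

abbreviation support_fun :: "'a::euclidean_space set \<Rightarrow> ('a \<Rightarrow> real) \<Rightarrow> 'a \<Rightarrow> real" where
  "support_fun S w x \<equiv> \<Sum>z\<in>S. w z * \<bar>x \<bullet> z\<bar>"

abbreviation prob_weights :: "'a::euclidean_space set \<Rightarrow> ('a \<Rightarrow> real) \<Rightarrow> bool" where
  "prob_weights S w \<equiv> finite S \<and> S \<subseteq> sphere 0 1 \<and> (\<forall>z\<in>S. w z \<ge> 0) \<and> (\<Sum>z\<in>S. w z) = 1"

abbreviation reducible :: "'a::euclidean_space set \<Rightarrow> ('a \<Rightarrow> real) \<Rightarrow> nat \<Rightarrow> real \<Rightarrow> bool" where
  "reducible S w n e \<equiv> \<exists>S' w'. S' \<subseteq> S \<and> (\<forall>z\<in>S'. w' z \<ge> 0) \<and> (\<Sum>z\<in>S'. w' z) = 1 \<and> card S' \<le> n \<and>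
    (\<forall>x\<in>sphere 0 1. \<bar>support_fun S w x - support_fun S' w' x\<bar> \<le> e)"

text \<open>The signed mass \<open>\<eta> i * w (p i)\<close> moves from \<open>q i\<close> to
  \<open>p i\<close>. Since \<open>w (p i) \<le> w (q i)\<close> and no atom occurs twice among the
  endpoints, weights stay nonnegative, and the sign -1 empties \<open>p i\<close>. The identity for
  all \<open>F\<close> yields both conservation of mass and the error.\<close>

lemma transfer_mass:
  fixes S :: "'a::euclidean_space set" and w :: "'a \<Rightarrow> real" and \<eta> :: "nat \<Rightarrow> real"
  assumes fS: "finite S" and w: "\<And>z. z \<in> S \<Longrightarrow> w z \<ge> 0"
    and pq: "\<And>i. i < M \<Longrightarrow> p i \<in> S \<and> q i \<in> S \<and> w (p i) \<le> w (q i) \<and> \<eta> i \<in> {-1, 0, 1}"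
    and inj: "inj_on p {..<M}" "inj_on q {..<M}" "p ` {..<M} \<inter> q ` {..<M} = {}"
  shows "\<exists>w'. (\<forall>z\<in>S. w' z \<ge> 0) \<and> (\<forall>i<M. \<eta> i = -1 \<longrightarrow> w' (p i) = 0) \<and>
    (\<forall>F. (\<Sum>z\<in>S. w' z * F z) = (\<Sum>z\<in>S. w z * F z) + (\<Sum>i<M. \<eta> i * w (p i) * (F (p i) - F (q i))))"
proof -
  define w' where "w' z = w z + (\<Sum>i<M. \<eta> i * w (p i) * (of_bool (z = p i) - of_bool (z = q i)))" for z
  define c where "c i = \<eta> i * w (p i)" for i
  have w'_eq: "w' z = w z + (\<Sum>i<M. c i * of_bool (z = p i)) - (\<Sum>i<M. c i * of_bool (z = q i))" for z
    by (simp add: w'_def c_def right_diff_distrib sum_subtractf)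
  have hit: "(\<Sum>i<M. c i * of_bool (r j = r i)) = c j" if r: "inj_on r {..<M}" and j: "j < M" for r :: "nat \<Rightarrow> 'a" and j
  proof -
    have "(\<Sum>i<M. c i * of_bool (r j = r i)) = (\<Sum>i<M. if j = i then c i else 0)"
      using r j by (intro sum.cong) (auto simp: inj_on_eq_iff)
    then show ?thesis using j by simp
  qed
  have miss: "(\<Sum>i<M. c i * of_bool (z = r i)) = 0" if "z \<notin> r ` {..<M}" for z and r :: "nat \<Rightarrow> 'a"
    by (rule sum.neutral) (use that in auto)
  have at_p: "w' (p j) = w (p j) + \<eta> j * w (p j)" if j: "j < M" for j
  proof -
    have "p j \<notin> q ` {..<M}" using inj(3) j by blast
    then show ?thesis unfolding w'_eq hit[OF inj(1) j] miss[OF \<open>p j \<notin> q ` {..<M}\<close>] by (simp add: c_def)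
  qed
  have at_q: "w' (q j) = w (q j) - \<eta> j * w (p j)" if j: "j < M" for j
  proof -
    have "q j \<notin> p ` {..<M}" using inj(3) j by blast
    then show ?thesis unfolding w'_eq hit[OF inj(2) j] miss[OF \<open>q j \<notin> p ` {..<M}\<close>] by (simp add: c_def)
  qed
  have else_w: "w' z = w z" if "z \<notin> p ` {..<M}" "z \<notin> q ` {..<M}" for z
    unfolding w'_eq miss[OF that(1)] miss[OF that(2)] by simp
  have pos: "w' z \<ge> 0" if z: "z \<in> S" for z
  proof -
    consider (a) j where "j < M" "z = p j" | (b) j where "j < M" "z = q j" | (c) "z \<notin> p ` {..<M}" "z \<notin> q ` {..<M}"
      by auto
    then show ?thesis
    proof cases
      case a
      have "w (p j) \<ge> 0" using pq[OF a(1)] w by blast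
      moreover have "\<eta> j = -1 \<or> \<eta> j = 0 \<or> \<eta> j = 1" using pq[OF a(1)] by auto
      ultimately show ?thesis using at_p[OF a(1)] a(2) by auto
    next
      case b
      have "w (p j) \<ge> 0" "w (p j) \<le> w (q j)" using pq[OF b(1)] w by blast+
      moreover have "\<eta> j = -1 \<or> \<eta> j = 0 \<or> \<eta> j = 1" using pq[OF b(1)] by auto
      ultimately show ?thesis using at_q[OF b(1)] b(2) by auto
    next
      case c
      then show ?thesis using else_w w z by simp
    qed
  qed
  have mass: "(\<Sum>z\<in>S. w' z * F z) = (\<Sum>z\<in>S. w z * F z) + (\<Sum>i<M. \<eta> i * w (p i) * (F (p i) - F (q i)))" for F
  proof -
    have "(\<Sum>z\<in>S. (\<Sum>i<M. \<eta> i * w (p i) * (of_bool (z = p i) - of_bool (z = q i))) * F z)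
      = (\<Sum>i<M. \<Sum>z\<in>S. \<eta> i * w (p i) * (of_bool (z = p i) - of_bool (z = q i)) * F z)"
      unfolding sum_distrib_right by (rule sum.swap)
    also have "\<dots> = (\<Sum>i<M. \<eta> i * w (p i) * (F (p i) - F (q i)))"
    proof (rule sum.cong[OF refl])
      fix i assume "i \<in> {..<M}"
      then have i: "p i \<in> S" "q i \<in> S" using pq by auto
      have single: "(\<Sum>z\<in>S. of_bool (z = u) * F z) = F u" if "u \<in> S" for u
        using fS that by (simp add: of_bool_def if_distrib[of "\<lambda>c. c * F _"] cong: if_cong)
      have "(\<Sum>z\<in>S. \<eta> i * w (p i) * (of_bool (z = p i) - of_bool (z = q i)) * F z)
         = \<eta> i * w (p i) * ((\<Sum>z\<in>S. of_bool (z = p i) * F z) - (\<Sum>z\<in>S. of_bool (z = q i) * F z))"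
        unfolding sum_subtractf[symmetric] sum_distrib_left by (intro sum.cong) (auto simp: algebra_simps)
      then show "(\<Sum>z\<in>S. \<eta> i * w (p i) * (of_bool (z = p i) - of_bool (z = q i)) * F z) = \<eta> i * w (p i) * (F (p i) - F (q i))"
        using single i by simp
    qed
    finally show ?thesis by (simp add: w'_def distrib_right sum.distrib)
  qed
  have "w' (p i) = 0" if "i < M" "\<eta> i = -1" for i using at_p[OF that(1)] that(2) by simp
  then show ?thesis using pos mass by (intro exI[of _ w'] conjI) auto
qed

section \<open>One reduction step and its iteration\<close>

definition rate :: "nat \<Rightarrow> real" where
  "rate d = 1 / 2 + 3 / (2 * real d)"

text \<open>The critical level \<open>k\<close> is the last one whose net bound is at most an eighth
  of the number of atoms, which makes \<open>\<delta>\<close> of order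
  \<open>N powr (- 1 / d)\<close>. The threshold \<open>N0\<close> ensures that level 0 qualifies
  and that there are at least two pairs.\<close>

lemma reduction_step:
  assumes D: "DIM('a::euclidean_space) \<ge> 2"
  shows "\<exists>B\<ge>0. \<exists>N0\<ge>1. \<forall>(S::'a set) w. N0 \<le> card S \<and> prob_weights S w \<longrightarrow>
    reducible S w (511 * card S div 512) (B * card S powr (- rate (DIM('a) - 1)))"
proof -
  define d where "d = DIM('a) - 1"
  define C where "C = net_const DIM('a)"
  define K where "K = 16384 * exp 4 * cost_const d"
  \<comment> \<open>The sixth power gives \<open>\<Lambda> powr (- 1 / 6) = 1 / K\<close>, which is
    the smallness that the coloring demands.\<close>
  define \<Lambda> where "\<Lambda> = K ^ 6"
  define E where "E = 2 * (8 * C) powr (1 / real d)"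
  define B where "B = 800 * \<Lambda> * E powr (3 / 2)"
  define N0 where "N0 = max 16 (nat \<lceil>8 * C\<rceil>)"
  have d1: "d \<ge> 1" using D by (simp add: d_def)
  have C4: "C \<ge> 4" unfolding C_def using D by (intro net_const_ge_4) simp
  have K1: "K \<ge> 1"
  proof -
    have "6 * 1 * 1 * 1 * 2 \<le> 6 * fact (2 * d + 5) * 2 ^ (d + 2) * fact (d + 2) * (2::real)"
      by (intro mult_mono fact_ge_1 one_le_power) auto
    then have "1 \<le> cost_const d" unfolding cost_const_def by linarith
    moreover have "1 \<le> exp (4::real)" by simp
    ultimately have "1 * 1 * 1 \<le> 16384 * exp 4 * cost_const d" by (intro mult_mono) auto
    then show ?thesis by (simp add: K_def)
  qed
  have \<Lambda>1: "\<Lambda> \<ge> 1" using K1 by (simp add: \<Lambda>_def one_le_power)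
  have "\<Lambda> powr (- 1 / 6) = K powr (6 * (- 1 / 6))" using K1 unfolding \<Lambda>_def
    by (simp only: powr_powr[symmetric]) (simp add: powr_numeral)
  also have "\<dots> = 1 / K" using K1 by (simp add: powr_minus_divide)
  finally have \<Lambda>2: "16384 * exp 4 * cost_const d * \<Lambda> powr (- 1 / 6) \<le> 1" using K1 by (simp add: K_def[symmetric])
  show ?thesis
  proof (intro exI[of _ B] exI[of _ N0] conjI allI impI)
    show "B \<ge> 0" using \<Lambda>1 by (simp add: B_def)
    show "N0 \<ge> 1" by (simp add: N0_def)
    fix S :: "'a set" and w :: "'a \<Rightarrow> real"
    assume A: "N0 \<le> card S \<and> prob_weights S w"
    then have fS: "finite S" and Ss: "S \<subseteq> sphere 0 1" and N0: "N0 \<le> card S" and w0: "\<And>z. z \<in> S \<Longrightarrow> w z \<ge> 0" and w1: "(\<Sum>z\<in>S. w z) = 1"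
      by auto
    define N where "N = card S"
    have N16: "N \<ge> 16" and NC: "8 * C \<le> real N" using N0 unfolding N_def N0_def by linarith+
    have Npos: "real N > 0" using N16 by simp
    have "\<exists>k. 8 * C * 2 ^ (k * d) \<le> N \<and> \<not> 8 * C * 2 ^ (Suc k * d) \<le> N"
    proof -
      have "\<not> 8 * C * 2 ^ (N * d) \<le> N"
      proof -
        have "real N < 2 ^ N" using of_nat_less_two_power by blast
        also have "\<dots> \<le> 2 ^ (N * d)" using d1 by (intro power_increasing) auto
        also have "\<dots> \<le> 8 * C * 2 ^ (N * d)" using C4 by simp
        finally show ?thesis by simp
      qed
      moreover have "\<not> \<not> 8 * C * 2 ^ (0 * d) \<le> N" using NC by simp
      ultimately obtain k where "\<forall>i\<le>k. \<not> \<not> 8 * C * 2 ^ (i * d) \<le> N" "\<not> 8 * C * 2 ^ (Suc k * d) \<le> N"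
        using ex_least_nat_less[of "\<lambda>k. \<not> 8 * C * 2 ^ (k * d) \<le> N" N] by auto
      then show ?thesis by auto
    qed
    then obtain k where k: "8 * C * 2 ^ (k * d) \<le> N" and k': "real N < 8 * C * 2 ^ (Suc k * d)" by force
    define M where "M = N div 8"
    define \<delta> :: real where "\<delta> = (1 / 2) ^ k"
    have NM: "real N \<le> 16 * M" using M_def N16 by linarith
    have MN: "real M \<le> N" unfolding M_def by simp
    have \<delta>0: "\<delta> > 0" by (simp add: \<delta>_def)
    have M\<delta>: "M * \<delta> \<ge> 1"
    proof -
      have "(2::real) ^ k \<le> 2 ^ (k * d)" using d1 by (intro power_increasing) auto
      then have "8 * 4 * (2::real) ^ k \<le> 8 * C * 2 ^ (k * d)" using C4 by (intro mult_mono) auto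
      then have "32 * 2 ^ k \<le> 16 * real M" using k NM by linarith
      moreover have "(0::real) \<le> 2 ^ k" by simp
      ultimately have "2 ^ k \<le> real M" by linarith
      then have "2 ^ k * \<delta> \<le> M * \<delta>" using \<delta>0 by (intro mult_right_mono) auto
      moreover have "2 ^ k * \<delta> = 1" by (simp add: \<delta>_def power_one_over)
      ultimately show ?thesis by simp
    qed
    have \<delta>E: "\<delta> \<le> E * N powr (- 1 / d)"
    proof -
      have "real N * \<delta> ^ d < 8 * C * 2 ^ d"
      proof -
        have "real N * \<delta> ^ d < (8 * C * 2 ^ (Suc k * d)) * \<delta> ^ d" using k' \<delta>0 by (intro mult_strict_right_mono) auto
        also have "\<dots> = 8 * C * 2 ^ d" by (simp add: \<delta>_def power_add power_mult[symmetric] power_one_over)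
        finally show ?thesis .
      qed
      then have "\<delta> ^ d \<le> 2 ^ d * (8 * C) / N" using Npos by (simp add: field_simps)
      then have "(\<delta> ^ d) powr (1 / d) \<le> (2 ^ d * (8 * C) / N) powr (1 / d)" using \<delta>0 by (intro powr_mono2) auto
      moreover have "(\<delta> ^ d) powr (1 / d) = \<delta>" using \<delta>0 d1 by (simp add: powr_realpow[symmetric] powr_powr)
      moreover have "(2 ^ d * (8 * C) / N) powr (1 / d) = (2 ^ d) powr (1 / d) * (8 * C) powr (1 / d) / N powr (1 / d)"
        using C4 by (simp add: powr_divide powr_mult)
      moreover have "(2 ^ d :: real) powr (1 / d) = 2" using d1 by (simp add: powr_realpow[symmetric] powr_powr)
      ultimately show ?thesis by (simp add: E_def powr_minus_divide)
    qed
    have err: "2 / N * (400 * \<Lambda> * sqrt (M * \<delta> ^ 3)) \<le> B * N powr (- rate d)"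
    proof -
      have "sqrt (M * \<delta> ^ 3) = sqrt M * \<delta> powr (3 / 2)"
      proof -
        have "sqrt (\<delta> ^ 3) = (\<delta> powr 3) powr (1 / 2)" using \<delta>0 by (simp add: powr_half_sqrt powr_numeral)
        then show ?thesis by (simp add: real_sqrt_mult powr_powr)
      qed
      also have "\<dots> \<le> sqrt N * (E * N powr (- 1 / d)) powr (3 / 2)"
        using MN \<delta>0 \<delta>E by (intro mult_mono powr_mono2 real_sqrt_le_mono) auto
      also have "\<dots> = N powr (1 / 2) * (E powr (3 / 2) * N powr (- 3 / (2 * d)))"
        using Npos C4 by (simp add: powr_half_sqrt powr_mult powr_powr E_def mult.commute)
      finally have "2 / N * (400 * \<Lambda> * sqrt (M * \<delta> ^ 3)) \<le> 2 / N * (400 * \<Lambda> * (N powr (1 / 2) * (E powr (3 / 2) * N powr (- 3 / (2 * d)))))"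
        using \<Lambda>1 by (intro mult_left_mono) auto
      also have "\<dots> = B * (N powr (-1) * N powr (1 / 2) * N powr (- 3 / (2 * d)))"
        using Npos by (simp add: B_def powr_minus_divide)
      also have "N powr (-1) * N powr (1 / 2) * N powr (- 3 / (2 * d)) = N powr (- rate d)"
      proof -
        have "N powr (-1) * N powr (1 / 2) * N powr (- 3 / (2 * d)) = N powr (-1 + 1 / 2 + - 3 / (2 * d))"
          by (simp only: powr_add)
        then show ?thesis by (simp add: rate_def)
      qed
      finally show ?thesis .
    qed
    \<comment> \<open>Since the total mass is 1, at most half of the atoms weigh more than
      \<open>2 / N\<close>. On the others the rescaled weight \<open>f\<close> is at most 1.\<close>
    define P where "P = {z\<in>S. w z \<le> 2 / N}"
    define f where "f z = w z * N / 2" for z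
    have fP: "finite P" "P \<subseteq> sphere 0 1" "P \<subseteq> S" using fS Ss by (auto simp: P_def)
    have PN: "card P \<le> N" unfolding N_def using fP fS by (intro card_mono)
    have NP: "N \<le> 2 * card P"
    proof -
      have "card (S - P) * (2 / N) = (\<Sum>z\<in>S - P. 2 / N)" by simp
      also have "\<dots> \<le> (\<Sum>z\<in>S - P. w z)" by (intro sum_mono) (auto simp: P_def)
      also have "\<dots> \<le> (\<Sum>z\<in>S. w z)" using fS w0 by (intro sum_mono2) auto
      finally have "2 * real (card (S - P)) \<le> N" using w1 Npos by (simp add: field_simps)
      moreover have "card S = card P + card (S - P)" using fP fS by (metis card_Diff_subset card_mono le_add_diff_inverse)
      ultimately show ?thesis unfolding N_def by linarith
    qed
    have f01: "0 \<le> f z \<and> f z \<le> 1" if "z \<in> P" for z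
      using that w0 Npos by (auto simp: f_def P_def field_simps)
    obtain p q \<epsilon> where pq: "\<And>i. i < M \<Longrightarrow> p i \<in> P \<and> q i \<in> P \<and> f (p i) \<le> f (q i) \<and> \<epsilon> i \<in> {-1, 0, 1::real}"
      and inj: "inj_on p {..<M}" "inj_on q {..<M}" "p ` {..<M} \<inter> q ` {..<M} = {}"
      and cnt: "M \<le> 16 * card {i\<in>{..<M}. \<epsilon> i \<noteq> 0}"
      and disc: "\<And>x. x \<in> sphere 0 1 \<Longrightarrow> \<bar>\<Sum>i<M. \<epsilon> i * f (p i) * pairdiff (p i) (q i) x\<bar> \<le> 400 * \<Lambda> * sqrt (M * \<delta> ^ 3)"
      using scale_discrepancy[where f = f, OF d1[unfolded d_def] fP(1,2) PN NP f01 k[unfolded C_def d_def] M_def N16 \<delta>_def M\<delta> \<Lambda>1 \<Lambda>2[unfolded d_def]]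
      by blast
    define A where "A e = {i\<in>{..<M}. \<epsilon> i = e}" for e
    have "{i\<in>{..<M}. \<epsilon> i \<noteq> 0} \<subseteq> A 1 \<union> A (-1)" using pq by (force simp: A_def)
    then have "card {i\<in>{..<M}. \<epsilon> i \<noteq> 0} \<le> card (A 1 \<union> A (-1))" by (rule card_mono[rotated]) (simp add: A_def)
    also have "\<dots> \<le> card (A 1) + card (A (-1))" by (rule card_Un_le)
    finally have "card {i\<in>{..<M}. \<epsilon> i \<noteq> 0} \<le> card (A 1) + card (A (-1))" .
    then have cA: "M \<le> 16 * (card (A 1) + card (A (-1)))" by (rule order_trans[OF cnt mult_le_mono2])
    \<comment> \<open>Reversing all signs preserves the discrepancy bounds; it is done when needed
      to make -1, the sign that empties an atom, at least as frequent as 1.\<close>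
    define sg :: real where "sg = (if card (A 1) \<le> card (A (-1)) then 1 else -1)"
    define \<eta> where "\<eta> i = sg * \<epsilon> i" for i
    define Z where "Z = {i\<in>{..<M}. \<eta> i = -1}"
    have "Z = (if card (A 1) \<le> card (A (-1)) then A (-1) else A 1)" by (auto simp: Z_def A_def \<eta>_def sg_def)
    then have cZ: "M \<le> 32 * card Z" using cA by (auto split: if_splits)
    have tm: "p i \<in> S \<and> q i \<in> S \<and> w (p i) \<le> w (q i) \<and> \<eta> i \<in> {-1, 0, 1}" if "i < M" for i
      using pq[OF that] fP(3) Npos by (auto simp: f_def \<eta>_def sg_def divide_right_mono)
    have "\<exists>w'. (\<forall>z\<in>S. w' z \<ge> 0) \<and> (\<forall>i<M. \<eta> i = -1 \<longrightarrow> w' (p i) = 0) \<and>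
      (\<forall>F. (\<Sum>z\<in>S. w' z * F z) = (\<Sum>z\<in>S. w z * F z) + (\<Sum>i<M. \<eta> i * w (p i) * (F (p i) - F (q i))))"
      by (rule transfer_mass[OF fS w0 tm inj])
    then obtain w' where W: "\<forall>z\<in>S. w' z \<ge> 0" "\<forall>i<M. \<eta> i = -1 \<longrightarrow> w' (p i) = 0"
      "\<forall>F. (\<Sum>z\<in>S. w' z * F z) = (\<Sum>z\<in>S. w z * F z) + (\<Sum>i<M. \<eta> i * w (p i) * (F (p i) - F (q i)))"
      by (elim exE conjE)
    note w' = W(1)[rule_format] W(2)[rule_format] W(3)[rule_format]
    define S' where "S' = S - p ` Z"
    have red: "(\<Sum>z\<in>S'. w' z * F z) = (\<Sum>z\<in>S. w' z * F z)" for F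
      by (rule sum.mono_neutral_left) (use fS w'(2) in \<open>auto simp: S'_def Z_def\<close>)
    have pZ: "p ` Z \<subseteq> S" "card (p ` Z) = card Z"
      using pq fP(3) inj(1) by (auto simp: Z_def intro!: card_image inj_on_subset[OF inj(1)])
    have cS': "card S' = N - card Z" unfolding S'_def N_def using pZ fS by (simp add: card_Diff_subset finite_subset)
    show "reducible S w (511 * card S div 512) (B * card S powr (- rate (DIM('a) - 1)))"
    proof (intro exI[of _ S'] exI[of _ w'] conjI ballI)
      show "S' \<subseteq> S" by (auto simp: S'_def)
      show "w' z \<ge> 0" if "z \<in> S'" for z using that w'(1) by (auto simp: S'_def)
      show "(\<Sum>z\<in>S'. w' z) = 1" using red[of "\<lambda>_. 1"] w'(3)[of "\<lambda>_. 1"] w1 by simp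
      have "N \<le> 512 * card Z" using NM cZ by linarith
      then show "card S' \<le> 511 * card S div 512" using cS' N_def by linarith
      fix x :: 'a assume x: "x \<in> sphere 0 1"
      have "support_fun S' w' x - support_fun S w x = (\<Sum>i<M. \<eta> i * w (p i) * pairdiff (p i) (q i) x)"
        unfolding red w'(3) pairdiff_def by simp
      also have "\<dots> = (sg * 2 / N) * (\<Sum>i<M. \<epsilon> i * f (p i) * pairdiff (p i) (q i) x)"
        unfolding sum_distrib_left using Npos by (intro sum.cong) (auto simp: \<eta>_def f_def)
      finally have eq: "support_fun S' w' x - support_fun S w x = (sg * 2 / N) * (\<Sum>i<M. \<epsilon> i * f (p i) * pairdiff (p i) (q i) x)" .
      have "\<bar>support_fun S w x - support_fun S' w' x\<bar> = \<bar>sg * 2 / N\<bar> * \<bar>\<Sum>i<M. \<epsilon> i * f (p i) * pairdiff (p i) (q i) x\<bar>"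
        by (subst abs_minus_commute) (simp only: eq abs_mult)
      also have "\<bar>sg * 2 / N\<bar> = 2 / N" using Npos by (simp add: sg_def)
      also have "2 / N * \<bar>\<Sum>i<M. \<epsilon> i * f (p i) * pairdiff (p i) (q i) x\<bar> \<le> 2 / N * (400 * \<Lambda> * sqrt (M * \<delta> ^ 3))"
        using disc[OF x] by (intro mult_left_mono) auto
      also have "\<dots> \<le> B * N powr (- rate d)" by (rule err)
      finally show "\<bar>support_fun S w x - support_fun S' w' x\<bar> \<le> B * card S powr (- rate (DIM('a) - 1))"
        unfolding N_def d_def .
    qed
  qed
qed

text \<open>The induction carries the telescoping error
  \<open>A * (n powr (- s) - card S powr (- s))\<close> plus \<open>B * n powr (- s)\<close> for the
  last step, the one that reaches at most \<open>n\<close> atoms. One step multiplies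
  \<open>card S powr (- s)\<close> by at least \<open>\<gamma>\<close>, and
  \<open>A * \<gamma> = A + B\<close> lets the telescoping part absorb the error of every earlier
  step.\<close>

lemma finite_support_reduction:
  assumes D: "DIM('a::euclidean_space) \<ge> 2"
  shows "\<exists>A\<ge>0. \<forall>n\<ge>1. \<forall>(S::'a set) w. prob_weights S w \<longrightarrow>
    reducible S w n (A * n powr (- rate (DIM('a) - 1)))"
proof -
  define s where "s = rate (DIM('a) - 1)"
  have s0: "s > 0" by (simp add: s_def rate_def add_pos_nonneg)
  obtain B N0 where B0: "B \<ge> 0" and N0: "N0 \<ge> 1" and step0: "\<forall>(S::'a set) w. N0 \<le> card S \<and> prob_weights S w \<longrightarrow>
    reducible S w (511 * card S div 512) (B * card S powr (- s))"
    using reduction_step[OF D] unfolding s_def[symmetric] by (elim exE conjE)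
  have step: "reducible S w (511 * card S div 512) (B * card S powr (- s))"
    if "finite S" "S \<subseteq> sphere 0 1" "N0 \<le> card S" "\<forall>z\<in>S. w z \<ge> 0" "(\<Sum>z\<in>S. w z) = 1" for S :: "'a set" and w
    by (rule step0[THEN spec, THEN spec, THEN mp]) (intro conjI that)
  define \<gamma> :: real where "\<gamma> = (512 / 511) powr s"
  have \<gamma>1: "\<gamma> > 1" unfolding \<gamma>_def using s0 by (intro gr_one_powr) auto
  define A where "A = B / (\<gamma> - 1)"
  have A0: "A \<ge> 0" using B0 \<gamma>1 by (simp add: A_def)
  have large: "reducible S w n (A * (n powr (- s) - card S powr (- s)) + B * n powr (- s))"
    if "finite S" "S \<subseteq> sphere 0 1" "n < card S" "\<forall>z\<in>S. w z \<ge> 0" "(\<Sum>z\<in>S. w z) = 1" and n: "N0 \<le> n" for S :: "'a set" and w n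
    using that(1-5)
  proof (induction "card S" arbitrary: S w rule: less_induct)
    case less
    have nn: "1 \<le> n" using n N0 by simp
    have "N0 \<le> card S" using less.prems(3) n by simp
    then obtain S1 w1 where S1: "S1 \<subseteq> S" "\<forall>z\<in>S1. w1 z \<ge> 0" "(\<Sum>z\<in>S1. w1 z) = 1" "card S1 \<le> 511 * card S div 512"
      "\<And>x. x \<in> sphere 0 1 \<Longrightarrow> \<bar>support_fun S w x - support_fun S1 w1 x\<bar> \<le> B * card S powr (- s)"
      using step[OF less.prems(1,2) _ less.prems(4,5)] by blast
    have mono: "card S powr (- s) \<le> n powr (- s)"
      using less.prems(3) nn s0 by (intro powr_mono2') auto
    show ?case
    proof (cases "card S1 \<le> n")
      case True
      have "B * card S powr (- s) \<le> A * (n powr (- s) - card S powr (- s)) + B * n powr (- s)"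
      proof -
        have "B * card S powr (- s) \<le> B * n powr (- s)" using mono B0 by (rule mult_left_mono)
        moreover have "0 \<le> A * (n powr (- s) - card S powr (- s))" using mono A0 by simp
        ultimately show ?thesis by linarith
      qed
      then show ?thesis using S1 True by (intro exI[of _ S1] exI[of _ w1]) force
    next
      case False
      have lt: "card S1 < card S" using S1(4) less.prems(3) by linarith
      have fS1: "finite S1" "S1 \<subseteq> sphere 0 1" using S1(1) less.prems finite_subset by auto
      obtain S2 w2 where S2: "S2 \<subseteq> S1" "\<forall>z\<in>S2. w2 z \<ge> 0" "(\<Sum>z\<in>S2. w2 z) = 1" "card S2 \<le> n"
        "\<And>x. x \<in> sphere 0 1 \<Longrightarrow> \<bar>support_fun S1 w1 x - support_fun S2 w2 x\<bar> \<le> A * (n powr (- s) - card S1 powr (- s)) + B * n powr (- s)"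
        using less.hyps[OF lt fS1 _ S1(2,3)] False by auto
      have c1: "card S1 > 0" using False nn by simp
      have "\<gamma> * card S powr (- s) \<le> card S1 powr (- s)"
      proof -
        have "real (card S1) \<le> (511 / 512) * card S" using S1(4) by linarith
        then have "((511 / 512) * card S) powr (- s) \<le> card S1 powr (- s)"
          using c1 s0 by (intro powr_mono2') auto
        moreover have "((511 / 512) * card S) powr (- s) = (511 / 512) powr (- s) * card S powr (- s)"
          by (rule powr_mult)
        moreover have "(511 / 512 :: real) powr (- s) = \<gamma>" unfolding \<gamma>_def by (simp add: powr_minus_divide powr_divide)
        ultimately show ?thesis by simp
      qed
      then have "A * (\<gamma> * card S powr (- s)) \<le> A * card S1 powr (- s)" using A0 by (rule mult_left_mono)
      moreover have "A * (\<gamma> * card S powr (- s)) = A * card S powr (- s) + B * card S powr (- s)"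
      proof -
        have "A * \<gamma> = A + B" using \<gamma>1 by (simp add: A_def field_simps)
        then show ?thesis by (metis distrib_right mult.assoc)
      qed
      ultimately have key: "A * (n powr (- s) - card S1 powr (- s)) + B * card S powr (- s) \<le> A * (n powr (- s) - card S powr (- s))"
        by (simp add: right_diff_distrib)
      show ?thesis
      proof (intro exI[of _ S2] exI[of _ w2] conjI ballI)
        fix x :: 'a assume x: "x \<in> sphere 0 1"
        show "\<bar>support_fun S w x - support_fun S2 w2 x\<bar> \<le> A * (n powr (- s) - card S powr (- s)) + B * n powr (- s)"
          using S1(5)[OF x] S2(5)[OF x] key by linarith
      qed (use S1 S2 in auto)
    qed
  qed
  \<comment> \<open>The summand \<open>N0 powr s\<close> covers \<open>n < N0\<close>, where a
    single atom already has error at most 1.\<close>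
  define A' where "A' = A + B + N0 powr s"
  show ?thesis
  proof (intro exI[of _ A'] conjI allI impI)
    show "A' \<ge> 0" using A0 B0 by (simp add: A'_def)
    fix n :: nat and S :: "'a set" and w :: "'a \<Rightarrow> real"
    assume n: "1 \<le> n" and H: "prob_weights S w"
    have A'n: "A' * n powr (- s) = A * n powr (- s) + B * n powr (- s) + N0 powr s * n powr (- s)"
      by (simp add: A'_def distrib_right)
    have np: "A * n powr (- s) \<ge> 0" "B * n powr (- s) \<ge> 0" "N0 powr s * n powr (- s) \<ge> 0" using A0 B0 by auto
    consider (a) "card S \<le> n" | (b) "n < card S" "N0 \<le> n" | (c) "n < N0" by linarith
    then show "reducible S w n (A' * n powr (- rate (DIM('a) - 1)))"
      unfolding s_def[symmetric]
    proof cases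
      case a
      then show "reducible S w n (A' * n powr (- s))"
        using H np A'n by (intro exI[of _ S] exI[of _ w]) simp
    next
      case b
      then obtain S' w' where S': "S' \<subseteq> S" "\<forall>z\<in>S'. w' z \<ge> 0" "(\<Sum>z\<in>S'. w' z) = 1" "card S' \<le> n" and
        e: "\<And>x. x \<in> sphere 0 1 \<Longrightarrow> \<bar>support_fun S w x - support_fun S' w' x\<bar> \<le> A * (n powr (- s) - card S powr (- s)) + B * n powr (- s)"
        using large[of S n w] H by blast
      have "A * (n powr (- s) - card S powr (- s)) \<le> A * n powr (- s)" using A0 by (intro mult_left_mono) auto
      then have le: "A * (n powr (- s) - card S powr (- s)) + B * n powr (- s) \<le> A' * n powr (- s)" using A'n np by linarith
      show "reducible S w n (A' * n powr (- s))"
      proof (intro exI[of _ S'] exI[of _ w'] conjI ballI)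
        fix x :: 'a assume "x \<in> sphere 0 1"
        then show "\<bar>support_fun S w x - support_fun S' w' x\<bar> \<le> A' * n powr (- s)" using e[of x] le by linarith
      qed (use S' in auto)
    next
      case c
      have "S \<noteq> {}" using H by auto
      then obtain z where z: "z \<in> S" by blast
      have "(1::real) \<le> (N0 / n) powr s" using c n s0 by (intro ge_one_powr_ge_zero) auto
      also have "\<dots> = N0 powr s * n powr (- s)" by (simp add: powr_divide powr_minus_divide)
      finally have one: "1 \<le> A' * n powr (- s)" using A'n np by linarith
      have bd: "0 \<le> \<bar>x \<bullet> y\<bar> \<and> \<bar>x \<bullet> y\<bar> \<le> 1" if "x \<in> sphere 0 1" "y \<in> sphere 0 1" for x y :: 'a
        using Cauchy_Schwarz_ineq2[of x y] that by simp
      show "reducible S w n (A' * n powr (- s))"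
      proof (intro exI[of _ "{z}"] exI[of _ "\<lambda>_. 1"] conjI ballI)
        fix x :: 'a assume x: "x \<in> sphere 0 1"
        have "support_fun S w x \<le> (\<Sum>y\<in>S. w y * 1)" using H bd[OF x] by (intro sum_mono mult_left_mono) auto
        then have "support_fun S w x \<le> 1" using H by simp
        moreover have "0 \<le> support_fun S w x" using H by (intro sum_nonneg) auto
        moreover have "0 \<le> \<bar>x \<bullet> z\<bar> \<and> \<bar>x \<bullet> z\<bar> \<le> 1" using bd[OF x] z H by blast
        ultimately show "\<bar>support_fun S w x - (\<Sum>z\<in>{z}. 1 * \<bar>x \<bullet> z\<bar>)\<bar> \<le> A' * n powr (- s)"
          using one by simp
      qed (use z n in auto)
    qed
  qed
qed

section \<open>Measures on the sphere\<close>

lemma discrete_sphere_prob: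
  fixes S :: "'a::euclidean_space set"
  assumes fS: "finite S" "S \<subseteq> sphere 0 1" and w: "\<And>z. z \<in> S \<Longrightarrow> w z \<ge> 0" "(\<Sum>z\<in>S. w z) = 1"
  shows "\<exists>\<tau>. sphere_prob \<tau> \<and> emeasure \<tau> (sphere 0 1 - S) = 0 \<and>
    (\<forall>x. (\<integral>y. \<bar>x \<bullet> y\<bar> \<partial>\<tau>) = support_fun S w x)"
proof -
  define R where "R = restrict_space borel (sphere (0::'a) 1)"
  define Q where "Q = point_measure S (\<lambda>z. ennreal (w z))"
  define \<tau> where "\<tau> = distr Q R (\<lambda>z. z)"
  have spR: "space R = sphere 0 1" by (simp add: R_def space_restrict_space)
  interpret Q: prob_space Q
    unfolding Q_def using fS w by (intro prob_space_point_measure) auto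
  have spQ: "space Q = S" by (simp add: Q_def space_point_measure)
  have meas: "(\<lambda>z. z) \<in> measurable Q R"
    unfolding Q_def measurable_point_measure_eq1 using fS(2) spR by (auto simp: measurable_def)
  have "prob_space \<tau>" unfolding \<tau>_def using meas by (rule Q.prob_space_distr)
  moreover have "sets \<tau> = sets R" by (simp add: \<tau>_def)
  ultimately have 1: "sphere_prob \<tau>" unfolding sphere_prob_def R_def by simp
  have "S \<in> sets borel" using fS(1) by (intro borel_closed finite_imp_closed)
  then have "sphere 0 1 - S \<in> sets borel" by (intro sets.Diff[OF borel_closed[OF closed_sphere]])
  then have "sphere 0 1 - S \<in> sets R" unfolding R_def by (auto simp: sets_restrict_space)
  then have "emeasure \<tau> (sphere 0 1 - S) = emeasure Q ((\<lambda>z. z) -` (sphere 0 1 - S) \<inter> space Q)"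
    unfolding \<tau>_def by (rule emeasure_distr[OF meas])
  also have "(\<lambda>z. z) -` (sphere 0 1 - S) \<inter> space Q = {}" using spQ by auto
  finally have 2: "emeasure \<tau> (sphere 0 1 - S) = 0" by simp
  have "(\<integral>y. \<bar>x \<bullet> y\<bar> \<partial>\<tau>) = support_fun S w x" for x
  proof -
    have "(\<lambda>y. \<bar>x \<bullet> y\<bar>) \<in> borel_measurable R" unfolding R_def by (intro measurable_restrict_space1) measurable
    then have "(\<integral>y. \<bar>x \<bullet> y\<bar> \<partial>\<tau>) = (\<integral>y. \<bar>x \<bullet> y\<bar> \<partial>Q)" unfolding \<tau>_def by (intro integral_distr meas)
    also have "\<dots> = support_fun S w x" unfolding Q_def
      using fS w by (subst lebesgue_integral_point_measure_finite) auto
    finally show ?thesis .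
  qed
  then show ?thesis using 1 2 by blast
qed

text \<open>The sphere is cut into measurable cells of radius \<open>r\<close> around the points of
  a finite net, and the mass of each cell moves to its net point. The integrand is 1-Lipschitz in
  \<open>y\<close>, so the error is at most \<open>r\<close> for all \<open>x\<close>. The number of
  atoms is left open, since the bound of the later reduction does not depend on it.\<close>

lemma discretize_sphere_prob:
  fixes \<tau> :: "'a::euclidean_space measure"
  assumes \<tau>: "sphere_prob \<tau>" and r: "0 < r" "r \<le> 1"
  shows "\<exists>S w. prob_weights S w \<and>
    (\<forall>x\<in>sphere 0 1. \<bar>(\<integral>y. \<bar>x \<bullet> y\<bar> \<partial>\<tau>) - support_fun S w x\<bar> \<le> r)"
proof -
  interpret prob_space \<tau> using \<tau> by (simp add: sphere_prob_def)
  have sets: "sets \<tau> = sets (restrict_space borel (sphere (0::'a) 1))" using \<tau> by (simp add: sphere_prob_def)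
  have sp: "space \<tau> = sphere 0 1" using sets_eq_imp_space_eq[OF sets] by (simp add: space_restrict_space)
  obtain S where S: "finite S" "S \<subseteq> sphere (0::'a) 1" "\<And>x. x \<in> sphere 0 1 \<Longrightarrow> \<exists>z\<in>S. norm (x - z) \<le> r"
    \<comment> \<open>With an empty index set no sign switches are counted, and a plain metric net
      remains.\<close>
    using sphere_net[of "{}::nat set" r "\<lambda>_. 0 :: 'a"] r by auto
  obtain ts where ts: "set ts = S" "distinct ts" using finite_distinct_list[OF S(1)] by blast
  define m where "m = length ts"
  \<comment> \<open>Beyond the length of the list the sets are empty, which makes an infinite
    sequence for \<open>disjointed\<close>.\<close>
  define U where "U i = (if i < m then {x\<in>sphere 0 1. norm (x - ts ! i) \<le> r} else {})" for i
  have U: "U i \<in> sets \<tau>" for i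
  proof -
    have "U i = sphere 0 1 \<inter> (if i < m then cball (ts ! i) r else {})" by (auto simp: U_def dist_norm norm_minus_commute)
    moreover have "(if i < m then cball (ts ! i) r else {}) \<in> sets borel" by auto
    ultimately show ?thesis unfolding sets sets_restrict_space by blast
  qed
  define V where "V = disjointed U"
  have V: "V i \<in> sets \<tau>" for i unfolding V_def using sets.range_disjointed_sets[of U \<tau>] U by blast
  have VU: "V i \<subseteq> U i" for i unfolding V_def by (rule disjointed_subset)
  have dis: "disjoint_family V" unfolding V_def by (rule disjoint_family_disjointed)
  have cov: "\<exists>i<m. y \<in> V i" if y: "y \<in> sphere 0 1" for y
  proof -
    obtain z where z: "z \<in> S" "norm (y - z) \<le> r" using S(3)[OF y] by blast
    then obtain i where "i < m" "ts ! i = z" using ts(1) unfolding m_def by (metis in_set_conv_nth)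
    then have "y \<in> U i" using y z by (simp add: U_def)
    then have "y \<in> (\<Union>i. V i)" unfolding V_def UN_disjointed_eq by blast
    then obtain j where j: "y \<in> V j" by blast
    then have "j < m" using VU[of j] by (auto simp: U_def split: if_splits)
    then show ?thesis using j by blast
  qed
  have ind: "(\<Sum>i<m. indicator (V i) y * c i) = c j" if "y \<in> V j" "j < m" for y j and c :: "nat \<Rightarrow> real"
  proof -
    have "(\<Sum>i<m. indicator (V i) y * c i) = (\<Sum>i\<in>{j}. indicator (V i) y * c i)"
    proof (rule sum.mono_neutral_right)
      show "\<forall>i\<in>{..<m} - {j}. indicator (V i) y * c i = 0"
      proof
        fix i assume "i \<in> {..<m} - {j}"
        then have "y \<notin> V i" using dis that(1) unfolding disjoint_family_on_def by auto
        then show "indicator (V i) y * c i = 0" by simp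
      qed
    qed (use that in auto)
    then show ?thesis using that by simp
  qed
  have intV: "integrable \<tau> (\<lambda>y. indicator (V i) y * c :: real)" for i c
    using V by (intro integrable_mult_left) (auto simp: emeasure_eq_measure)
  have sumV: "(\<integral>y. (\<Sum>i<m. indicator (V i) y * c i) \<partial>\<tau>) = (\<Sum>i<m. measure \<tau> (V i) * c i)" for c :: "nat \<Rightarrow> real"
  proof -
    have "(\<integral>y. (\<Sum>i<m. indicator (V i) y * c i) \<partial>\<tau>) = (\<Sum>i<m. \<integral>y. indicator (V i) y * c i \<partial>\<tau>)"
      by (rule Bochner_Integration.integral_sum) (rule intV)
    also have "\<dots> = (\<Sum>i<m. measure \<tau> (V i) * c i)"
    proof (rule sum.cong[OF refl])
      fix i
      have "(\<integral>y. indicator (V i) y * c i \<partial>\<tau>) = (\<integral>y. indicator (V i) y \<partial>\<tau>) * c i" by (rule integral_mult_left_zero)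
      also have "(\<integral>y. indicator (V i) y \<partial>\<tau>) = measure \<tau> (V i \<inter> space \<tau>)" by (rule Bochner_Integration.integral_indicator)
      also have "V i \<inter> space \<tau> = V i" using sets.sets_into_space[OF V[of i]] by (rule Int_absorb2)
      finally show "(\<integral>y. indicator (V i) y * c i \<partial>\<tau>) = measure \<tau> (V i) * c i" .
    qed
    finally show ?thesis .
  qed
  have "(\<Sum>i<m. measure \<tau> (V i) * 1) = (\<integral>y. (\<Sum>i<m. indicator (V i) y * 1) \<partial>\<tau>)" by (rule sumV[symmetric])
  also have "\<dots> = (\<integral>y. 1 \<partial>\<tau>)"
  proof (rule Bochner_Integration.integral_cong[OF refl])
    fix y assume "y \<in> space \<tau>"
    then obtain j where j: "j < m" "y \<in> V j" using cov[of y] unfolding sp by auto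
    show "(\<Sum>i<m. indicator (V i) y * 1) = (1::real)" by (rule ind[OF j(2,1)])
  qed
  finally have tot: "(\<Sum>i<m. measure \<tau> (V i)) = 1" by (simp add: prob_space)
  define w where "w z = measure \<tau> (V (THE i. i < m \<and> ts ! i = z))" for z
  have wt: "w (ts ! i) = measure \<tau> (V i)" if "i < m" for i
  proof -
    have "(THE j. j < m \<and> ts ! j = ts ! i) = i"
      using that ts(2) unfolding m_def by (intro the_equality) (auto simp: nth_eq_iff_index_eq)
    then show ?thesis by (simp add: w_def)
  qed
  have reS: "(\<Sum>z\<in>S. F z) = (\<Sum>i<m. F (ts ! i))" for F :: "'a \<Rightarrow> real"
  proof -
    have "bij_betw ((!) ts) {..<m} S" using bij_betw_nth[OF ts(2), of "{..<m}" S] ts(1) by (simp add: m_def)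
    then show ?thesis by (rule sum.reindex_bij_betw[symmetric])
  qed
  show ?thesis
  proof (intro exI[of _ S] exI[of _ w] conjI ballI)
    show "finite S" "S \<subseteq> sphere 0 1" by fact+
    show "w z \<ge> 0" for z by (simp add: w_def)
    show "(\<Sum>z\<in>S. w z) = 1" unfolding reS using tot wt by simp
    fix x :: 'a assume x: "x \<in> sphere 0 1"
    have meas: "(\<lambda>y. \<bar>x \<bullet> y\<bar>) \<in> borel_measurable \<tau>"
      unfolding measurable_cong_sets[OF sets refl] by (intro measurable_restrict_space1) measurable
    have int: "integrable \<tau> (\<lambda>y. \<bar>x \<bullet> y\<bar>)"
    proof (rule integrable_const_bound[where B = 1])
      show "AE y in \<tau>. norm \<bar>x \<bullet> y\<bar> \<le> 1"
      proof (rule AE_I2)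
        fix y assume "y \<in> space \<tau>"
        then have "norm y = 1" unfolding sp by simp
        then show "norm \<bar>x \<bullet> y\<bar> \<le> 1" using Cauchy_Schwarz_ineq2[of x y] x by simp
      qed
    qed (rule meas)
    let ?s = "\<lambda>y. (\<Sum>i<m. indicator (V i) y * \<bar>x \<bullet> ts ! i\<bar>)"
    have ints: "integrable \<tau> ?s" by (intro Bochner_Integration.integrable_sum intV)
    have bd: "\<bar>\<bar>x \<bullet> y\<bar> - ?s y\<bar> \<le> r" if y: "y \<in> space \<tau>" for y
    proof -
      obtain j where j: "j < m" "y \<in> V j" using cov[OF y[unfolded sp]] by (elim exE conjE)
      have "norm (y - ts ! j) \<le> r" using VU[of j] j by (auto simp: U_def)
      then have "\<bar>\<bar>x \<bullet> y\<bar> - \<bar>x \<bullet> ts ! j\<bar>\<bar> \<le> r" using abs_inner_diff_le[of x y "ts ! j"] x by simp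
      then show ?thesis using ind[OF j(2,1), of "\<lambda>i. \<bar>x \<bullet> ts ! i\<bar>"] by simp
    qed
    have "support_fun S w x = (\<integral>y. ?s y \<partial>\<tau>)"
      unfolding sumV reS using wt by simp
    then have "\<bar>(\<integral>y. \<bar>x \<bullet> y\<bar> \<partial>\<tau>) - support_fun S w x\<bar> = \<bar>\<integral>y. \<bar>x \<bullet> y\<bar> - ?s y \<partial>\<tau>\<bar>"
      using int ints by (simp only: Bochner_Integration.integral_diff)
    also have "\<dots> \<le> (\<integral>y. \<bar>\<bar>x \<bullet> y\<bar> - ?s y\<bar> \<partial>\<tau>)" by (rule integral_abs_bound)
    also have "\<dots> \<le> (\<integral>y. r \<partial>\<tau>)"
      by (intro integral_mono integrable_abs Bochner_Integration.integrable_diff[OF int ints] integrable_const) (rule bd)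
    also have "\<dots> = r" by (simp add: prob_space)
    finally show "\<bar>(\<integral>y. \<bar>x \<bullet> y\<bar> \<partial>\<tau>) - support_fun S w x\<bar> \<le> r" .
  qed
qed

theorem theorem1:
  assumes "DIM('a::euclidean_space) \<ge> 2"
  shows "\<exists>C::real. \<forall>n::nat. n \<ge> 1 \<longrightarrow> (\<forall>\<tau>::'a measure. sphere_prob \<tau> \<longrightarrow>
           (\<exists>\<tau>'. sphere_prob \<tau>' \<and>
              (\<exists>S. finite S \<and> card S \<le> n \<and> S \<subseteq> sphere 0 1 \<and> emeasure \<tau>' (sphere 0 1 - S) = 0) \<and>
              (\<forall>x\<in>sphere (0::'a) 1.
                 \<bar>(\<integral>y. \<bar>x \<bullet> y\<bar> \<partial>\<tau>) - (\<integral>y. \<bar>x \<bullet> y\<bar> \<partial>\<tau>')\<bar>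
                   \<le> C * real n powr (- 1/2 - 3 / (2 * real (DIM('a) - 1))))))"
proof -
  define s where "s = rate (DIM('a) - 1)"
  have s0: "s \<ge> 0" by (simp add: s_def rate_def)
  have s: "- 1/2 - 3 / (2 * real (DIM('a) - 1)) = - s" by (simp add: s_def rate_def)
  obtain A where A0: "A \<ge> 0" and A: "\<forall>n\<ge>1. \<forall>(S::'a set) w. prob_weights S w \<longrightarrow>
    reducible S w n (A * n powr (- s))"
    using finite_support_reduction[OF assms] unfolding s_def[symmetric] by (elim exE conjE)
  show ?thesis unfolding s
  \<comment> \<open>Discretizing with precision \<open>n powr (- s)\<close> adds 1 to the
    constant.\<close>
  proof (intro exI[of _ "A + 1"] allI impI)
    fix n :: nat and \<tau> :: "'a measure"
    assume n: "n \<ge> 1" and \<tau>: "sphere_prob \<tau>"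
    have r: "0 < real n powr (- s)" "real n powr (- s) \<le> 1"
      using n s0 powr_mono[of "- s" 0 "real n"] by auto
    obtain S w where S: "finite S" "S \<subseteq> sphere 0 1" "\<forall>z\<in>S. w z \<ge> 0" "(\<Sum>z\<in>S. w z) = 1"
      and e1: "\<forall>x\<in>sphere 0 1. \<bar>(\<integral>y. \<bar>x \<bullet> y\<bar> \<partial>\<tau>) - support_fun S w x\<bar> \<le> real n powr (- s)"
      using discretize_sphere_prob[OF \<tau> r] by (elim exE conjE)
    have "reducible S w n (A * n powr (- s))"
      by (rule A[THEN spec, THEN mp, OF n, THEN spec, THEN spec, THEN mp]) (intro conjI S)
    then obtain S' w' where S': "S' \<subseteq> S" "\<forall>z\<in>S'. w' z \<ge> 0" "(\<Sum>z\<in>S'. w' z) = 1" "card S' \<le> n"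
      and e2: "\<forall>x\<in>sphere 0 1. \<bar>support_fun S w x - support_fun S' w' x\<bar> \<le> A * n powr (- s)"
      by (elim exE conjE)
    have fS': "finite S'" "S' \<subseteq> sphere 0 1" using S' S finite_subset by auto
    obtain \<tau>' where \<tau>': "sphere_prob \<tau>'" "emeasure \<tau>' (sphere 0 1 - S') = 0"
      "\<And>x. (\<integral>y. \<bar>x \<bullet> y\<bar> \<partial>\<tau>') = support_fun S' w' x"
      using discrete_sphere_prob[OF fS' S'(2)[THEN bspec] S'(3)] by blast
    show "\<exists>\<tau>'. sphere_prob \<tau>' \<and>
        (\<exists>S. finite S \<and> card S \<le> n \<and> S \<subseteq> sphere 0 1 \<and> emeasure \<tau>' (sphere 0 1 - S) = 0) \<and>
        (\<forall>x\<in>sphere (0::'a) 1. \<bar>(\<integral>y. \<bar>x \<bullet> y\<bar> \<partial>\<tau>) - (\<integral>y. \<bar>x \<bullet> y\<bar> \<partial>\<tau>')\<bar> \<le> (A + 1) * real n powr (- s))"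
    proof (intro exI[of _ \<tau>'] conjI ballI)
      show "sphere_prob \<tau>'" by (rule \<tau>')
      show "\<exists>S. finite S \<and> card S \<le> n \<and> S \<subseteq> sphere 0 1 \<and> emeasure \<tau>' (sphere 0 1 - S) = 0"
        using fS' S'(4) \<tau>'(2) by blast
      fix x :: 'a assume x: "x \<in> sphere 0 1"
      have "\<bar>(\<integral>y. \<bar>x \<bullet> y\<bar> \<partial>\<tau>) - support_fun S' w' x\<bar> \<le> real n powr (- s) + A * n powr (- s)"
        using bspec[OF e1 x] bspec[OF e2 x] by linarith
      then show "\<bar>(\<integral>y. \<bar>x \<bullet> y\<bar> \<partial>\<tau>) - (\<integral>y. \<bar>x \<bullet> y\<bar> \<partial>\<tau>')\<bar> \<le> (A + 1) * real n powr (- s)"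
        unfolding \<tau>'(3) by (simp add: algebra_simps)
    qed
  qed
qed

end
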